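(* Let $q\ge s\ge 3$ be integers and $\mathcal D=\{(1,\{2,\ldots,s\})\}$. Let $R$ be a polynomial ring in finitely many variables over a field $\mathsf k$, and let $I\subseteq R$ be an ideal minimally generated by $q$ square-free monomials $m_1,\ldots,m_q$ satisfying the divisibility relation in $\mathcal D$, i.e. $m_1\mid \operatorname{lcm}(m_2,\ldots,m_s)$. Then the cell complex $\mathbb L^2_{q,\mathcal D}$ (defined in the context; it depends on $q$ and $s$ but not on $I$) has $\binom{q+1}{2}$ vertices and, when its vertices are labeled by the monomials $m_im_j$, $1\le i\le j\le q$, it supports a free resolution of $I^2$. Moreover, the resolution of $I^2$ supported on $\mathbb L^2_{q,\mathcal D}$ is minimal if $I$ is the $\mathcal D$-extremal ideal $\mathcal E_{q,\mathcal D}$ (with $m_i=\epsilon_{\mathcal D,i}$ for $1\le i\le q$).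
   Context: Notation: $[q]=\{1,\ldots,q\}$; $\mathbf e_i$ is the $i$-th standard unit vector of $\mathbb R^q$; $\mathbf e_{ij}=\mathbf e_{ji}=\mathbf e_i+\mathbf e_j$ (so $\mathbf e_{ii}=2\mathbf e_i$); $\mathcal N^2_q=\{\mathbf e_{ij}: 1\le i\le j\le q\}$. The simplicial complex $\mathbb L^2_q$ has vertex set $\mathcal N^2_q$ and facets $\mathcal B=\{\mathbf e_{ij}:1\le i<j\le q\}$ and $G_i=\{\mathbf e_{ij}:1\le j\le q\}$ for $i\in[q]$ (here $q\ge 3$). Matching $A$ on $\mathbb L^2_q$. Let $N$ be the set of faces $\sigma$ of $\mathbb L^2_q$ of one of the types: (i) $\sigma=\{\mathbf e_{2j},\mathbf e_{3j},\ldots,\mathbf e_{sj}\}$ for some $j\in[q]$; (ii) $\sigma=\{\mathbf e_{2t_2},\ldots,\mathbf e_{st_s}\}$ with $\{t_2,\ldots,t_s\}=\{1,j\}$ for some $j$ with $s<j\le q$; (iii) $\sigma=\{\mathbf e_{21},\mathbf e_{31},\ldots,\mathbf e_{s1},\mathbf e_{ju}\}$ for some $q\ge j>u>s$. In each case $j=j_\sigma$ is determined by $\sigma$; put $\omega(\sigma)=\mathbf e_{1j_\sigma}$. Fix a total order $\preccurlyeq$ on $N$ in which every face of type (i) precedes every face of type (ii), and every face of type (ii) precedes every face of type (iii) (the order within a type is arbitrary but fixed). For $\sigma\in N$ let $Y_\sigma$ be the set of faces $\gamma$ of $\mathbb L^2_q$ containing some element of $N$ and such that $\sigma$ is the $\preccurlyeq$-largest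 element of $N$ contained in $\gamma$. Let $G$ be the directed graph whose vertices are the faces of $\mathbb L^2_q$ and whose edges are $\tau'\to\tau$ for $\tau\subseteq\tau'$, $|\tau'|=|\tau|+1$. Let $A$ be the set of edges $\tau'\to\tau$ of $G$ such that for some $\sigma\in N$: $\tau,\tau'\in Y_\sigma$, $\omega(\sigma)\in\tau'$ and $\tau=\tau'\smallsetminus\{\omega(\sigma)\}$. This is an acyclic matching: each face is in at most one edge of $A$, and the graph $G^A$ obtained from $G$ by reversing the edges in $A$ has no directed cycle. Faces not appearing in any edge of $A$ are called critical. The cell complex $\mathbb L^2_{q,\mathcal D}$ is the Morse complex (Batzies–Welker) of this matching: a CW complex having one $i$-cell $\sigma_A$ for each critical $i$-dimensional face $\sigma$ of $\mathbb L^2_q$ (the dimension of a face is its cardinality minus 1), and whose cellular incidence numbers, for critical faces with $|\sigma|=|\tau|-1$, are $[\tau_A:\sigma_A]=\sum_P w(P)$, the sum over directed paths $P$ from $\tau$ to $\sigma$ in $G^A$, where $w(P)$ is the product over the edges of $P$ of the following weights: an edge $\rho\to\rho'$ of $G$ not in $A$ has weight the simplicial incidence number $[\rho:\rho']=\pm1$, and the reversal $\rho'\to\rho$ of an edge $\rho\to\rho'$ in $A$ has weight $-[\rho:\rho']$. Labels: the vertex $\mathbf e_{ij}$ is labeled by $m_im_j$, and the cell $\sigma_A$ is labeled by $\operatorname{lcm}(\sigma)=\operatorname{lcm}(m_im_j:\mathbf e_{ij}\in\sigma)$. The labeled complex supports a free resolution of $I^2$ if the complex of free $R$-modules with basis in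 homological degree $i\ge0$ the $i$-cells, with differential $\tau_A\mapsto\sum_{\sigma}[\tau_A:\sigma_A]\frac{\operatorname{lcm}(\tau)}{\operatorname{lcm}(\sigma)}\sigma_A$ (sum over critical $\sigma$ with $|\sigma|=|\tau|-1$, $\sigma\neq\emptyset$) and augmentation $\mathbf e_{ij}\mapsto m_im_j\in I^2$, is a free resolution of $I^2$. The resolution is minimal if the rank of its $i$-th free module equals the Betti number $\beta_i(I^2)$ for all $i$. The $\mathcal D$-extremal ideal for $\mathcal D=\{(1,\{2,\ldots,s\})\}$: let $S_{[q]}=\mathsf k[y_C:\emptyset\ne C\subseteq[q]]$ and $Q(\mathcal D)=\{C\subseteq[q]: C\ne\emptyset,\ 1\notin C\text{ or }C\cap\{2,\ldots,s\}\neq\emptyset\}$. For $i\in[q]$ put $\epsilon_{\mathcal D,i}=\prod_{C\in Q(\mathcal D),\,i\in C}y_C$. Then $\mathcal E_{q,\mathcal D}=(\epsilon_{\mathcal D,1},\ldots,\epsilon_{\mathcal D,q})\subseteq S_{[q]}$; it is minimally generated by these $q$ square-free monomials, which satisfy the relation in $\mathcal D$. *)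

theory Defs
  imports
    "HOL-Library.Poly_Mapping"
    "HOL-Library.Multiset"
    "HOL-Algebra.Ideal_Product"
begin

text \<open>
  The polynomial ring over \<open>'k\<close> in a set \<open>X\<close> of variables is the subring of the monoid algebra
  \<open>('x \<Rightarrow>\<^sub>0 nat) \<Rightarrow>\<^sub>0 'k\<close> of those polynomials in which only variables from \<open>X\<close> occur. Monomials are
  represented by their exponent vectors \<open>'x \<Rightarrow>\<^sub>0 nat\<close>.
\<close>

type_synonym ('x, 'k) mpol = "('x \<Rightarrow>\<^sub>0 nat) \<Rightarrow>\<^sub>0 'k"

definition poly_ring :: "'x set \<Rightarrow> ('x, 'k::field) mpol ring" where
  "poly_ring X = \<lparr> carrier = {p. \<forall>t \<in> Poly_Mapping.keys p. Poly_Mapping.keys t \<subseteq> X},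
                   mult = (*), one = 1, zero = 0, add = (+) \<rparr>"

definition mon :: "('x \<Rightarrow>\<^sub>0 nat) \<Rightarrow> ('x, 'k::field) mpol" where
  "mon t = Poly_Mapping.single t 1"

text \<open>Exponent vector of the lcm of a finite set of monomials (which is 1 for the empty set).\<close>

definition lcm_exp :: "('x \<Rightarrow>\<^sub>0 nat) set \<Rightarrow> ('x \<Rightarrow>\<^sub>0 nat)" where
  "lcm_exp T = Abs_poly_mapping (\<lambda>x. Max (insert 0 ((\<lambda>t. Poly_Mapping.lookup t x) ` T)))"

definition square_free_exp :: "('x \<Rightarrow>\<^sub>0 nat) \<Rightarrow> bool" where
  "square_free_exp t \<longleftrightarrow> (\<forall>x. Poly_Mapping.lookup t x \<le> 1)"

definition total_deg :: "('x \<Rightarrow>\<^sub>0 nat) \<Rightarrow> nat" where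
  "total_deg t = (\<Sum>x \<in> Poly_Mapping.keys t. Poly_Mapping.lookup t x)"

definition minimally_generated ::
    "'x set \<Rightarrow> nat \<Rightarrow> (nat \<Rightarrow> ('x \<Rightarrow>\<^sub>0 nat)) \<Rightarrow> ('x, 'k::field) mpol set \<Rightarrow> bool" where
  "minimally_generated X q m I \<longleftrightarrow>
     I = genideal (poly_ring X) (mon ` m ` {1..q}) \<and>
     (\<forall>J. J \<subset> {1..q} \<longrightarrow> genideal (poly_ring X) (mon ` m ` J) \<noteq> I)"

definition ideal_square :: "'x set \<Rightarrow> ('x, 'k::field) mpol set \<Rightarrow> ('x, 'k) mpol set" where
  "ideal_square X I = ideal_prod (poly_ring X) I I"

definition free_mod :: "'x set \<Rightarrow> 'b set \<Rightarrow> ('b \<Rightarrow> ('x, 'k::field) mpol) set" where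
  "free_mod X B = {f. (\<forall>b \<in> B. f b \<in> carrier (poly_ring X)) \<and> (\<forall>b. b \<notin> B \<longrightarrow> f b = 0)}"

definition free_map ::
    "'b set \<Rightarrow> 'b set \<Rightarrow> ('b \<Rightarrow> 'b \<Rightarrow> ('x, 'k::field) mpol) \<Rightarrow>
     ('b \<Rightarrow> ('x, 'k) mpol) \<Rightarrow> ('b \<Rightarrow> ('x, 'k) mpol)" where
  "free_map B B' D f = (\<lambda>c. if c \<in> B' then \<Sum>b \<in> B. f b * D b c else 0)"

definition aug_map ::
    "'b set \<Rightarrow> ('b \<Rightarrow> ('x, 'k::field) mpol) \<Rightarrow> ('b \<Rightarrow> ('x, 'k) mpol) \<Rightarrow> ('x, 'k) mpol" where
  "aug_map B \<epsilon> f = (\<Sum>b \<in> B. f b * \<epsilon> b)"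

text \<open>
  \<open>B i\<close> is the basis of the module in homological degree \<open>i\<close>; \<open>D i b c\<close> is the coefficient of the
  basis element \<open>c \<in> B i\<close> in the image of \<open>b \<in> B (Suc i)\<close>, and \<open>\<epsilon> b\<close> is the image of \<open>b \<in> B 0\<close> in
  the resolved ideal \<open>M\<close>.
\<close>

definition free_resolution ::
    "'x set \<Rightarrow> (nat \<Rightarrow> 'b set) \<Rightarrow> (nat \<Rightarrow> 'b \<Rightarrow> 'b \<Rightarrow> ('x, 'k::field) mpol) \<Rightarrow>
     ('b \<Rightarrow> ('x, 'k) mpol) \<Rightarrow> ('x, 'k) mpol set \<Rightarrow> bool" where
  "free_resolution X B D \<epsilon> M \<longleftrightarrow>
     (\<forall>i. finite (B i)) \<and>
     (\<forall>i. \<forall>b \<in> B (Suc i). \<forall>c \<in> B i. D i b c \<in> carrier (poly_ring X)) \<and>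
     (\<forall>b \<in> B 0. \<epsilon> b \<in> carrier (poly_ring X)) \<and>
     aug_map (B 0) \<epsilon> ` free_mod X (B 0) = M \<and>
     {f \<in> free_mod X (B 0). aug_map (B 0) \<epsilon> f = 0}
       = free_map (B (Suc 0)) (B 0) (D 0) ` free_mod X (B (Suc 0)) \<and>
     (\<forall>i. {f \<in> free_mod X (B (Suc i)). free_map (B (Suc i)) (B i) (D i) f = (\<lambda>_. 0)}
       = free_map (B (Suc (Suc i))) (B (Suc i)) (D (Suc i)) ` free_mod X (B (Suc (Suc i))))"

text \<open>
  Minimal graded free resolutions, for the standard grading: \<open>deg i b\<close> is the degree of the basis
  element \<open>b\<close>, the maps are homogeneous, and the entries of the differentials lie in the
  homogeneous maximal ideal, i.e. have constant term 0.
\<close>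

definition minimal_graded_free_resolution ::
    "'x set \<Rightarrow> (nat \<Rightarrow> 'b set) \<Rightarrow> (nat \<Rightarrow> 'b \<Rightarrow> 'b \<Rightarrow> ('x, 'k::field) mpol) \<Rightarrow>
     ('b \<Rightarrow> ('x, 'k) mpol) \<Rightarrow> ('x, 'k) mpol set \<Rightarrow> bool" where
  "minimal_graded_free_resolution X B D \<epsilon> M \<longleftrightarrow>
     free_resolution X B D \<epsilon> M \<and>
     (\<exists>deg :: nat \<Rightarrow> 'b \<Rightarrow> nat.
        (\<forall>b \<in> B 0. \<forall>t \<in> Poly_Mapping.keys (\<epsilon> b). total_deg t = deg 0 b) \<and>
        (\<forall>i. \<forall>b \<in> B (Suc i). \<forall>c \<in> B i. \<forall>t \<in> Poly_Mapping.keys (D i b c).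
           total_deg t + deg i c = deg (Suc i) b)) \<and>
     (\<forall>i. \<forall>b \<in> B (Suc i). \<forall>c \<in> B i. Poly_Mapping.lookup (D i b c) 0 = 0)"

text \<open>The basis type \<open>nat\<close> is no restriction, since the modules have finite rank.\<close>

definition betti :: "'x set \<Rightarrow> ('x, 'k::field) mpol set \<Rightarrow> nat \<Rightarrow> nat" where
  "betti X M i = (THE n. \<exists>(B :: nat \<Rightarrow> nat set) D \<epsilon>.
     minimal_graded_free_resolution X B D \<epsilon> M \<and> card (B i) = n)"

text \<open>A simplicial complex is the set of its faces, including the empty face.\<close>

definition face_edges :: "'v set set \<Rightarrow> ('v set \<times> 'v set) set" where
  "face_edges K = {(\<tau>', \<tau>). \<tau>' \<in> K \<and> \<tau> \<in> K \<and> \<tau> \<subseteq> \<tau>' \<and> card \<tau>' = card \<tau> + 1}"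

definition morse_graph :: "'v set set \<Rightarrow> ('v set \<times> 'v set) set \<Rightarrow> ('v set \<times> 'v set) set" where
  "morse_graph K A = (face_edges K - A) \<union> A\<inverse>"

definition acyclic_matching :: "'v set set \<Rightarrow> ('v set \<times> 'v set) set \<Rightarrow> bool" where
  "acyclic_matching K A \<longleftrightarrow>
     A \<subseteq> face_edges K \<and>
     (\<forall>e \<in> A. \<forall>e' \<in> A. e \<noteq> e' \<longrightarrow> {fst e, snd e} \<inter> {fst e', snd e'} = {}) \<and>
     acyclic (morse_graph K A)"

definition critical_faces :: "'v set set \<Rightarrow> ('v set \<times> 'v set) set \<Rightarrow> 'v set set" where
  "critical_faces K A = {\<sigma> \<in> K. \<forall>e \<in> A. \<sigma> \<noteq> fst e \<and> \<sigma> \<noteq> snd e}"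

text \<open>
  The incidence number of a face and a facet of it, with respect to the orientations given by the
  total order \<open>V\<close> of the vertices; only meaningful on edges of the face graph.
\<close>

definition simplicial_incidence :: "('v \<times> 'v) set \<Rightarrow> 'v set \<Rightarrow> 'v set \<Rightarrow> int" where
  "simplicial_incidence V \<rho> \<rho>' = (-1) ^ card {w \<in> \<rho>'. (w, the_elem (\<rho> - \<rho>')) \<in> V}"

definition step_weight ::
    "('v \<times> 'v) set \<Rightarrow> ('v set \<times> 'v set) set \<Rightarrow> 'v set \<Rightarrow> 'v set \<Rightarrow> int" where
  "step_weight V A \<rho> \<rho>' =
     (if (\<rho>', \<rho>) \<in> A then - simplicial_incidence V \<rho>' \<rho> else simplicial_incidence V \<rho> \<rho>')"

definition path_weight ::
    "('v \<times> 'v) set \<Rightarrow> ('v set \<times> 'v set) set \<Rightarrow> 'v set list \<Rightarrow> int" where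
  "path_weight V A p = (\<Prod>i < length p - 1. step_weight V A (p ! i) (p ! Suc i))"

definition morse_paths ::
    "'v set set \<Rightarrow> ('v set \<times> 'v set) set \<Rightarrow> 'v set \<Rightarrow> 'v set \<Rightarrow> 'v set list set" where
  "morse_paths K A \<tau> \<sigma> =
     {p. p \<noteq> [] \<and> hd p = \<tau> \<and> last p = \<sigma> \<and> successively (\<lambda>x y. (x, y) \<in> morse_graph K A) p}"

text \<open>For an acyclic matching on a finite complex, the sum below is finite.\<close>

definition morse_incidence ::
    "'v set set \<Rightarrow> ('v \<times> 'v) set \<Rightarrow> ('v set \<times> 'v set) set \<Rightarrow> 'v set \<Rightarrow> 'v set \<Rightarrow> int" where
  "morse_incidence K V A \<tau> \<sigma> = (\<Sum>p \<in> morse_paths K A \<tau> \<sigma>. path_weight V A p)"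

definition morse_cells :: "'v set set \<Rightarrow> ('v set \<times> 'v set) set \<Rightarrow> nat \<Rightarrow> 'v set set" where
  "morse_cells K A i = {\<sigma> \<in> critical_faces K A. card \<sigma> = i + 1}"

text \<open>
  The lattice point \<open>e\<^sub>i + e\<^sub>j\<close> is encoded as the multiset \<open>{#i, j#}\<close>, whose multiplicity function
  is the vector \<open>e\<^sub>i + e\<^sub>j\<close>.
\<close>

type_synonym vertex = "nat multiset"

definition ee :: "nat \<Rightarrow> nat \<Rightarrow> vertex" where
  "ee i j = {#i, j#}"

definition vertices :: "nat \<Rightarrow> vertex set" where
  "vertices q = {ee i j | i j. 1 \<le> i \<and> i \<le> j \<and> j \<le> q}"

definition L2_facets :: "nat \<Rightarrow> vertex set set" where
  "L2_facets q = insert {ee i j | i j. 1 \<le> i \<and> i < j \<and> j \<le> q}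
                        ((\<lambda>i. {ee i j | j. 1 \<le> j \<and> j \<le> q}) ` {1..q})"

definition L2 :: "nat \<Rightarrow> vertex set set" where
  "L2 q = {\<sigma>. \<exists>F \<in> L2_facets q. \<sigma> \<subseteq> F}"

definition type_i :: "nat \<Rightarrow> nat \<Rightarrow> vertex set \<Rightarrow> nat \<Rightarrow> bool" where
  "type_i q s \<sigma> j \<longleftrightarrow> j \<in> {1..q} \<and> \<sigma> = (\<lambda>k. ee k j) ` {2..s}"

definition type_ii :: "nat \<Rightarrow> nat \<Rightarrow> vertex set \<Rightarrow> nat \<Rightarrow> bool" where
  "type_ii q s \<sigma> j \<longleftrightarrow> s < j \<and> j \<le> q \<and>
     (\<exists>t. t ` {2..s} = {1, j} \<and> \<sigma> = (\<lambda>k. ee k (t k)) ` {2..s})"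

definition type_iii :: "nat \<Rightarrow> nat \<Rightarrow> vertex set \<Rightarrow> nat \<Rightarrow> bool" where
  "type_iii q s \<sigma> j \<longleftrightarrow>
     (\<exists>u. s < u \<and> u < j \<and> j \<le> q \<and> \<sigma> = insert (ee j u) ((\<lambda>k. ee k 1) ` {2..s}))"

definition NN :: "nat \<Rightarrow> nat \<Rightarrow> vertex set set" where
  "NN q s = {\<sigma> \<in> L2 q. \<exists>j. type_i q s \<sigma> j \<or> type_ii q s \<sigma> j \<or> type_iii q s \<sigma> j}"

definition omega :: "nat \<Rightarrow> nat \<Rightarrow> vertex set \<Rightarrow> vertex" where
  "omega q s \<sigma> = ee 1 (THE j. type_i q s \<sigma> j \<or> type_ii q s \<sigma> j \<or> type_iii q s \<sigma> j)"

text \<open>In \<open>ord\<close>, a pair \<open>(\<sigma>, \<sigma>')\<close> means that \<open>\<sigma>\<close> precedes or equals \<open>\<sigma>'\<close>.\<close>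

definition admissible_order :: "nat \<Rightarrow> nat \<Rightarrow> (vertex set \<times> vertex set) set \<Rightarrow> bool" where
  "admissible_order q s ord \<longleftrightarrow>
     linear_order_on (NN q s) ord \<and>
     (\<forall>\<sigma> \<in> NN q s. \<forall>\<sigma>' \<in> NN q s.
        ((\<exists>j. type_i q s \<sigma> j) \<and> (\<exists>j. type_ii q s \<sigma>' j) \<longrightarrow> (\<sigma>, \<sigma>') \<in> ord) \<and>
        ((\<exists>j. type_ii q s \<sigma> j) \<and> (\<exists>j. type_iii q s \<sigma>' j) \<longrightarrow> (\<sigma>, \<sigma>') \<in> ord) \<and>
        ((\<exists>j. type_i q s \<sigma> j) \<and> (\<exists>j. type_iii q s \<sigma>' j) \<longrightarrow> (\<sigma>, \<sigma>') \<in> ord))"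

definition YY ::
    "nat \<Rightarrow> nat \<Rightarrow> (vertex set \<times> vertex set) set \<Rightarrow> vertex set \<Rightarrow> vertex set set" where
  "YY q s ord \<sigma> =
     {\<gamma> \<in> L2 q. \<sigma> \<in> NN q s \<and> \<sigma> \<subseteq> \<gamma> \<and> (\<forall>\<sigma>' \<in> NN q s. \<sigma>' \<subseteq> \<gamma> \<longrightarrow> (\<sigma>', \<sigma>) \<in> ord)}"

definition matching ::
    "nat \<Rightarrow> nat \<Rightarrow> (vertex set \<times> vertex set) set \<Rightarrow> (vertex set \<times> vertex set) set" where
  "matching q s ord =
     {(\<tau>', \<tau>). \<exists>\<sigma> \<in> NN q s. \<tau> \<in> YY q s ord \<sigma> \<and> \<tau>' \<in> YY q s ord \<sigma> \<and>
        omega q s \<sigma> \<in> \<tau>' \<and> \<tau> = \<tau>' - {omega q s \<sigma>}}"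

definition LD_cells :: "nat \<Rightarrow> nat \<Rightarrow> (vertex set \<times> vertex set) set \<Rightarrow> nat \<Rightarrow> vertex set set" where
  "LD_cells q s ord i = morse_cells (L2 q) (matching q s ord) i"

definition LD_incidence ::
    "nat \<Rightarrow> nat \<Rightarrow> (vertex set \<times> vertex set) set \<Rightarrow> (vertex \<times> vertex) set \<Rightarrow>
     vertex set \<Rightarrow> vertex set \<Rightarrow> int" where
  "LD_incidence q s ord V \<tau> \<sigma> = morse_incidence (L2 q) V (matching q s ord) \<tau> \<sigma>"

text \<open>The label of \<open>ee i j\<close> has exponent vector \<open>m i + m j\<close>, i.e. it is the product of the monomials.\<close>

definition vertex_label :: "(nat \<Rightarrow> ('x \<Rightarrow>\<^sub>0 nat)) \<Rightarrow> vertex \<Rightarrow> ('x \<Rightarrow>\<^sub>0 nat)" where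
  "vertex_label m v = (\<Sum>k \<in># v. m k)"

definition face_label :: "(nat \<Rightarrow> ('x \<Rightarrow>\<^sub>0 nat)) \<Rightarrow> vertex set \<Rightarrow> ('x \<Rightarrow>\<^sub>0 nat)" where
  "face_label m \<sigma> = lcm_exp (vertex_label m ` \<sigma>)"

text \<open>
  Subtraction of exponents is truncated; the first conjunct guarantees that wherever the incidence
  number is nonzero, the difference below is the exponent vector of a true quotient of monomials.
\<close>

definition LD_supports_free_resolution ::
    "'x set \<Rightarrow> nat \<Rightarrow> nat \<Rightarrow> (vertex set \<times> vertex set) set \<Rightarrow> (vertex \<times> vertex) set \<Rightarrow>
     (nat \<Rightarrow> ('x \<Rightarrow>\<^sub>0 nat)) \<Rightarrow> ('x, 'k::field) mpol set \<Rightarrow> bool" where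
  "LD_supports_free_resolution X q s ord V m M \<longleftrightarrow>
     (\<forall>i. \<forall>\<tau> \<in> LD_cells q s ord (Suc i). \<forall>\<sigma> \<in> LD_cells q s ord i.
        LD_incidence q s ord V \<tau> \<sigma> \<noteq> 0 \<longrightarrow>
        (mon (face_label m \<sigma>) :: ('x, 'k) mpol) dvd mon (face_label m \<tau>)) \<and>
     free_resolution X (LD_cells q s ord)
       (\<lambda>i \<tau> \<sigma>. Poly_Mapping.single (face_label m \<tau> - face_label m \<sigma>)
                   (of_int (LD_incidence q s ord V \<tau> \<sigma>)))
       (\<lambda>\<sigma>. mon (face_label m \<sigma>)) M"

text \<open>The variable indexed by a set \<open>C\<close> is \<open>C\<close> itself.\<close>

definition extremal_vars :: "nat \<Rightarrow> nat set set" where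
  "extremal_vars q = {C. C \<noteq> {} \<and> C \<subseteq> {1..q}}"

definition QD :: "nat \<Rightarrow> nat \<Rightarrow> nat set set" where
  "QD q s = {C. C \<subseteq> {1..q} \<and> C \<noteq> {} \<and> (1 \<notin> C \<or> C \<inter> {2..s} \<noteq> {})}"

definition extremal_gen :: "nat \<Rightarrow> nat \<Rightarrow> nat \<Rightarrow> (nat set \<Rightarrow>\<^sub>0 nat)" where
  "extremal_gen q s i = (\<Sum>C \<in> {C \<in> QD q s. i \<in> C}. Poly_Mapping.single C 1)"

definition extremal_ideal :: "nat \<Rightarrow> nat \<Rightarrow> (nat set, 'k::field) mpol set" where
  "extremal_ideal q s =
     genideal (poly_ring (extremal_vars q)) (mon ` extremal_gen q s ` {1..q})"

end

theory Submission
  imports Defs "HOL.Vector_Spaces" "HOL-Library.Function_Algebras"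
begin

text \<open>
  A matching that toggles a vertex depending only on the fibre of a monotone map is acyclic, which
  applies to the fibres \<open>YY q s ord \<sigma>\<close>. For a matching with potential \<open>\<mu>\<close> the path sums \<open>W x \<sigma>\<close> from
  arbitrary faces to critical faces of the same dimension form a chain map onto the Morse complex,
  which restricts to the identity on critical faces and vanishes on tops of matched pairs; a cycle
  in its kernel is a boundary, because its faces of maximal potential are bottoms of matched pairs.
  Hence the Morse complex is exact wherever the simplicial complex is.

  Because \<open>m 1\<close> divides the lcm of \<open>m 2, \<dots>, m s\<close>, matched faces have the same label, so all of this
  happens inside the subcomplex of faces whose label divides a given monomial. Square-freeness makes
  this subcomplex empty or acyclic, by another toggle matching without critical faces; the strands
  in all multidegrees together give the resolution.

  For the extremal ideal, a critical face either contains no element of \<open>NN q s\<close>, or it consists of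
  all \<open>ee k 1\<close> with \<open>2 \<le> k \<le> s\<close>, some further \<open>ee j 1\<close>, and edges inside \<open>{2..s}\<close>. From this one
  reads off that distinct critical faces have distinct labels, so no differential has a unit entry.
  Ranks of minimal resolutions agree since comparison maps are mutually inverse modulo the variables.
\<close>

section \<open>Algebraic discrete Morse theory\<close>

text \<open>The empty face is kept as a cell of cardinality 0. It is critical and has incidence 1
  with every vertex, so the augmentation is one more Morse differential; a strand without vertices
  is harmless because exactness is claimed only from cardinality 1 on.

  The vertex \<open>ee 1 j\<close> is the right one to toggle because every element of
  \<open>NN\<close> with index \<open>j\<close> joins each \<open>k\<close> in \<open>{2..s}\<close>
  to 1 or to \<open>j\<close>, so that some \<open>m k\<close> can stand in for \<open>m 1\<close>.
  Toggling seldom disturbs the fibre: no element of \<open>NN\<close> contains \<open>ee 1 l\<close>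
  with \<open>l = 1\<close> or \<open>s < l\<close>.

  The obstacle to minimality is that a label shows only the sets in \<open>QD\<close>. Sets such as
  \<open>{1}\<close> and \<open>{1, j}\<close> with \<open>s < j\<close> are missing, exactly those
  that would reveal \<open>ee 1 1\<close> and \<open>ee 1 j\<close>. They are replaced by larger
  sets with one more index in \<open>{2..s}\<close> that the face avoids; the absence of elements of
  \<open>NN\<close> is what supplies this index.\<close>

locale morse_data =
  fixes K :: "'a set" and deg :: "'a \<Rightarrow> nat" and D :: "'a \<Rightarrow> 'a \<Rightarrow> 'k::comm_ring_1"
    and A :: "('a \<times> 'a) set" and \<mu> :: "'a \<Rightarrow> nat"
  assumes finK: "finite K"
    and deg_D: "\<lbrakk>x \<in> K; y \<in> K; D x y \<noteq> 0\<rbrakk> \<Longrightarrow> deg x = Suc (deg y)"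
    and DD: "\<lbrakk>x \<in> K; z \<in> K\<rbrakk> \<Longrightarrow> (\<Sum>y\<in>K. D x y * D y z) = 0"
    and A_K: "(u, l) \<in> A \<Longrightarrow> u \<in> K \<and> l \<in> K"
    \<comment> \<open>Matched coefficients are their own inverses, as signs are; this replaces
      division over a general commutative ring.\<close>
    and A_unit: "(u, l) \<in> A \<Longrightarrow> D u l * D u l = 1"
    and A_match: "\<lbrakk>(u, l) \<in> A; (u', l') \<in> A; {u, l} \<inter> {u', l'} \<noteq> {}\<rbrakk> \<Longrightarrow> u = u' \<and> l = l'"
    \<comment> \<open>The potential drops along each edge of the graph with \<open>A\<close>
      reversed: upward from a bottom to its top, downward along the remaining incidences.\<close>
    and mu_up: "(u, l) \<in> A \<Longrightarrow> \<mu> u < \<mu> l"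
    and mu_down: "\<lbrakk>x \<in> K; y \<in> K; D x y \<noteq> 0; (x, y) \<notin> A\<rbrakk> \<Longrightarrow> \<mu> y < \<mu> x"
begin

definition crit :: "'a set" where
  "crit = {x \<in> K. \<forall>e \<in> A. x \<noteq> fst e \<and> x \<noteq> snd e}"

lemma crit_K: "x \<in> crit \<Longrightarrow> x \<in> K"
  by (simp add: crit_def)

lemma finite_crit: "finite crit"
  using finK by (simp add: crit_def)

lemma crit_notin: "x \<in> crit \<Longrightarrow> (x, y) \<notin> A \<and> (y, x) \<notin> A"
  by (force simp: crit_def)

lemma crit_cases:
  assumes "x \<in> K"
  obtains "x \<in> crit" | l where "(x, l) \<in> A" | u where "(u, x) \<in> A"
proof -
  have "x \<in> crit \<or> (\<exists>l. (x, l) \<in> A) \<or> (\<exists>u. (u, x) \<in> A)"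
    using assms by (force simp: crit_def)
  then show thesis using that by blast
qed

lemma A_top_not_bottom: "(u, l) \<in> A \<Longrightarrow> (v, u) \<notin> A"
  using A_match[of u l v u] mu_up by force

lemma A_unique_bottom: "(u, l) \<in> A \<Longrightarrow> (u, l') \<in> A \<Longrightarrow> l = l'"
  using A_match[of u l u l'] by auto

lemma A_unique_top: "(u, l) \<in> A \<Longrightarrow> (u', l) \<in> A \<Longrightarrow> u = u'"
  using A_match[of u l u' l] by auto

lemma A_nonzero: "(u, l) \<in> A \<Longrightarrow> D u l \<noteq> 0"
  using A_unit[of u l] by auto

lemma A_deg: "(u, l) \<in> A \<Longrightarrow> deg u = Suc (deg l)"
  using A_K A_nonzero deg_D by blast

lemma boundary_boundary:
  assumes "v \<in> K"
  shows "(\<Sum>y\<in>K. (\<Sum>u\<in>K. w u * D u y) * D y v) = 0"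
proof -
  have "(\<Sum>y\<in>K. (\<Sum>u\<in>K. w u * D u y) * D y v) = (\<Sum>y\<in>K. \<Sum>u\<in>K. w u * (D u y * D y v))"
    by (simp add: sum_distrib_right mult.assoc)
  also have "\<dots> = (\<Sum>u\<in>K. \<Sum>y\<in>K. w u * (D u y * D y v))"
    by (rule sum.swap)
  also have "\<dots> = 0"
    using assms by (simp add: sum_distrib_left[symmetric] DD)
  finally show ?thesis .
qed

text \<open>The cells of maximal potential in the support of a cycle are bottoms of matched pairs, so
  subtracting multiples of the boundaries of the corresponding tops lowers the potential.\<close>

lemma cycle_boundary:
  \<comment> \<open>\<open>H\<close> is an invariant that keeps a critical cell from having maximal
    potential in the support (\<open>H_crit\<close>) and survives the subtraction
    (\<open>H_diff\<close>). It is trivial when there are no critical cells; for the Morse complex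
    it is a condition on path sums.\<close>
  assumes H_diff: "\<And>x w. \<lbrakk>H x; \<And>u. w u \<noteq> 0 \<Longrightarrow> u \<in> Domain A \<and> deg u = Suc n\<rbrakk> \<Longrightarrow>
                     H (\<lambda>y. x y - (\<Sum>u\<in>K. w u * D u y))"
    and H_crit: "\<And>x r. \<lbrakk>H x; r \<in> crit; x r \<noteq> 0\<rbrakk> \<Longrightarrow> \<exists>y\<in>K. x y \<noteq> 0 \<and> \<mu> r < \<mu> y"
    and "H x" and "\<And>y. \<lbrakk>y \<in> K; x y \<noteq> 0\<rbrakk> \<Longrightarrow> deg y = n"
    and "\<And>z. z \<in> K \<Longrightarrow> (\<Sum>y\<in>K. x y * D y z) = 0"
  shows "\<exists>w. (\<forall>u. w u \<noteq> 0 \<longrightarrow> u \<in> Domain A \<and> deg u = Suc n) \<and>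
             (\<forall>y\<in>K. x y = (\<Sum>u\<in>K. w u * D u y))"
proof -
  \<comment> \<open>Induction on a strict bound \<open>M\<close> for the potential on the
    support.\<close>
  have claim: "\<exists>w. (\<forall>u. w u \<noteq> 0 \<longrightarrow> u \<in> Domain A \<and> deg u = Suc n) \<and>
             (\<forall>y\<in>K. x y = (\<Sum>u\<in>K. w u * D u y))"
    if "H x" and "\<And>y. \<lbrakk>y \<in> K; x y \<noteq> 0\<rbrakk> \<Longrightarrow> deg y = n"
      and "\<And>z. z \<in> K \<Longrightarrow> (\<Sum>y\<in>K. x y * D y z) = 0"
      and "\<And>y. \<lbrakk>y \<in> K; x y \<noteq> 0\<rbrakk> \<Longrightarrow> \<mu> y < M" for M x
    using that
  proof (induction M arbitrary: x)
    case 0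
    then have "\<forall>y\<in>K. x y = 0" by blast
    then show ?case by (intro exI[of _ "\<lambda>_. 0"]) auto
  next
    case (Suc M)
    note hx = \<open>H x\<close> and dx = Suc.prems(2) and cx = Suc.prems(3) and mx = Suc.prems(4)
    define p where "p u = (THE l. (u, l) \<in> A)" for u
    have p: "p u = l" if "(u, l) \<in> A" for u l
      unfolding p_def using that A_unique_bottom by blast
    \<comment> \<open>With coefficient \<open>x l * D u l\<close> the boundary of \<open>u\<close>
      has the value \<open>x l\<close> at \<open>l\<close>, because \<open>D u l\<close> is its own
      inverse.\<close>
    define w where
      "w u = (if u \<in> Domain A \<and> \<mu> (p u) = M then x (p u) * D u (p u) else 0)" for u
    have w_dom: "u \<in> Domain A \<and> deg u = Suc n" if wu: "w u \<noteq> 0" for u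
    proof -
      from wu obtain l where l: "(u, l) \<in> A" and "x l * D u l \<noteq> 0"
        by (auto simp: w_def p split: if_splits)
      then have "x l \<noteq> 0" by auto
      then have "deg l = n" using dx A_K l by blast
      then show ?thesis using A_deg[OF l(1)] l(1) by auto
    qed
    \<comment> \<open>A face \<open>r\<close> of \<open>u\<close> other than its partner has
      potential below that of \<open>u\<close>, hence below \<open>M\<close>, so the subtraction
      creates no new cell of potential \<open>M\<close> or more.\<close>
    have w_zero: "w u * D u r = 0" if "u \<in> K" "r \<in> K" "M \<le> \<mu> r" "(u, r) \<notin> A" for u r
    proof (rule ccontr)
      assume a: "w u * D u r \<noteq> 0"
      then have wu: "w u \<noteq> 0" and du: "D u r \<noteq> 0" by auto
      then obtain l where l: "(u, l) \<in> A" "\<mu> l = M"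
        by (auto simp: w_def p split: if_splits)
      show False
        using mu_down[OF that(1,2) du that(4)] mu_up[OF l(1)] l(2) that(3) by linarith
    qed
    have top: "(\<Sum>u\<in>K. w u * D u r) = x r" if r: "r \<in> K" "M \<le> \<mu> r" for r
    proof (cases "\<exists>u. (u, r) \<in> A")
      case True
      then obtain u where u: "(u, r) \<in> A" by blast
      have "(\<Sum>v\<in>K. w v * D v r) = w u * D u r + (\<Sum>v\<in>K - {u}. w v * D v r)"
        using finK u A_K by (intro sum.remove) auto
      also have "(\<Sum>v\<in>K - {u}. w v * D v r) = 0"
        using w_zero[OF _ r] A_unique_top[OF u] by (intro sum.neutral) auto
      also have "w u * D u r = x r"
      proof (cases "\<mu> r = M")
        case True
        have "w u * D u r = x r * (D u r * D u r)"
          using u True by (auto simp: w_def p mult.assoc)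
        then show ?thesis using A_unit[OF u] by simp
      next
        case False
        then have "x r = 0" using mx[of r] r by force
        then show ?thesis using u by (auto simp: w_def p)
      qed
      finally show ?thesis by simp
    next
      case False
      then have s0: "(\<Sum>v\<in>K. w v * D v r) = 0"
        using w_zero[OF _ r] by (intro sum.neutral) auto
      \<comment> \<open>A maximal cell \<open>r\<close> that is neither critical nor a bottom is the
        top of some \<open>l\<close>. As \<open>x\<close> is a cycle, another \<open>y\<close> in
        its support must cancel at \<open>l\<close>, and then
        \<open>\<mu> r < \<mu> l < \<mu> y\<close>, against maximality.\<close>
      have "x r = 0"
      proof (rule ccontr)
        assume xr: "x r \<noteq> 0"
        then have mr: "\<mu> r = M" using mx[OF r(1)] r(2) by force
        have notbig: "\<not> (\<exists>y\<in>K. x y \<noteq> 0 \<and> \<mu> r < \<mu> y)" using mx mr by fastforce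
        with H_crit[OF hx _ xr] have "r \<notin> crit" by blast
        with False obtain l where l: "(r, l) \<in> A" using crit_cases[OF r(1)] by blast
        then have lK: "l \<in> K" using A_K by blast
        have "(\<Sum>y\<in>K. x y * D y l) = x r * D r l + (\<Sum>y\<in>K - {r}. x y * D y l)"
          using finK r by (intro sum.remove) auto
        moreover have "x r * D r l \<noteq> 0"
        proof
          assume "x r * D r l = 0"
          then have "x r * (D r l * D r l) = 0" by (simp add: mult.assoc[symmetric])
          then show False using A_unit[OF l] xr by simp
        qed
        ultimately have "(\<Sum>y\<in>K - {r}. x y * D y l) \<noteq> 0" using cx[OF lK] by auto
        then obtain y where "y \<in> K - {r}" "x y * D y l \<noteq> 0"
          by (rule sum.not_neutral_contains_not_neutral)
        then have y: "y \<in> K" "y \<noteq> r" "x y * D y l \<noteq> 0" by auto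
        then have nz: "x y \<noteq> 0" "D y l \<noteq> 0" by auto
        have "(y, l) \<notin> A" using A_unique_top[OF l] y by blast
        then have "\<mu> l < \<mu> y" using mu_down y lK nz by blast
        moreover have "\<mu> y \<le> \<mu> r" using notbig y nz by force
        ultimately show False using mu_up[OF l] by linarith
      qed
      with s0 show ?thesis by simp
    qed
    define x' where "x' = (\<lambda>y. x y - (\<Sum>u\<in>K. w u * D u y))"
    have "\<exists>w'. (\<forall>u. w' u \<noteq> 0 \<longrightarrow> u \<in> Domain A \<and> deg u = Suc n) \<and>
             (\<forall>y\<in>K. x' y = (\<Sum>u\<in>K. w' u * D u y))"
    proof (rule Suc.IH)
      show "H x'" unfolding x'_def by (rule H_diff[OF hx w_dom])
      show "deg y = n" if "y \<in> K" "x' y \<noteq> 0" for y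
      proof (cases "x y = 0")
        case True
        with that have "(\<Sum>u\<in>K. w u * D u y) \<noteq> 0" by (simp add: x'_def)
        then obtain u where u: "u \<in> K" "w u * D u y \<noteq> 0"
          by (rule sum.not_neutral_contains_not_neutral)
        then have "w u \<noteq> 0" "D u y \<noteq> 0" by auto
        then show ?thesis using w_dom[of u] deg_D[of u y] that u by simp
      qed (use that dx in auto)
      show "(\<Sum>y\<in>K. x' y * D y z) = 0" if "z \<in> K" for z
        unfolding x'_def using cx[OF that] boundary_boundary[OF that, of w]
        by (simp add: left_diff_distrib sum_subtractf)
      show "\<mu> y < M" if "y \<in> K" "x' y \<noteq> 0" for y
        using top[of y] that by (force simp: x'_def)
    qed
    then obtain w' where w': "\<And>u. w' u \<noteq> 0 \<Longrightarrow> u \<in> Domain A \<and> deg u = Suc n"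
      "\<And>y. y \<in> K \<Longrightarrow> x' y = (\<Sum>u\<in>K. w' u * D u y)" by blast
    show ?case
    proof (intro exI[of _ "\<lambda>u. w u + w' u"] conjI ballI allI impI)
      fix u assume "w u + w' u \<noteq> 0"
      then have "w u \<noteq> 0 \<or> w' u \<noteq> 0" by auto
      then show "u \<in> Domain A" "deg u = Suc n" using w_dom w'(1) by blast+
    next
      fix y assume "y \<in> K"
      from w'(2)[OF this] show "x y = (\<Sum>u\<in>K. (w u + w' u) * D u y)"
        by (simp add: x'_def distrib_right sum.distrib algebra_simps)
    qed
  qed
  define M where "M = Suc (Max (\<mu> ` K))"
  have "\<mu> y < M" if "y \<in> K" for y
    using that finK by (simp add: M_def less_Suc_eq_le)
  with assms(3-5) claim[of x M] show ?thesis by blast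
qed

text \<open>With every cell matched, the invariant of \<open>cycle_boundary\<close> can be trivial.
  This is the form in which acyclicity of the strands is obtained.\<close>

lemma perfect_exact:
  assumes "crit = {}" and "\<And>y. \<lbrakk>y \<in> K; x y \<noteq> 0\<rbrakk> \<Longrightarrow> deg y = n"
    and "\<And>z. z \<in> K \<Longrightarrow> (\<Sum>y\<in>K. x y * D y z) = 0"
  shows "\<exists>w. (\<forall>u. w u \<noteq> 0 \<longrightarrow> u \<in> K \<and> deg u = Suc n) \<and>
             (\<forall>y\<in>K. x y = (\<Sum>u\<in>K. w u * D u y))"
proof -
  have "\<exists>w. (\<forall>u. w u \<noteq> 0 \<longrightarrow> u \<in> Domain A \<and> deg u = Suc n) \<and>
             (\<forall>y\<in>K. x y = (\<Sum>u\<in>K. w u * D u y))"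
    by (rule cycle_boundary[of "\<lambda>_. True"]) (use assms in auto)
  moreover have "Domain A \<subseteq> K" using A_K by blast
  ultimately show ?thesis by (meson subsetD)
qed

end

section \<open>Path sums as a chain map onto the Morse complex\<close>

locale morse_paths_sum = morse_data K deg D A \<mu>
  for K :: "'a set" and deg and D :: "'a \<Rightarrow> 'a \<Rightarrow> 'k::comm_ring_1" and A and \<mu> +
  fixes W :: "'a \<Rightarrow> 'a \<Rightarrow> 'k"
  assumes W_rec: "\<lbrakk>x \<in> K; y \<in> K\<rbrakk> \<Longrightarrow> W x y = (if x = y then 1 else 0) +
     (\<Sum>z\<in>K. (if (z, x) \<in> A then - D z x else if (x, z) \<in> A then 0 else D x z) * W z y)"
begin

text \<open>The weighted adjacency matrix of the graph with \<open>A\<close> reversed. The recursion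
  reads W = 1 + N W; since \<open>N\<close> lowers the potential, \<open>W\<close> is the finite sum
  of the powers of \<open>N\<close>.\<close>

definition N :: "'a \<Rightarrow> 'a \<Rightarrow> 'k" where
  "N x z = (if (z, x) \<in> A then - D z x else if (x, z) \<in> A then 0 else D x z)"

lemma W_step: "\<lbrakk>x \<in> K; y \<in> K\<rbrakk> \<Longrightarrow> W x y = (if x = y then 1 else 0) + (\<Sum>z\<in>K. N x z * W z y)"
  using W_rec by (simp add: N_def)

lemma N_mu: "\<lbrakk>x \<in> K; z \<in> K; N x z \<noteq> 0\<rbrakk> \<Longrightarrow> \<mu> z < \<mu> x"
  using mu_up mu_down by (auto simp: N_def split: if_splits)

lemma W_mu:
  assumes "x \<in> K" "y \<in> K" "W x y \<noteq> 0"
  shows "x = y \<or> \<mu> y < \<mu> x"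
  using assms
proof (induction "\<mu> x" arbitrary: x rule: less_induct)
  case less
  show ?case
  proof (rule ccontr)
    assume c: "\<not> ?thesis"
    then have "(\<Sum>z\<in>K. N x z * W z y) \<noteq> 0" using W_step[of x y] less by simp
    then obtain z where z: "z \<in> K" "N x z * W z y \<noteq> 0" by (rule sum.not_neutral_contains_not_neutral)
    then have "N x z \<noteq> 0" "W z y \<noteq> 0" by auto
    then have "\<mu> z < \<mu> x" "z = y \<or> \<mu> y < \<mu> z"
      using N_mu less z by auto
    then show False using c by auto
  qed
qed

lemma W_self:
  assumes "x \<in> K" shows "W x x = 1"
proof -
  have "N x z * W z x = 0" if "z \<in> K" for z
    using N_mu[OF assms that] W_mu[OF that assms] by fastforce
  then show ?thesis using W_step[OF assms assms] by simp
qed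

text \<open>A path rises only along a reversed matched edge, which ends at a top; a top is not a
  bottom, so the next step goes down. Hence rises cannot accumulate before a critical cell is
  reached.\<close>

lemma W_deg:
  assumes "x \<in> K" "y \<in> crit" "W x y \<noteq> 0"
  shows "deg y \<le> deg x \<and> (x \<in> Domain A \<longrightarrow> deg y < deg x)"
  using assms
proof (induction "\<mu> x" arbitrary: x rule: less_induct)
  case less
  have y: "y \<in> K" using less crit_K by blast
  show ?case
  proof (cases "x = y")
    case True
    then show ?thesis using crit_notin less by blast
  next
    case False
    then have "(\<Sum>z\<in>K. N x z * W z y) \<noteq> 0" using W_step[of x y] less y by simp
    then obtain z where z: "z \<in> K" "N x z * W z y \<noteq> 0" by (rule sum.not_neutral_contains_not_neutral)
    then have nz: "N x z \<noteq> 0" "W z y \<noteq> 0" by auto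
    then have "\<mu> z < \<mu> x" using N_mu less z by auto
    then have IH: "deg y \<le> deg z \<and> (z \<in> Domain A \<longrightarrow> deg y < deg z)"
      using less z nz by blast
    show ?thesis
    proof (cases "(z, x) \<in> A")
      case True
      then have "z \<in> Domain A" "x \<notin> Domain A" using A_top_not_bottom by blast+
      then show ?thesis using IH A_deg[OF True] by simp
    next
      case False
      then have "D x z \<noteq> 0" using nz by (auto simp: N_def split: if_splits)
      then show ?thesis using deg_D[of x z] less z IH by simp
    qed
  qed
qed

text \<open>From a critical cell every first step goes down, so by \<open>W_deg\<close> only the
  empty path ends at a critical cell of the same degree.\<close>

lemma W_crit:
  assumes "x \<in> crit" "y \<in> crit" "deg x = deg y"
  shows "W x y = (if x = y then 1 else 0)"
proof -
  have K: "x \<in> K" "y \<in> K" using assms crit_K by auto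
  have "N x z * W z y = 0" if "z \<in> K" for z
  proof (rule ccontr)
    assume "N x z * W z y \<noteq> 0"
    then have nz: "N x z \<noteq> 0" "W z y \<noteq> 0" by auto
    then have "D x z \<noteq> 0" using crit_notin[OF assms(1)] by (simp add: N_def)
    then have "deg x = Suc (deg z)" using deg_D K that by blast
    then show False using W_deg[OF that assms(2) nz(2)] assms(3) by simp
  qed
  then show ?thesis using W_step[OF K] by simp
qed

lemma W_top:
  assumes "u \<in> Domain A" "y \<in> crit" "deg u = deg y"
  shows "W u y = 0"
  using W_deg[of u y] assms A_K by fastforce

text \<open>In the boundary of \<open>u\<close> the term of its partner \<open>b\<close> cancels all
  others. Paths from \<open>u\<close> start with the other faces, so these contribute
  \<open>W u s\<close>; a path from \<open>b\<close> must, for degree reasons, first climb to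
  \<open>u\<close>, which gives \<open>W b s = - D u b * W u s\<close>.\<close>

lemma D_W_top:
  assumes "u \<in> Domain A" "s \<in> crit" "deg u = Suc (deg s)"
  shows "(\<Sum>z\<in>K. D u z * W z s) = 0"
proof -
  obtain b where b: "(u, b) \<in> A" using assms by blast
  have K: "u \<in> K" "b \<in> K" "s \<in> K" using A_K[OF b] crit_K assms by auto
  have bs: "deg b = deg s" using A_deg[OF b] assms by simp
  have "u \<noteq> s" "b \<noteq> s" using b crit_notin assms by blast+
  have "W u s = (\<Sum>z\<in>K. N u z * W z s)" using W_step[of u s] K \<open>u \<noteq> s\<close> by simp
  also have "\<dots> = N u b * W b s + (\<Sum>z\<in>K - {b}. N u z * W z s)"
    using finK K by (intro sum.remove) auto
  also have "N u b = 0" using b A_top_not_bottom[OF b] by (simp add: N_def)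
  also have "(\<Sum>z\<in>K - {b}. N u z * W z s) = (\<Sum>z\<in>K - {b}. D u z * W z s)"
    using A_top_not_bottom[OF b] A_unique_bottom[OF b] by (intro sum.cong) (auto simp: N_def)
  finally have Wu: "W u s = (\<Sum>z\<in>K - {b}. D u z * W z s)" by simp
  have "W b s = (\<Sum>z\<in>K. N b z * W z s)" using W_step[of b s] K \<open>b \<noteq> s\<close> by simp
  also have "\<dots> = N b u * W u s + (\<Sum>z\<in>K - {u}. N b z * W z s)"
    using finK K by (intro sum.remove) auto
  also have "(\<Sum>z\<in>K - {u}. N b z * W z s) = 0"
  proof (intro sum.neutral ballI, rule ccontr)
    fix z assume z: "z \<in> K - {u}" "N b z * W z s \<noteq> 0"
    then have nz: "N b z \<noteq> 0" "W z s \<noteq> 0" by auto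
    have "(z, b) \<notin> A" using A_unique_top[OF b] z by blast
    then have "D b z \<noteq> 0" using nz by (auto simp: N_def split: if_splits)
    then have "deg b = Suc (deg z)" using deg_D K z by blast
    then show False using W_deg[of z s] nz assms z bs by auto
  qed
  also have "N b u = - D u b" using b by (simp add: N_def)
  finally have Wb: "W b s = - D u b * W u s" by simp
  have "(\<Sum>z\<in>K. D u z * W z s) = D u b * W b s + (\<Sum>z\<in>K - {b}. D u z * W z s)"
    using finK K by (intro sum.remove) auto
  also have "\<dots> = - (D u b * D u b) * W u s + W u s"
    by (simp only: Wb Wu[symmetric]) (simp add: mult.assoc)
  finally show ?thesis using A_unit[OF b] by simp
qed

lemma D_W_crit:
  assumes "x \<in> crit" "y \<in> K" "x \<noteq> y"
  shows "(\<Sum>z\<in>K. D x z * W z y) = W x y"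
proof -
  have "N x z = D x z" for z using crit_notin[OF assms(1)] by (simp add: N_def)
  then show ?thesis using W_step[of x y] assms crit_K by simp
qed

text \<open>This is the chain map property. Critical and top cells are covered by the previous
  lemmas. For the bottom \<open>x\<close> of a pair \<open>(u, x)\<close>, both sides at
  \<open>x\<close> are determined by the other faces of \<open>u\<close>, which have smaller
  potential than \<open>x\<close>: on the left through \<open>DD\<close>, on the right through the
  recursion at \<open>x\<close> and at \<open>u\<close>.\<close>

lemma D_W:
  assumes "x \<in> K" "s \<in> crit" "deg x = Suc (deg s)"
  shows "(\<Sum>z\<in>K. D x z * W z s) = (\<Sum>t\<in>{t \<in> crit. deg t = Suc (deg s)}. W x t * W t s)"
  using assms
proof (induction "\<mu> x" arbitrary: x rule: less_induct)
  case less
  let ?T = "{t \<in> crit. deg t = Suc (deg s)}"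
  have finT: "finite ?T" using finite_crit by simp
  have sK: "s \<in> K" using less crit_K by blast
  from \<open>x \<in> K\<close> show ?case
  proof (cases rule: crit_cases)
    case 1
    have "(\<Sum>t\<in>?T. W x t * W t s) = (\<Sum>t\<in>?T. if t = x then W t s else 0)"
      using 1 less.prems by (intro sum.cong) (auto simp: W_crit)
    also have "\<dots> = W x s" using finT 1 less.prems by (simp add: sum.delta)
    finally show ?thesis using D_W_crit[OF 1 sK] less.prems by force
  next
    case (2 l)
    then have "x \<in> Domain A" by blast
    then show ?thesis using D_W_top less.prems W_top by simp
  next
    case (3 u)
    have uK: "u \<in> K" using 3 A_K by blast
    have mu: "\<mu> u < \<mu> x" using mu_up 3 by blast
    have degu: "deg u = Suc (deg x)" using A_deg 3 by blast
    \<comment> \<open>For degree reasons every path from \<open>x\<close> to \<open>t\<close> begins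
      with the step up to \<open>u\<close>.\<close>
    have Wx: "W x t = - D u x * W u t" if t: "t \<in> ?T" for t
    proof -
      have tK: "t \<in> K" using t crit_K by auto
      have "x \<noteq> t" using 3 t crit_notin by blast
      then have "W x t = (\<Sum>z\<in>K. N x z * W z t)" using W_step[OF \<open>x \<in> K\<close> tK] by simp
      also have "\<dots> = N x u * W u t + (\<Sum>z\<in>K - {u}. N x z * W z t)"
        using finK uK by (intro sum.remove) auto
      also have "(\<Sum>z\<in>K - {u}. N x z * W z t) = 0"
      proof (intro sum.neutral ballI, rule ccontr)
        fix z assume z: "z \<in> K - {u}" "N x z * W z t \<noteq> 0"
        then have nz: "N x z \<noteq> 0" "W z t \<noteq> 0" by auto
        have "(z, x) \<notin> A" using A_unique_top[OF 3] z by blast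
        then have "D x z \<noteq> 0" using nz by (auto simp: N_def split: if_splits)
        then have "deg x = Suc (deg z)" using deg_D \<open>x \<in> K\<close> z by blast
        then show False using W_deg[of z t] nz t z less.prems by auto
      qed
      finally show ?thesis using 3 by (simp add: N_def)
    qed
    have Wu: "W u t = (\<Sum>y\<in>K - {x}. D u y * W y t)" if t: "t \<in> ?T" for t
    proof -
      have tK: "t \<in> K" using t crit_K by auto
      have "u \<noteq> t" using 3 t crit_notin by blast
      then have "W u t = (\<Sum>z\<in>K. N u z * W z t)" using W_step[OF uK tK] by simp
      also have "\<dots> = N u x * W x t + (\<Sum>z\<in>K - {x}. N u z * W z t)"
        using finK less.prems by (intro sum.remove) auto
      also have "N u x = 0" using 3 A_top_not_bottom[OF 3] by (simp add: N_def)
      also have "(\<Sum>z\<in>K - {x}. N u z * W z t) = (\<Sum>z\<in>K - {x}. D u z * W z t)"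
        using A_top_not_bottom[OF 3] A_unique_bottom[OF 3] by (intro sum.cong) (auto simp: N_def)
      finally show ?thesis by simp
    qed
    define L where "L y = (\<Sum>z\<in>K. D y z * W z s)" for y
    have IH: "D u y * (\<Sum>t\<in>?T. W y t * W t s) = D u y * L y" if y: "y \<in> K - {x}" for y
    proof (cases "D u y = 0")
      case False
      have "(u, y) \<notin> A" using A_unique_bottom[OF 3] y by blast
      then have "\<mu> y < \<mu> x" using mu_down[OF uK _ False] y mu by auto
      moreover have "deg y = Suc (deg s)" using deg_D[OF uK _ False] y degu less.prems by auto
      ultimately show ?thesis using less.hyps[of y] y less.prems by (simp add: L_def)
    qed simp
    have "(\<Sum>t\<in>?T. W x t * W t s) = (\<Sum>t\<in>?T. - D u x * (\<Sum>y\<in>K - {x}. D u y * W y t) * W t s)"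
      using Wx Wu by (intro sum.cong) auto
    also have "\<dots> = (\<Sum>t\<in>?T. \<Sum>y\<in>K - {x}. - D u x * (D u y * (W y t * W t s)))"
      by (simp add: sum_distrib_left sum_distrib_right mult.assoc)
    also have "\<dots> = (\<Sum>y\<in>K - {x}. \<Sum>t\<in>?T. - D u x * (D u y * (W y t * W t s)))"
      by (rule sum.swap)
    also have "\<dots> = - D u x * (\<Sum>y\<in>K - {x}. D u y * (\<Sum>t\<in>?T. W y t * W t s))"
      by (simp add: sum_distrib_left)
    also have "(\<Sum>y\<in>K - {x}. D u y * (\<Sum>t\<in>?T. W y t * W t s)) = (\<Sum>y\<in>K - {x}. D u y * L y)"
      using IH by (intro sum.cong) auto
    also have "\<dots> = (\<Sum>y\<in>K. D u y * L y) - D u x * L x"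
      using finK less.prems sum.remove[of K x "\<lambda>y. D u y * L y"] by simp
    also have "(\<Sum>y\<in>K. D u y * L y) = (\<Sum>y\<in>K. \<Sum>z\<in>K. D u y * D y z * W z s)"
      by (simp add: L_def sum_distrib_left mult.assoc)
    also have "\<dots> = (\<Sum>z\<in>K. \<Sum>y\<in>K. D u y * D y z * W z s)"
      by (rule sum.swap)
    also have "\<dots> = 0" using DD[OF uK] by (simp add: sum_distrib_right[symmetric])
    finally have "(\<Sum>t\<in>?T. W x t * W t s) = (D u x * D u x) * L x" by (simp add: mult.assoc)
    then show ?thesis using A_unit[OF 3] by (simp add: L_def)
  qed
qed

text \<open>On a critical row \<open>W\<close> equals the boundary followed by \<open>W\<close>;
  then \<open>D_W\<close> brings a second boundary to the front, and \<open>DD\<close>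
  applies.\<close>

lemma morse_boundary_boundary:
  assumes "t \<in> crit" "p \<in> crit" "deg t = Suc (Suc (deg p))"
  shows "(\<Sum>s\<in>{s \<in> crit. deg s = Suc (deg p)}. W t s * W s p) = 0"
proof -
  let ?S = "{s \<in> crit. deg s = Suc (deg p)}"
  have K: "t \<in> K" "p \<in> K" using assms crit_K by auto
  have "(\<Sum>s\<in>?S. W t s * W s p) = (\<Sum>s\<in>?S. (\<Sum>z\<in>K. D t z * W z s) * W s p)"
  proof (intro sum.cong refl)
    fix s assume "s \<in> ?S"
    then have "s \<in> K" "t \<noteq> s" using assms crit_K by auto
    then show "W t s * W s p = (\<Sum>z\<in>K. D t z * W z s) * W s p"
      using D_W_crit[OF assms(1)] by simp
  qed
  also have "\<dots> = (\<Sum>s\<in>?S. \<Sum>z\<in>K. D t z * (W z s * W s p))"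
    by (simp add: sum_distrib_right mult.assoc)
  also have "\<dots> = (\<Sum>z\<in>K. \<Sum>s\<in>?S. D t z * (W z s * W s p))"
    by (rule sum.swap)
  also have "\<dots> = (\<Sum>z\<in>K. D t z * (\<Sum>s\<in>?S. W z s * W s p))"
    by (simp add: sum_distrib_left)
  also have "\<dots> = (\<Sum>z\<in>K. D t z * (\<Sum>y\<in>K. D z y * W y p))"
  proof (intro sum.cong refl)
    fix z assume z: "z \<in> K"
    show "D t z * (\<Sum>s\<in>?S. W z s * W s p) = D t z * (\<Sum>y\<in>K. D z y * W y p)"
    proof (cases "D t z = 0")
      case False
      then have "deg z = Suc (deg p)" using deg_D[OF K(1) z] assms by simp
      then show ?thesis using D_W[OF z assms(2)] by simp
    qed simp
  qed
  also have "\<dots> = (\<Sum>z\<in>K. \<Sum>y\<in>K. D t z * D z y * W y p)"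
    by (simp add: sum_distrib_left mult.assoc)
  also have "\<dots> = (\<Sum>y\<in>K. \<Sum>z\<in>K. D t z * D z y * W y p)"
    by (rule sum.swap)
  also have "\<dots> = 0" using DD[OF K(1)] by (simp add: sum_distrib_right[symmetric])
  finally show ?thesis .
qed

theorem morse_exact:
  assumes z_deg: "\<And>t. \<lbrakk>t \<in> crit; z t \<noteq> 0\<rbrakk> \<Longrightarrow> deg t = Suc n"
    and z_cycle: "\<And>s. \<lbrakk>s \<in> crit; deg s = n\<rbrakk> \<Longrightarrow> (\<Sum>t\<in>crit. z t * W t s) = 0"
    and exact: "\<And>x. \<lbrakk>\<And>y. \<lbrakk>y \<in> K; x y \<noteq> 0\<rbrakk> \<Longrightarrow> deg y = Suc n;
                      \<And>v. v \<in> K \<Longrightarrow> (\<Sum>y\<in>K. x y * D y v) = 0\<rbrakk> \<Longrightarrow>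
      \<exists>w. (\<forall>u. w u \<noteq> 0 \<longrightarrow> u \<in> K \<and> deg u = Suc (Suc n)) \<and> (\<forall>y\<in>K. x y = (\<Sum>u\<in>K. w u * D u y))"
  shows "\<exists>w. (\<forall>t. w t \<noteq> 0 \<longrightarrow> t \<in> crit \<and> deg t = Suc (Suc n)) \<and>
             (\<forall>s\<in>crit. deg s = Suc n \<longrightarrow> z s = (\<Sum>t\<in>crit. w t * W t s))"
proof -
  \<comment> \<open>The extension of \<open>z\<close> by 0, which need not be a cycle of the full
    complex.\<close>
  define i where "i = (\<lambda>y. if y \<in> crit then z y else 0)"
  have sum_i: "(\<Sum>y\<in>K. i y * g y) = (\<Sum>t\<in>crit. z t * g t)" for g
    using finK crit_K
    by (intro sum.mono_neutral_cong_right) (auto simp: i_def)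
  have i_deg: "deg y = Suc n" if "i y \<noteq> 0" for y
    using that z_deg by (auto simp: i_def split: if_splits)
  define x where "x = (\<lambda>v. \<Sum>u\<in>K. i u * D u v)"
  \<comment> \<open>The boundary of \<open>i\<close> need not vanish, but all path sums kill it;
    boundaries of tops share this property by \<open>D_W_top\<close>.\<close>
  define H where "H y \<longleftrightarrow> (\<forall>v\<in>K. y v \<noteq> 0 \<longrightarrow> deg v = n) \<and>
    (\<forall>s\<in>crit. deg s = n \<longrightarrow> (\<Sum>v\<in>K. y v * W v s) = 0)" for y
  have push: "(\<Sum>v\<in>K. (\<Sum>u\<in>K. g u * D u v) * W v s) = (\<Sum>u\<in>K. g u * (\<Sum>v\<in>K. D u v * W v s))"
    for g s
  proof -
    have "(\<Sum>v\<in>K. (\<Sum>u\<in>K. g u * D u v) * W v s) = (\<Sum>v\<in>K. \<Sum>u\<in>K. g u * (D u v * W v s))"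
      by (simp add: sum_distrib_right mult.assoc)
    also have "\<dots> = (\<Sum>u\<in>K. \<Sum>v\<in>K. g u * (D u v * W v s))" by (rule sum.swap)
    finally show ?thesis by (simp add: sum_distrib_left)
  qed
  have boundary_deg: "deg v = n"
    if "v \<in> K" "(\<Sum>u\<in>K. g u * D u v) \<noteq> 0" "\<And>u. g u \<noteq> 0 \<Longrightarrow> deg u = Suc n" for g v
  proof -
    from that(2) obtain u where u: "u \<in> K" "g u * D u v \<noteq> 0" by (rule sum.not_neutral_contains_not_neutral)
    then have "g u \<noteq> 0" "D u v \<noteq> 0" by auto
    then show ?thesis using deg_D[of u v] that u by simp
  qed
  have x_deg: "deg v = n" if "v \<in> K" "x v \<noteq> 0" for v
    using boundary_deg[of v i] that i_deg by (simp add: x_def)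
  have "\<exists>w. (\<forall>u. w u \<noteq> 0 \<longrightarrow> u \<in> Domain A \<and> deg u = Suc n) \<and>
             (\<forall>y\<in>K. x y = (\<Sum>u\<in>K. w u * D u y))"
  proof (rule cycle_boundary[of H])
    have "(\<Sum>v\<in>K. x v * W v s) = 0" if s: "s \<in> crit" "deg s = n" for s
    proof -
      have "(\<Sum>v\<in>K. x v * W v s) = (\<Sum>u\<in>K. i u * (\<Sum>v\<in>K. D u v * W v s))"
        unfolding x_def by (rule push)
      also have "\<dots> = (\<Sum>u\<in>crit. z u * (\<Sum>v\<in>K. D u v * W v s))" by (rule sum_i)
      also have "\<dots> = (\<Sum>u\<in>crit. z u * W u s)"
      proof (intro sum.cong refl)
        fix u assume u: "u \<in> crit"
        show "z u * (\<Sum>v\<in>K. D u v * W v s) = z u * W u s"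
        proof (cases "z u = 0")
          case False
          then have "u \<noteq> s" using z_deg[OF u] s by auto
          then show ?thesis using D_W_crit[OF u] s crit_K by simp
        qed simp
      qed
      finally show "(\<Sum>v\<in>K. x v * W v s) = 0" using z_cycle[OF s] by simp
    qed
    then show "H x" using x_deg by (simp add: H_def)
    show "H (\<lambda>v. y v - (\<Sum>u\<in>K. w u * D u v))"
      if "H y" and w: "\<And>u. w u \<noteq> 0 \<Longrightarrow> u \<in> Domain A \<and> deg u = Suc n" for y w
      unfolding H_def
    proof (intro conjI ballI impI)
      fix v assume v: "v \<in> K" "y v - (\<Sum>u\<in>K. w u * D u v) \<noteq> 0"
      then have "y v \<noteq> 0 \<or> (\<Sum>u\<in>K. w u * D u v) \<noteq> 0" by auto
      then show "deg v = n" using boundary_deg[OF v(1), of w] w v \<open>H y\<close> by (auto simp: H_def)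
    next
      fix s assume s: "s \<in> crit" "deg s = n"
      have "w u * (\<Sum>v\<in>K. D u v * W v s) = 0" for u
        using w[of u] D_W_top[of u s] s by (cases "w u = 0") auto
      then show "(\<Sum>v\<in>K. (y v - (\<Sum>u\<in>K. w u * D u v)) * W v s) = 0"
        using \<open>H y\<close> s push[of w s] by (simp add: H_def left_diff_distrib sum_subtractf)
    qed
    show "deg y = n" if "y \<in> K" "x y \<noteq> 0" for y
      using that by (rule x_deg)
    \<comment> \<open>The path sum to \<open>r\<close> is zero but contains the term
      \<open>y r * W r r = y r\<close>. So another cell \<open>v\<close> must contribute, and by
      \<open>W_mu\<close> it has larger potential.\<close>
    show "\<exists>v\<in>K. y v \<noteq> 0 \<and> \<mu> r < \<mu> v" if "H y" "r \<in> crit" "y r \<noteq> 0" for y r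
    proof -
      have rK: "r \<in> K" "deg r = n" using that crit_K by (auto simp: H_def)
      have "0 = (\<Sum>v\<in>K. y v * W v r)" using that rK by (simp add: H_def)
      also have "\<dots> = y r + (\<Sum>v\<in>K - {r}. y v * W v r)"
        using finK rK W_self by (simp add: sum.remove)
      finally have "(\<Sum>v\<in>K - {r}. y v * W v r) \<noteq> 0" using that by auto
      then obtain v where v: "v \<in> K - {r}" "y v * W v r \<noteq> 0"
        by (rule sum.not_neutral_contains_not_neutral)
      then have "y v \<noteq> 0" "W v r \<noteq> 0" by auto
      with v show ?thesis using W_mu[of v r] rK by (intro bexI[of _ v]) auto
    qed
    show "(\<Sum>y\<in>K. x y * D y v) = 0" if "v \<in> K" for v
      unfolding x_def by (rule boundary_boundary[OF that])
  qed
  then obtain w where w: "\<And>u. w u \<noteq> 0 \<Longrightarrow> u \<in> Domain A \<and> deg u = Suc n"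
    and xw: "\<And>y. y \<in> K \<Longrightarrow> x y = (\<Sum>u\<in>K. w u * D u y)" by blast
  \<comment> \<open>Correcting \<open>i\<close> by tops makes it a cycle and does not change its
    image under the path sums, which vanish on tops by \<open>W_top\<close>.\<close>
  have "\<exists>w'. (\<forall>u. w' u \<noteq> 0 \<longrightarrow> u \<in> K \<and> deg u = Suc (Suc n)) \<and>
             (\<forall>y\<in>K. i y - w y = (\<Sum>u\<in>K. w' u * D u y))"
  proof (rule exact)
    show "deg y = Suc n" if "i y - w y \<noteq> 0" for y
      using that i_deg[of y] w[of y] by (cases "w y = 0") auto
    show "(\<Sum>y\<in>K. (i y - w y) * D y v) = 0" if "v \<in> K" for v
      using xw[OF that] by (simp add: x_def left_diff_distrib sum_subtractf)
  qed
  then obtain w' where w': "\<And>u. w' u \<noteq> 0 \<Longrightarrow> u \<in> K \<and> deg u = Suc (Suc n)"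
    and iw: "\<And>y. y \<in> K \<Longrightarrow> i y - w y = (\<Sum>u\<in>K. w' u * D u y)" by blast
  \<comment> \<open>The image of \<open>w'\<close> under the path sums is the required Morse
    chain.\<close>
  define c where "c t = (if t \<in> crit \<and> deg t = Suc (Suc n) then \<Sum>r\<in>K. w' r * W r t else 0)" for t
  have "z s = (\<Sum>t\<in>crit. c t * W t s)" if s: "s \<in> crit" "deg s = Suc n" for s
  proof -
    let ?T = "{t \<in> crit. deg t = Suc (deg s)}"
    have "(\<Sum>t\<in>crit. c t * W t s) = (\<Sum>t\<in>?T. c t * W t s)"
      using finite_crit s by (intro sum.mono_neutral_right) (auto simp: c_def)
    also have "\<dots> = (\<Sum>t\<in>?T. \<Sum>r\<in>K. w' r * (W r t * W t s))"
      using s by (intro sum.cong) (auto simp: c_def sum_distrib_right mult.assoc)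
    also have "\<dots> = (\<Sum>r\<in>K. \<Sum>t\<in>?T. w' r * (W r t * W t s))"
      by (rule sum.swap)
    also have "\<dots> = (\<Sum>r\<in>K. w' r * (\<Sum>t\<in>?T. W r t * W t s))"
      by (simp add: sum_distrib_left)
    also have "\<dots> = (\<Sum>r\<in>K. w' r * (\<Sum>v\<in>K. D r v * W v s))"
    proof (intro sum.cong refl)
      fix r assume "r \<in> K"
      then show "w' r * (\<Sum>t\<in>?T. W r t * W t s) = w' r * (\<Sum>v\<in>K. D r v * W v s)"
        using w'[of r] D_W[of r s] s by (cases "w' r = 0") auto
    qed
    also have "\<dots> = (\<Sum>v\<in>K. (\<Sum>r\<in>K. w' r * D r v) * W v s)" by (rule push[symmetric])
    also have "\<dots> = (\<Sum>v\<in>K. i v * W v s) - (\<Sum>v\<in>K. w v * W v s)"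
      by (simp add: left_diff_distrib sum_subtractf flip: iw)
    also have "(\<Sum>v\<in>K. w v * W v s) = 0"
    proof (intro sum.neutral ballI)
      fix v show "w v * W v s = 0" using w[of v] W_top[of v s] s by (cases "w v = 0") auto
    qed
    also have "(\<Sum>v\<in>K. i v * W v s) = (\<Sum>t\<in>crit. z t * W t s)" by (rule sum_i)
    also have "\<dots> = (\<Sum>t\<in>crit. if t = s then z t else 0)"
    proof (intro sum.cong refl)
      fix t assume "t \<in> crit"
      then show "z t * W t s = (if t = s then z t else 0)"
        using z_deg[of t] W_crit[of t s] s by (cases "z t = 0") auto
    qed
    also have "\<dots> = z s" using finite_crit s by simp
    finally show ?thesis by simp
  qed
  then show ?thesis by (intro exI[of _ c]) (auto simp: c_def split: if_splits)
qed

end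

section \<open>Toggle matchings and sums over gradient paths\<close>

definition toggle_matching ::
    "'v set set \<Rightarrow> ('v set \<Rightarrow> nat) \<Rightarrow> ('v set \<Rightarrow> 'v option) \<Rightarrow> ('v set \<times> 'v set) set" where
  "toggle_matching K I w =
     {(x, y). x \<in> K \<and> y \<in> K \<and> I x = I y \<and> (\<exists>v\<in>x. w x = Some v \<and> y = x - {v})}"

text \<open>\<open>I\<close> separates the fibres and \<open>w\<close> names the vertex to toggle,
  with \<open>None\<close> where nothing is matched. Constancy of \<open>w\<close> is required only
  between comparable faces, so incomparable faces with equal \<open>I\<close> may be toggled at
  different vertices.\<close>

locale toggle =
  fixes K :: "'v set set" and I :: "'v set \<Rightarrow> nat" and w :: "'v set \<Rightarrow> 'v option"
  assumes fin_K: "finite K"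
    and fin_face: "x \<in> K \<Longrightarrow> finite x"
    and I_mono: "\<lbrakk>x \<in> K; y \<in> K; y \<subseteq> x\<rbrakk> \<Longrightarrow> I y \<le> I x"
    and w_fibre: "\<lbrakk>x \<in> K; y \<in> K; y \<subseteq> x; I y = I x\<rbrakk> \<Longrightarrow> w y = w x"
begin

abbreviation M :: "('v set \<times> 'v set) set" where "M \<equiv> toggle_matching K I w"

definition missing :: "'v set \<Rightarrow> nat" where
  "missing x = (case w x of None \<Rightarrow> 0 | Some v \<Rightarrow> if v \<in> x then 0 else 1)"

text \<open>Lexicographic in the fibre, the absence of the toggled vertex, and the cardinality.\<close>

definition pot :: "'v set \<Rightarrow> nat" where
  "pot x = (2 * I x + missing x) * Suc (Max (card ` K)) + card x"

lemma pot_less: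
  assumes "2 * I x + missing x < 2 * I y + missing y" "x \<in> K"
  shows "pot x < pot y"
proof -
  have "card x < Suc (Max (card ` K))" using fin_K assms by (simp add: less_Suc_eq_le)
  then have "pot x < Suc (2 * I x + missing x) * Suc (Max (card ` K))"
    by (simp add: pot_def)
  also have "\<dots> \<le> (2 * I y + missing y) * Suc (Max (card ` K))"
    using assms by (intro mult_right_mono) auto
  also have "\<dots> \<le> pot y" by (simp add: pot_def)
  finally show ?thesis .
qed

lemma M_E:
  assumes "(u, l) \<in> M"
  obtains v where "u \<in> K" "l \<in> K" "I u = I l" "v \<in> u" "w u = Some v" "w l = Some v" "l = u - {v}"
proof -
  from assms obtain v where v: "u \<in> K" "l \<in> K" "I u = I l" "v \<in> u" "w u = Some v" "l = u - {v}"
    by (auto simp: toggle_matching_def)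
  moreover have "w l = Some v" using w_fibre[of u l] v by auto
  ultimately show thesis using that by blast
qed

lemma pot_up: "(u, l) \<in> M \<Longrightarrow> pot u < pot l"
  by (elim M_E) (rule pot_less, auto simp: missing_def)

text \<open>Inside a fibre, deleting the toggled vertex would be the matched edge itself; so
  \<open>missing\<close> does not change and the cardinality decides. Between fibres
  \<open>I\<close> drops, and the factor 2 in \<open>pot\<close> outweighs a possible rise of
  \<open>missing\<close>.\<close>

lemma pot_down:
  assumes "x \<in> K" "y \<in> K" "y \<subseteq> x" "card x = Suc (card y)" "(x, y) \<notin> M"
  shows "pot y < pot x"
proof (cases "I y = I x")
  case False
  then have "I y < I x" using I_mono assms by force
  moreover have "missing y \<le> 1" by (auto simp: missing_def split: option.splits)
  ultimately show ?thesis using assms by (intro pot_less) auto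
next
  case True
  have w: "w y = w x" using w_fibre assms True by blast
  have fx: "finite x" using fin_face assms by blast
  have "missing y = missing x"
  proof (rule ccontr)
    assume "missing y \<noteq> missing x"
    then obtain v where v: "w x = Some v" "v \<in> x" "v \<notin> y"
      using w \<open>y \<subseteq> x\<close> by (auto simp: missing_def split: option.splits if_splits)
    then have "y = x - {v}" using assms fx by (intro card_seteq) auto
    then show False using assms v True by (auto simp: toggle_matching_def)
  qed
  then show ?thesis using True assms by (simp add: pot_def)
qed

lemma M_face_edges: "M \<subseteq> face_edges K"
proof clarify
  fix u l assume "(u, l) \<in> M"
  then show "(u, l) \<in> face_edges K"
  proof (rule M_E)
    fix v assume v: "u \<in> K" "l \<in> K" "v \<in> u" "l = u - {v}"
    then have "card u = Suc (card l)" using fin_face card.remove by metis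
    then show ?thesis using v by (auto simp: face_edges_def)
  qed
qed

text \<open>A shared face determines the toggled vertex, and whether it contains that vertex decides
  if it is the top or the bottom.\<close>

lemma M_disjoint:
  assumes "(u, l) \<in> M" "(u', l') \<in> M" "{u, l} \<inter> {u', l'} \<noteq> {}"
  shows "u = u' \<and> l = l'"
proof -
  from assms(1) obtain v where v: "v \<in> u" "w u = Some v" "w l = Some v" "l = u - {v}"
    by (rule M_E)
  from assms(2) obtain v' where v': "v' \<in> u'" "w u' = Some v'" "w l' = Some v'" "l' = u' - {v'}"
    by (rule M_E)
  have "v = v'" using assms(3) v(2,3) v'(2,3) by auto
  moreover from this have "u \<noteq> l'" "l \<noteq> u'" using v(1,4) v'(1,4) by blast+
  ultimately show ?thesis using assms(3) v(1,4) v'(1,4) by (metis Int_emptyI insert_Diff insertE singletonD)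
qed

lemma pot_decreasing:
  assumes "(x, y) \<in> morse_graph K M"
  shows "pot y < pot x"
  using assms pot_up pot_down by (auto simp: morse_graph_def face_edges_def)

lemma acyclic_matching: "acyclic_matching K M"
proof -
  have "wf ((morse_graph K M)\<inverse>)"
    by (rule wf_subset[OF wf_measure[of pot]]) (auto dest: pot_decreasing)
  then have "acyclic (morse_graph K M)"
    using wf_acyclic[of "(morse_graph K M)\<inverse>"] by (simp only: acyclic_converse)
  then show ?thesis
    unfolding acyclic_matching_def
  proof (intro conjI ballI impI)
    fix e e' assume e: "e \<in> M" "e' \<in> M" "e \<noteq> e'"
    show "{fst e, snd e} \<inter> {fst e', snd e'} = {}"
    proof (rule ccontr)
      assume "{fst e, snd e} \<inter> {fst e', snd e'} \<noteq> {}"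
      from M_disjoint[OF _ _ this] e show False by (simp add: prod_eq_iff)
    qed
  qed (rule M_face_edges)
qed

end

section \<open>Path sums by their first step\<close>

lemma finite_morse_paths:
  assumes fin: "finite K" and A: "A \<subseteq> K \<times> K"
    and pot: "\<And>x y. (x, y) \<in> morse_graph K A \<Longrightarrow> \<mu> y < (\<mu> x :: nat)"
  shows "finite (morse_paths K A x y)"
    and "morse_paths K A x y = (if x = y then {[x]} else {}) \<union>
           (\<Union>z\<in>{z \<in> K. (x, z) \<in> morse_graph K A}. (#) x ` morse_paths K A z y)"
proof -
  have E: "z \<in> K" if "(x, z) \<in> morse_graph K A" for x z
    using that A by (auto simp: morse_graph_def face_edges_def)
  have rec: "morse_paths K A x y = (if x = y then {[x]} else {}) \<union>
           (\<Union>z\<in>{z \<in> K. (x, z) \<in> morse_graph K A}. (#) x ` morse_paths K A z y)" for x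
  proof (rule equalityI; rule subsetI)
    fix p assume "p \<in> morse_paths K A x y"
    then have p: "p \<noteq> []" "hd p = x" "last p = y" "successively (\<lambda>x y. (x, y) \<in> morse_graph K A) p"
      by (auto simp: morse_paths_def)
    then obtain p' where p': "p = x # p'" by (cases p) auto
    show "p \<in> (if x = y then {[x]} else {}) \<union>
           (\<Union>z\<in>{z \<in> K. (x, z) \<in> morse_graph K A}. (#) x ` morse_paths K A z y)"
    proof (cases p')
      case Nil
      then show ?thesis using p p' by auto
    next
      case (Cons z r)
      then have "(x, z) \<in> morse_graph K A" "p' \<in> morse_paths K A z y"
        using p p' by (auto simp: morse_paths_def)
      then show ?thesis using E p' by auto
    qed
  next
    fix p assume "p \<in> (if x = y then {[x]} else {}) \<union>
           (\<Union>z\<in>{z \<in> K. (x, z) \<in> morse_graph K A}. (#) x ` morse_paths K A z y)"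
    then show "p \<in> morse_paths K A x y"
      by (auto simp: morse_paths_def successively_Cons split: if_splits)
  qed
  show "finite (morse_paths K A x y)"
  proof (induction "\<mu> x" arbitrary: x rule: less_induct)
    case less
    show ?case unfolding rec[of x] using fin less pot by auto
  qed
  show "morse_paths K A x y = (if x = y then {[x]} else {}) \<union>
           (\<Union>z\<in>{z \<in> K. (x, z) \<in> morse_graph K A}. (#) x ` morse_paths K A z y)"
    by (rule rec)
qed

lemma path_weight_Cons:
  "p \<noteq> [] \<Longrightarrow> path_weight V A (x # p) = step_weight V A x (hd p) * path_weight V A p"
proof -
  assume "p \<noteq> []"
  then obtain z r where p: "p = z # r" by (cases p) auto
  show ?thesis unfolding path_weight_def p
    by (simp add: prod.lessThan_Suc_shift del: prod.lessThan_Suc)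
qed

text \<open>The one fact about path sums that the exactness arguments use, in the form of
  \<open>W_rec\<close>. Paths are told apart by their second entry, so the sum splits over the first
  step.\<close>

lemma morse_incidence_rec:
  assumes fin: "finite K" and A: "A \<subseteq> K \<times> K"
    and pot: "\<And>x y. (x, y) \<in> morse_graph K A \<Longrightarrow> \<mu> y < (\<mu> x :: nat)"
  shows "morse_incidence K V A x y = (if x = y then 1 else 0) +
     (\<Sum>z\<in>K. if (x, z) \<in> morse_graph K A then step_weight V A x z * morse_incidence K V A z y else 0)"
proof -
  let ?E = "{z \<in> K. (x, z) \<in> morse_graph K A}"
  have paths: "finite (morse_paths K A x y)" "morse_paths K A x y = (if x = y then {[x]} else {}) \<union>
      (\<Union>z\<in>{z \<in> K. (x, z) \<in> morse_graph K A}. (#) x ` morse_paths K A z y)" for x y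
    by (rule finite_morse_paths[OF fin A pot]; assumption)+
  have disj: "(if x = y then {[x]} else {}) \<inter> (\<Union>z\<in>?E. (#) x ` morse_paths K A z y) = {}"
    by (auto simp: morse_paths_def)
  have "morse_incidence K V A x y =
      sum (path_weight V A) (if x = y then {[x]} else {}) +
      sum (path_weight V A) (\<Union>z\<in>?E. (#) x ` morse_paths K A z y)"
    unfolding morse_incidence_def
    by (subst paths(2), rule sum.union_disjoint) (use fin paths(1) disj in auto)
  also have "sum (path_weight V A) (if x = y then {[x]} else {}) = (if x = y then 1 else 0)"
    by (simp add: path_weight_def)
  also have "sum (path_weight V A) (\<Union>z\<in>?E. (#) x ` morse_paths K A z y) =
      (\<Sum>z\<in>?E. sum (path_weight V A) ((#) x ` morse_paths K A z y))"
    by (rule sum.UNION_disjoint) (use fin paths(1) in \<open>auto simp: morse_paths_def\<close>)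
  also have "\<dots> = (\<Sum>z\<in>?E. step_weight V A x z * morse_incidence K V A z y)"
  proof (intro sum.cong refl)
    fix z
    have "sum (path_weight V A) ((#) x ` morse_paths K A z y) =
        (\<Sum>p\<in>morse_paths K A z y. path_weight V A (x # p))"
      by (simp add: sum.reindex)
    also have "\<dots> = (\<Sum>p\<in>morse_paths K A z y. step_weight V A x z * path_weight V A p)"
      by (intro sum.cong) (auto simp: path_weight_Cons morse_paths_def)
    finally show "sum (path_weight V A) ((#) x ` morse_paths K A z y) =
        step_weight V A x z * morse_incidence K V A z y"
      by (simp add: morse_incidence_def sum_distrib_left)
  qed
  also have "\<dots> = (\<Sum>z\<in>K. if (x, z) \<in> morse_graph K A
      then step_weight V A x z * morse_incidence K V A z y else 0)"
    using fin by (simp add: sum.inter_filter)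
  finally show ?thesis .
qed

section \<open>The simplicial boundary, including the empty face\<close>

definition boundary_coeff :: "('v \<times> 'v) set \<Rightarrow> 'v set \<Rightarrow> 'v set \<Rightarrow> 'k::comm_ring_1" where
  "boundary_coeff V x y =
     (if y \<subseteq> x \<and> card x = Suc (card y) then of_int (simplicial_incidence V x y) else 0)"

lemma simplicial_incidence_insert:
  assumes "v \<notin> y"
  shows "simplicial_incidence V (insert v y) y = (-1) ^ card {t \<in> y. (t, v) \<in> V}"
proof -
  have "insert v y - y = {v}" using assms by auto
  then show ?thesis by (simp add: simplicial_incidence_def)
qed

text \<open>Adding \<open>v\<close> to the face flips the sign of \<open>w\<close> exactly if
  \<open>v\<close> precedes \<open>w\<close>, and conversely. Of two distinct vertices exactly one
  precedes the other, so exactly one of the two products is flipped.\<close>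

lemma simplicial_incidence_cancel:
  assumes V: "linear_order_on S V" and "finite z" "v \<in> S" "w \<in> S" "v \<notin> z" "w \<notin> z" "v \<noteq> w"
  shows "simplicial_incidence V (insert w (insert v z)) (insert v z) *
           simplicial_incidence V (insert v z) z +
         simplicial_incidence V (insert v (insert w z)) (insert w z) *
           simplicial_incidence V (insert w z) z = 0"
proof -
  have card_ins: "card {t \<in> insert a z. (t, b) \<in> V} =
      card {t \<in> z. (t, b) \<in> V} + (if (a, b) \<in> V then 1 else 0)" if "a \<notin> z" for a b
  proof -
    have "{t \<in> insert a z. (t, b) \<in> V} =
        (if (a, b) \<in> V then insert a {t \<in> z. (t, b) \<in> V} else {t \<in> z. (t, b) \<in> V})"
      by auto
    then show ?thesis using assms that by auto
  qed
  have order: "((v, w) \<in> V) \<noteq> ((w, v) \<in> V)"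
    using V assms by (auto simp: linear_order_on_def partial_order_on_def total_on_def antisym_def)
  have notin: "w \<notin> insert v z" "v \<notin> insert w z" using assms by auto
  note eqs = notin[THEN simplicial_incidence_insert] assms(5,6)[THEN simplicial_incidence_insert]
    assms(5,6)[THEN card_ins]
  show ?thesis
    unfolding eqs using order by (cases "(v, w) \<in> V") auto
qed

lemma boundary_coeff_square:
  assumes V: "linear_order_on S V" and K: "finite K" "\<And>x. x \<in> K \<Longrightarrow> finite x \<and> x \<subseteq> S"
    and closed: "\<And>x y. x \<in> K \<Longrightarrow> y \<subseteq> x \<Longrightarrow> y \<in> K"
    and "x \<in> K" "z \<in> K"
  shows "(\<Sum>y\<in>K. boundary_coeff V x y * boundary_coeff V y z) = (0 :: 'k::comm_ring_1)"
proof (cases "z \<subseteq> x \<and> card x = Suc (Suc (card z))")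
  case False
  have "boundary_coeff V x y * boundary_coeff V y z = (0 :: 'k)" for y
    using False by (auto simp: boundary_coeff_def)
  then show ?thesis by simp
next
  case True
  have finx: "finite x" "x \<subseteq> S" using K assms by auto
  have finz: "finite z" using K assms by auto
  have "card (x - z) = 2" using True finx finz by (simp add: card_Diff_subset)
  then obtain v w where vw: "x - z = {v, w}" "v \<noteq> w" by (meson card_2_iff)
  have x: "x = insert w (insert v z)" "x = insert v (insert w z)" using vw True by auto
  have nz: "v \<notin> z" "w \<notin> z" "v \<in> S" "w \<in> S" using vw finx by auto
  have ne: "insert v z \<noteq> insert w z" using nz vw by auto
  have inK: "insert v z \<in> K" "insert w z \<in> K" using closed[OF \<open>x \<in> K\<close>] x by blast+
  have zero: "boundary_coeff V x y * boundary_coeff V y z = (0 :: 'k)"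
    if "y \<in> K - {insert v z, insert w z}" for y
  proof (rule ccontr)
    assume "boundary_coeff V x y * boundary_coeff V y z \<noteq> (0 :: 'k)"
    then have y: "y \<subseteq> x" "z \<subseteq> y" "card y = Suc (card z)"
      by (auto simp: boundary_coeff_def split: if_splits)
    then obtain t where t: "t \<in> y" "t \<notin> z"
      by (metis n_not_Suc_n subset_antisym subsetI)
    have "finite y" using y finx finite_subset by blast
    then have "insert t z = y" using y t finz by (intro card_seteq) auto
    then show False using that t y vw by auto
  qed
  have "(\<Sum>y\<in>K. boundary_coeff V x y * boundary_coeff V y z) =
      (\<Sum>y\<in>{insert v z, insert w z}. boundary_coeff V x y * boundary_coeff V y z :: 'k)"
    using K zero inK by (intro sum.mono_neutral_right) auto
  also have "\<dots> = boundary_coeff V x (insert v z) * boundary_coeff V (insert v z) z +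
      boundary_coeff V x (insert w z) * boundary_coeff V (insert w z) z"
    using ne by simp
  also have "\<dots> = of_int (simplicial_incidence V x (insert v z) * simplicial_incidence V (insert v z) z +
      simplicial_incidence V x (insert w z) * simplicial_incidence V (insert w z) z)"
    using finz nz True x by (simp add: boundary_coeff_def subset_insertI)
  also have "\<dots> = 0"
    using simplicial_incidence_cancel[OF V finz nz(3,4,1,2) vw(2)] x by simp
  finally show ?thesis .
qed

lemma boundary_coeff_unit:
  assumes "y \<subseteq> x" "card x = Suc (card y)"
  shows "boundary_coeff V x y * boundary_coeff V x y = (1 :: 'k::comm_ring_1)"
proof -
  have "simplicial_incidence V x y * simplicial_incidence V x y = 1"
    by (simp add: simplicial_incidence_def flip: power_mult_distrib)
  then have "(of_int (simplicial_incidence V x y) * of_int (simplicial_incidence V x y) :: 'k) = 1"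
    by (metis of_int_1 of_int_mult)
  then show ?thesis using assms by (simp add: boundary_coeff_def)
qed

context toggle begin

text \<open>A gradient path that starts in \<open>L\<close> stays there, downward by
  \<open>closed\<close> and upward by \<open>up\<close>. Hence the path sums of \<open>K\<close>
  serve every such \<open>L\<close> at once, and the same incidence numbers work in all
  strands.\<close>

lemma morse_paths_sum_subcomplex:
  assumes V: "linear_order_on S V" and K_S: "\<And>x. x \<in> K \<Longrightarrow> x \<subseteq> S"
    and L: "L \<subseteq> K" and closed: "\<And>x y. x \<in> L \<Longrightarrow> y \<subseteq> x \<Longrightarrow> y \<in> L"
    and up: "\<And>u l. (u, l) \<in> M \<Longrightarrow> l \<in> L \<Longrightarrow> u \<in> L"
  shows "morse_paths_sum L card (boundary_coeff V :: _ \<Rightarrow> _ \<Rightarrow> 'k::comm_ring_1) (M \<inter> L \<times> L) pot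
           (\<lambda>x y. of_int (morse_incidence K V M x y))"
proof unfold_locales
  have MK: "M \<subseteq> K \<times> K" by (auto simp: toggle_matching_def)
  have M_bc: "l \<subseteq> u \<and> card u = Suc (card l)" if "(u, l) \<in> M" for u l
    using that M_face_edges by (auto simp: face_edges_def)
  show "finite L" using L fin_K finite_subset by blast
  show "card x = Suc (card y)" if "(boundary_coeff V x y :: 'k) \<noteq> 0" for x y :: "'v set"
    using that by (simp add: boundary_coeff_def split: if_splits)
  show "(\<Sum>y\<in>L. boundary_coeff V x y * boundary_coeff V y z) = (0 :: 'k)" if "x \<in> L" "z \<in> L" for x z
  proof (rule boundary_coeff_square[OF V _ _ _ that])
    show "finite L" by fact
    show "finite x \<and> x \<subseteq> S" if "x \<in> L" for x using that L fin_face K_S by blast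
  qed (use closed in blast)
  show "u \<in> L \<and> l \<in> L" if "(u, l) \<in> M \<inter> L \<times> L" for u l using that by blast
  show "boundary_coeff V u l * boundary_coeff V u l = (1 :: 'k)" if "(u, l) \<in> M \<inter> L \<times> L" for u l
    using that M_bc boundary_coeff_unit by blast
  show "u = u' \<and> l = l'"
    if "(u, l) \<in> M \<inter> L \<times> L" "(u', l') \<in> M \<inter> L \<times> L" "{u, l} \<inter> {u', l'} \<noteq> {}" for u l u' l'
    using that M_disjoint by blast
  show "pot u < pot l" if "(u, l) \<in> M \<inter> L \<times> L" for u l using that pot_up by blast
  show "pot y < pot x" if "x \<in> L" "y \<in> L" "(boundary_coeff V x y :: 'k) \<noteq> 0" "(x, y) \<notin> M \<inter> L \<times> L" for x y
    using that L pot_down[of x y] by (auto simp: boundary_coeff_def split: if_splits)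
  show "of_int (morse_incidence K V M x y) = (if x = y then 1 else 0) +
     (\<Sum>z\<in>L. (if (z, x) \<in> M \<inter> L \<times> L then - boundary_coeff V z x
             else if (x, z) \<in> M \<inter> L \<times> L then 0 else boundary_coeff V x z :: 'k) *
        of_int (morse_incidence K V M z y))" if "x \<in> L" "y \<in> L" for x y
  proof -
    let ?s = "\<lambda>z. if (x, z) \<in> morse_graph K M then step_weight V M x z * morse_incidence K V M z y else 0"
    have in_L: "z \<in> L" if "(x, z) \<in> morse_graph K M" for z
      using that \<open>x \<in> L\<close> closed up by (auto simp: morse_graph_def face_edges_def)
    have "morse_incidence K V M x y = (if x = y then 1 else 0) + (\<Sum>z\<in>K. ?s z)"
      by (rule morse_incidence_rec[OF fin_K MK pot_decreasing])
    also have "(\<Sum>z\<in>K. ?s z) = (\<Sum>z\<in>L. ?s z)"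
      using fin_K L in_L by (intro sum.mono_neutral_right) auto
    finally have "(of_int (morse_incidence K V M x y) :: 'k) =
        (if x = y then 1 else 0) + (\<Sum>z\<in>L. of_int (?s z))" by simp
    also have "(\<Sum>z\<in>L. of_int (?s z) :: 'k) = (\<Sum>z\<in>L. (if (z, x) \<in> M \<inter> L \<times> L then - boundary_coeff V z x
             else if (x, z) \<in> M \<inter> L \<times> L then 0 else boundary_coeff V x z) *
        of_int (morse_incidence K V M z y))"
    proof (intro sum.cong refl)
      fix z assume z: "z \<in> L"
      have K: "x \<in> K" "z \<in> K" using z L \<open>x \<in> L\<close> by auto
      have anti: "(x, z) \<notin> M" if "(z, x) \<in> M" using M_bc[OF that] M_bc[of x z] by auto
      consider "(z, x) \<in> M" "(x, z) \<notin> M" | "(x, z) \<in> M" "(z, x) \<notin> M"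
        | "(x, z) \<notin> M" "(z, x) \<notin> M" using anti by blast
      then
      show "of_int (?s z) = (if (z, x) \<in> M \<inter> L \<times> L then - boundary_coeff V z x
             else if (x, z) \<in> M \<inter> L \<times> L then 0 else boundary_coeff V x z) *
        (of_int (morse_incidence K V M z y) :: 'k)"
      proof cases
        case 1
        then have "z \<noteq> x" using M_bc by fastforce
        then show ?thesis using 1 z \<open>x \<in> L\<close> K M_bc[OF 1(1)]
          by (simp add: morse_graph_def step_weight_def boundary_coeff_def)
      next
        case 2
        then show ?thesis using z \<open>x \<in> L\<close> by (simp add: morse_graph_def)
      next
        case 3
        then show ?thesis using K
          by (simp add: morse_graph_def face_edges_def step_weight_def boundary_coeff_def)
      qed
    qed
    finally show ?thesis .
  qed
qed

text \<open>By \<open>closed\<close> and \<open>up\<close> a matched pair lies in \<open>L\<close>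
  entirely or not at all.\<close>

lemma crit_subcomplex:
  assumes "morse_data L card (boundary_coeff V :: _ \<Rightarrow> _ \<Rightarrow> 'k::comm_ring_1) (M \<inter> L \<times> L) pot"
    and L: "L \<subseteq> K" and closed: "\<And>x y. x \<in> L \<Longrightarrow> y \<subseteq> x \<Longrightarrow> y \<in> L"
    and up: "\<And>u l. (u, l) \<in> M \<Longrightarrow> l \<in> L \<Longrightarrow> u \<in> L"
  shows "morse_data.crit L (M \<inter> L \<times> L) = critical_faces K M \<inter> L"
proof -
  have "u \<in> L \<longleftrightarrow> l \<in> L" if "(u, l) \<in> M" for u l
    using that M_face_edges closed[of u l] up[OF that] by (auto simp: face_edges_def)
  then have "e \<in> L \<times> L" if "e \<in> M" "x = fst e \<or> x = snd e" "x \<in> L" for e x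
    using that by (cases e) auto
  then have "(\<forall>e\<in>M \<inter> L \<times> L. x \<noteq> fst e \<and> x \<noteq> snd e) \<longleftrightarrow> (\<forall>e\<in>M. x \<noteq> fst e \<and> x \<noteq> snd e)"
    if "x \<in> L" for x using that by blast
  then show ?thesis
    unfolding morse_data.crit_def[OF assms(1)] critical_faces_def using L by blast
qed

end

section \<open>The matching of the second square complex\<close>

definition off_diagonal :: "nat \<Rightarrow> vertex set" where
  "off_diagonal q = {ee i j | i j. 1 \<le> i \<and> i < j \<and> j \<le> q}"

definition star :: "nat \<Rightarrow> nat \<Rightarrow> vertex set" where
  "star q i = {ee i j | j. 1 \<le> j \<and> j \<le> q}"

lemma ee_eq_iff: "ee i j = ee k l \<longleftrightarrow> (i = k \<and> j = l) \<or> (i = l \<and> j = k)"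
  by (auto simp: ee_def add_eq_conv_ex)

lemma ee_commute: "ee i j = ee j i"
  by (simp add: ee_eq_iff)

lemma ee_in_off_diagonal: "ee i j \<in> off_diagonal q \<longleftrightarrow> i \<in> {1..q} \<and> j \<in> {1..q} \<and> i \<noteq> j"
proof
  assume "i \<in> {1..q} \<and> j \<in> {1..q} \<and> i \<noteq> j"
  then show "ee i j \<in> off_diagonal q"
    unfolding off_diagonal_def
    by (cases i j rule: linorder_cases) (force simp: ee_eq_iff)+
qed (auto simp: off_diagonal_def ee_eq_iff)

lemma ee_in_star:
  "ee a b \<in> star q i \<longleftrightarrow> (a = i \<and> b \<in> {1..q}) \<or> (b = i \<and> a \<in> {1..q})"
  by (auto simp: star_def ee_eq_iff)

lemma ee_in_vertices: "ee i j \<in> vertices q \<longleftrightarrow> i \<in> {1..q} \<and> j \<in> {1..q}"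
proof
  assume "i \<in> {1..q} \<and> j \<in> {1..q}"
  then show "ee i j \<in> vertices q"
    unfolding vertices_def by (cases "i \<le> j") (force simp: ee_eq_iff)+
qed (auto simp: vertices_def ee_eq_iff)

lemma vertices_E:
  assumes "v \<in> vertices q"
  obtains i j where "v = ee i j" "i \<in> {1..q}" "j \<in> {1..q}"
  using assms by (force simp: vertices_def)

lemma L2_iff: "x \<in> L2 q \<longleftrightarrow> x \<subseteq> off_diagonal q \<or> (\<exists>i\<in>{1..q}. x \<subseteq> star q i)"
  by (auto simp: L2_def L2_facets_def off_diagonal_def star_def)

lemma L2_subset: "x \<in> L2 q \<Longrightarrow> y \<subseteq> x \<Longrightarrow> y \<in> L2 q"
  by (auto simp: L2_def)

lemma L2_vertices: "x \<in> L2 q \<Longrightarrow> x \<subseteq> vertices q"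
proof -
  have "off_diagonal q \<subseteq> vertices q" by (auto simp: off_diagonal_def ee_in_vertices)
  moreover have "star q i \<subseteq> vertices q" if "i \<in> {1..q}" for i
    using that by (auto simp: star_def ee_in_vertices)
  ultimately show "x \<in> L2 q \<Longrightarrow> x \<subseteq> vertices q" by (fastforce simp: L2_iff)
qed

lemma vertices_image: "vertices q = (\<lambda>(i, j). ee i j) ` (SIGMA i:{1..q}. {i..q})"
  by (force simp: vertices_def image_iff)

lemma finite_vertices: "finite (vertices q)"
  by (simp add: vertices_image)

lemma card_vertices: "card (vertices q) = (q + 1) choose 2"
proof -
  have "inj_on (\<lambda>(i, j). ee i j) (SIGMA i:{1..q}. {i..q})"
    by (auto simp: inj_on_def ee_eq_iff)
  then have "card (vertices q) = (\<Sum>i = 1..q. Suc q - i)"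
    by (simp add: vertices_image card_image)
  also have "\<dots> = (\<Sum>i = 1..q. i)"
    by (rule sum.reindex_bij_witness[of _ "\<lambda>i. Suc q - i" "\<lambda>i. Suc q - i"]) auto
  also have "\<dots> = (q + 1) choose 2"
    by (induction q) (auto simp: numeral_2_eq_2)
  finally show ?thesis .
qed

lemma finite_L2: "finite (L2 q)"
  by (rule finite_subset[of _ "Pow (vertices q)"]) (use L2_vertices finite_vertices in auto)

lemma L2_finite_face: "x \<in> L2 q \<Longrightarrow> finite x"
  using L2_vertices finite_vertices finite_subset by blast

lemma singleton_L2: "v \<in> vertices q \<Longrightarrow> {v} \<in> L2 q"
  by (elim vertices_E) (auto simp: L2_iff ee_in_star)

lemma NN_L2: "NN q s \<subseteq> L2 q"
  by (auto simp: NN_def)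

lemma finite_NN: "finite (NN q s)"
  using NN_L2 finite_L2 finite_subset by blast

section \<open>The elements of \<open>NN\<close>, their index and their order\<close>

definition is_type :: "nat \<Rightarrow> nat \<Rightarrow> vertex set \<Rightarrow> nat \<Rightarrow> bool" where
  "is_type q s \<sigma> j \<longleftrightarrow> type_i q s \<sigma> j \<or> type_ii q s \<sigma> j \<or> type_iii q s \<sigma> j"

lemma type_ii_E:
  assumes "type_ii q s \<sigma> j"
  obtains a b t where "a \<in> {2..s}" "b \<in> {2..s}" "a \<noteq> b" "ee a 1 \<in> \<sigma>" "ee b j \<in> \<sigma>"
    "s < j" "j \<le> q" "t ` {2..s} = {1, j}" "\<sigma> = (\<lambda>k. ee k (t k)) ` {2..s}"
proof -
  from assms obtain t where t: "s < j" "j \<le> q" "t ` {2..s} = {1, j}" "\<sigma> = (\<lambda>k. ee k (t k)) ` {2..s}"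
    by (auto simp: type_ii_def)
  then have "1 \<in> t ` {2..s}" "j \<in> t ` {2..s}" by auto
  then obtain a b where ab: "a \<in> {2..s}" "t a = 1" "b \<in> {2..s}" "t b = j" by fastforce
  then have "a \<noteq> b" using t by auto
  moreover have "ee a 1 \<in> \<sigma>" "ee b j \<in> \<sigma>" using ab t by force+
  ultimately show thesis using that ab t by blast
qed

text \<open>This makes the \<open>THE\<close> in \<open>omega\<close> determinate. Only type (iii)
  has an edge with both ends above \<open>s\<close>. Type (ii) has an edge to 1 together with an end
  above \<open>s\<close>, which no face of type (i) has. The index is then read off from these
  edges.\<close>

lemma is_type_unique:
  assumes s: "3 \<le> s" and "is_type q s \<sigma> j" "is_type q s \<sigma> j'"
  shows "j = j'"
proof -
  have 23: "2 \<in> {2..s}" "3 \<in> {2..s}" using s by auto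
  have i_i: "j = j'" if "type_i q s \<sigma> j" "type_i q s \<sigma> j'" for j j'
  proof -
    have "ee 2 j \<in> (\<lambda>k. ee k j') ` {2..s}" "ee 3 j \<in> (\<lambda>k. ee k j') ` {2..s}"
      using that 23 by (auto simp: type_i_def)
    then show ?thesis by (auto simp: ee_eq_iff)
  qed
  have i_ii: False if "type_i q s \<sigma> j" "type_ii q s \<sigma> j'" for j j'
  proof -
    from that(2) obtain a b where ab: "a \<in> {2..s}" "b \<in> {2..s}" "a \<noteq> b" "ee a 1 \<in> \<sigma>" "ee b j' \<in> \<sigma>" "s < j'"
      by (rule type_ii_E)
    then have "ee a 1 \<in> (\<lambda>k. ee k j) ` {2..s}" "ee b j' \<in> (\<lambda>k. ee k j) ` {2..s}"
      using that(1) by (auto simp: type_i_def)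
    then show ?thesis using ab by (auto simp: ee_eq_iff)
  qed
  have i_iii: False if "type_i q s \<sigma> j" "type_iii q s \<sigma> j'" for j j'
  proof -
    from that(2) obtain u where u: "s < u" "u < j'" "\<sigma> = insert (ee j' u) ((\<lambda>k. ee k 1) ` {2..s})"
      by (auto simp: type_iii_def)
    then have "ee 2 1 \<in> (\<lambda>k. ee k j) ` {2..s}" "ee 3 1 \<in> (\<lambda>k. ee k j) ` {2..s}"
      "ee j' u \<in> (\<lambda>k. ee k j) ` {2..s}"
      using that(1) 23 by (auto simp: type_i_def)
    then show ?thesis using u by (auto simp: ee_eq_iff)
  qed
  have ii_ii: "j = j'" if "type_ii q s \<sigma> j" "type_ii q s \<sigma> j'" for j j'
  proof -
    from that(1) obtain b where b: "b \<in> {2..s}" "ee b j \<in> \<sigma>" "s < j"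
      by (rule type_ii_E)
    from that(2) obtain t where t: "t ` {2..s} = {1, j'}" "\<sigma> = (\<lambda>k. ee k (t k)) ` {2..s}"
      by (rule type_ii_E)
    from b t obtain k where k: "k \<in> {2..s}" "ee b j = ee k (t k)" by auto
    then have "t k = j" using b by (auto simp: ee_eq_iff)
    moreover have "t k \<in> {1, j'}" using t k by blast
    ultimately show ?thesis using b by auto
  qed
  have ii_iii: False if "type_ii q s \<sigma> j" "type_iii q s \<sigma> j'" for j j'
  proof -
    from that(1) obtain b where b: "b \<in> {2..s}" "ee b j \<in> \<sigma>" "s < j"
      by (rule type_ii_E)
    from that(2) obtain u where u: "s < u" "u < j'" "\<sigma> = insert (ee j' u) ((\<lambda>k. ee k 1) ` {2..s})"
      by (auto simp: type_iii_def)
    then show ?thesis using b by (auto simp: ee_eq_iff)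
  qed
  have iii_iii: "j = j'" if "type_iii q s \<sigma> j" "type_iii q s \<sigma> j'" for j j'
  proof -
    from that(1) obtain u where u: "s < u" "u < j" "ee j u \<in> \<sigma>"
      by (auto simp: type_iii_def)
    from that(2) obtain u' where u': "s < u'" "u' < j'" "\<sigma> = insert (ee j' u') ((\<lambda>k. ee k 1) ` {2..s})"
      by (auto simp: type_iii_def)
    then show ?thesis using u by (auto simp: ee_eq_iff)
  qed
  show ?thesis
    using assms(2,3) i_i i_ii i_iii ii_ii ii_iii iii_iii unfolding is_type_def by metis
qed

lemma omega_is_type:
  assumes "3 \<le> s" "is_type q s \<sigma> j"
  shows "omega q s \<sigma> = ee 1 j"
proof -
  have "(THE j. type_i q s \<sigma> j \<or> type_ii q s \<sigma> j \<or> type_iii q s \<sigma> j) = j"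
    using assms is_type_unique[OF assms(1)] unfolding is_type_def by (intro the_equality) auto
  then show ?thesis by (simp add: omega_def)
qed

lemma NN_is_type: "\<sigma> \<in> NN q s \<Longrightarrow> \<exists>j. is_type q s \<sigma> j"
  by (auto simp: NN_def is_type_def)

text \<open>For a linear order, the rank of the largest element of \<open>NN\<close> inside the
  face. As the size of a down-set it is monotone by inclusion of sets, and it is 0 if the face
  contains no element of \<open>NN\<close>.\<close>

definition down_index :: "nat \<Rightarrow> nat \<Rightarrow> (vertex set \<times> vertex set) set \<Rightarrow> vertex set \<Rightarrow> nat" where
  "down_index q s ord \<gamma> = card {\<sigma>' \<in> NN q s. \<exists>\<sigma>\<in>NN q s. \<sigma> \<subseteq> \<gamma> \<and> (\<sigma>', \<sigma>) \<in> ord}"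

definition toggle_vertex ::
    "nat \<Rightarrow> nat \<Rightarrow> (vertex set \<times> vertex set) set \<Rightarrow> vertex set \<Rightarrow> vertex option" where
  "toggle_vertex q s ord \<gamma> =
     (if \<exists>\<sigma>. \<gamma> \<in> YY q s ord \<sigma> then Some (omega q s (THE \<sigma>. \<gamma> \<in> YY q s ord \<sigma>)) else None)"

context
  fixes q s :: nat and ord :: "(vertex set \<times> vertex set) set"
  assumes lin: "linear_order_on (NN q s) ord"
begin

lemma ord_facts:
  shows ord_refl: "\<sigma> \<in> NN q s \<Longrightarrow> (\<sigma>, \<sigma>) \<in> ord"
    and ord_trans: "(\<sigma>, \<sigma>') \<in> ord \<Longrightarrow> (\<sigma>', \<sigma>'') \<in> ord \<Longrightarrow> (\<sigma>, \<sigma>'') \<in> ord"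
    and ord_antisym: "(\<sigma>, \<sigma>') \<in> ord \<Longrightarrow> (\<sigma>', \<sigma>) \<in> ord \<Longrightarrow> \<sigma> = \<sigma>'"
    and ord_total: "\<sigma> \<in> NN q s \<Longrightarrow> \<sigma>' \<in> NN q s \<Longrightarrow> (\<sigma>, \<sigma>') \<in> ord \<or> (\<sigma>', \<sigma>) \<in> ord"
proof -
  have *: "refl_on (NN q s) ord" "trans ord" "antisym ord" "total_on (NN q s) ord"
    using lin by (simp_all add: linear_order_on_def partial_order_on_def preorder_on_def)
  show "\<sigma> \<in> NN q s \<Longrightarrow> (\<sigma>, \<sigma>) \<in> ord" using *(1) by (rule refl_onD)
  then show "\<sigma> \<in> NN q s \<Longrightarrow> \<sigma>' \<in> NN q s \<Longrightarrow> (\<sigma>, \<sigma>') \<in> ord \<or> (\<sigma>', \<sigma>) \<in> ord"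
    using *(4) unfolding total_on_def by metis
  show "(\<sigma>, \<sigma>') \<in> ord \<Longrightarrow> (\<sigma>', \<sigma>'') \<in> ord \<Longrightarrow> (\<sigma>, \<sigma>'') \<in> ord"
    using *(2) by (rule transD)
  show "(\<sigma>, \<sigma>') \<in> ord \<Longrightarrow> (\<sigma>', \<sigma>) \<in> ord \<Longrightarrow> \<sigma> = \<sigma>'"
    using *(3) by (rule antisymD)
qed

lemma ord_max:
  assumes "finite S" "S \<noteq> {}" "S \<subseteq> NN q s"
  shows "\<exists>m\<in>S. \<forall>x\<in>S. (x, m) \<in> ord"
  using assms
proof (induction S rule: finite_ne_induct)
  case (singleton x)
  then show ?case using ord_refl by auto
next
  case (insert x S)
  then obtain m where m: "m \<in> S" "\<forall>y\<in>S. (y, m) \<in> ord" by auto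
  show ?case
  proof (cases "(x, m) \<in> ord")
    case True
    then show ?thesis using m by auto
  next
    case False
    then have "(m, x) \<in> ord" using ord_total[of x m] insert m by auto
    then have "(y, x) \<in> ord" if "y \<in> insert x S" for y
      using that m(2) ord_trans[of y m x] ord_refl[of x] insert.prems by auto
    then show ?thesis by blast
  qed
qed

lemma YY_exists:
  assumes "\<gamma> \<in> L2 q" "\<sigma> \<in> NN q s" "\<sigma> \<subseteq> \<gamma>"
  shows "\<exists>\<sigma>. \<gamma> \<in> YY q s ord \<sigma>"
proof -
  have "\<exists>m\<in>{\<sigma> \<in> NN q s. \<sigma> \<subseteq> \<gamma>}. \<forall>x\<in>{\<sigma> \<in> NN q s. \<sigma> \<subseteq> \<gamma>}. (x, m) \<in> ord"
    using assms finite_NN by (intro ord_max) auto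
  then show ?thesis using assms by (auto simp: YY_def)
qed

lemma YY_unique: "\<gamma> \<in> YY q s ord \<sigma> \<Longrightarrow> \<gamma> \<in> YY q s ord \<sigma>' \<Longrightarrow> \<sigma> = \<sigma>'"
  by (rule ord_antisym) (auto simp: YY_def)

lemma toggle_vertex_YY: "\<gamma> \<in> YY q s ord \<sigma> \<Longrightarrow> toggle_vertex q s ord \<gamma> = Some (omega q s \<sigma>)"
proof -
  assume a: "\<gamma> \<in> YY q s ord \<sigma>"
  then have "(THE \<sigma>. \<gamma> \<in> YY q s ord \<sigma>) = \<sigma>" by (rule the_equality) (rule YY_unique[OF _ a])
  then show ?thesis using a by (auto simp: toggle_vertex_def)
qed

lemma down_index_YY:
  assumes "\<gamma> \<in> YY q s ord \<sigma>"
  shows "down_index q s ord \<gamma> = card {\<sigma>' \<in> NN q s. (\<sigma>', \<sigma>) \<in> ord}"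
proof -
  have "{\<sigma>' \<in> NN q s. \<exists>\<sigma>\<in>NN q s. \<sigma> \<subseteq> \<gamma> \<and> (\<sigma>', \<sigma>) \<in> ord} = {\<sigma>' \<in> NN q s. (\<sigma>', \<sigma>) \<in> ord}"
    using assms ord_trans[of _ _ \<sigma>] unfolding YY_def by auto
  then show ?thesis by (simp add: down_index_def)
qed

lemma down_index_pos: "\<gamma> \<in> L2 q \<Longrightarrow> 0 < down_index q s ord \<gamma> \<longleftrightarrow> (\<exists>\<sigma>. \<gamma> \<in> YY q s ord \<sigma>)"
proof
  assume "\<gamma> \<in> L2 q" "0 < down_index q s ord \<gamma>"
  then have "{\<sigma>' \<in> NN q s. \<exists>\<sigma>\<in>NN q s. \<sigma> \<subseteq> \<gamma> \<and> (\<sigma>', \<sigma>) \<in> ord} \<noteq> {}"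
    by (simp add: down_index_def card_gt_0_iff)
  then show "\<exists>\<sigma>. \<gamma> \<in> YY q s ord \<sigma>" using YY_exists \<open>\<gamma> \<in> L2 q\<close> by blast
next
  assume "\<exists>\<sigma>. \<gamma> \<in> YY q s ord \<sigma>"
  then obtain \<sigma> where \<sigma>: "\<gamma> \<in> YY q s ord \<sigma>" by blast
  then have "\<sigma> \<in> {\<sigma>' \<in> NN q s. (\<sigma>', \<sigma>) \<in> ord}" using ord_refl by (auto simp: YY_def)
  then show "0 < down_index q s ord \<gamma>"
    using finite_NN[of q s] unfolding down_index_YY[OF \<sigma>] by (auto simp: card_gt_0_iff)
qed

text \<open>The largest elements in the two faces have nested down-sets; equal size makes the
  down-sets equal, hence the elements too.\<close>

lemma YY_down_index_eq:
  assumes "\<gamma> \<in> YY q s ord \<sigma>" "\<gamma>' \<in> L2 q" "\<gamma>' \<subseteq> \<gamma>" "down_index q s ord \<gamma>' = down_index q s ord \<gamma>"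
  shows "\<gamma>' \<in> YY q s ord \<sigma>"
proof -
  have "\<gamma> \<in> L2 q" using assms by (auto simp: YY_def)
  then obtain \<sigma>' where \<sigma>': "\<gamma>' \<in> YY q s ord \<sigma>'" using down_index_pos assms by metis
  have N: "\<sigma> \<in> NN q s" "\<sigma>' \<in> NN q s" "(\<sigma>', \<sigma>) \<in> ord"
    using assms \<sigma>' by (auto simp: YY_def)
  have "{\<rho> \<in> NN q s. (\<rho>, \<sigma>') \<in> ord} = {\<rho> \<in> NN q s. (\<rho>, \<sigma>) \<in> ord}"
  proof (rule card_subset_eq)
    show "{\<rho> \<in> NN q s. (\<rho>, \<sigma>') \<in> ord} \<subseteq> {\<rho> \<in> NN q s. (\<rho>, \<sigma>) \<in> ord}"
      using ord_trans[OF _ N(3)] by auto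
  qed (use assms down_index_YY \<sigma>' finite_NN in auto)
  then have "(\<sigma>, \<sigma>') \<in> ord" using N ord_refl by blast
  then have "\<sigma> = \<sigma>'" using N by (intro ord_antisym)
  then show ?thesis using \<sigma>' by simp
qed

lemma toggle_L2: "toggle (L2 q) (down_index q s ord) (toggle_vertex q s ord)"
proof
  show "finite (L2 q)" by (rule finite_L2)
  show "finite x" if "x \<in> L2 q" for x using that by (rule L2_finite_face)
  show "down_index q s ord y \<le> down_index q s ord x" if "x \<in> L2 q" "y \<in> L2 q" "y \<subseteq> x" for x y
    unfolding down_index_def
  proof (rule card_mono)
    show "{\<sigma>' \<in> NN q s. \<exists>\<sigma>\<in>NN q s. \<sigma> \<subseteq> y \<and> (\<sigma>', \<sigma>) \<in> ord}
      \<subseteq> {\<sigma>' \<in> NN q s. \<exists>\<sigma>\<in>NN q s. \<sigma> \<subseteq> x \<and> (\<sigma>', \<sigma>) \<in> ord}" using that(3) by blast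
  qed (use finite_NN in auto)
  show "toggle_vertex q s ord y = toggle_vertex q s ord x"
    if "x \<in> L2 q" "y \<in> L2 q" "y \<subseteq> x" "down_index q s ord y = down_index q s ord x" for x y
  proof (cases "\<exists>\<sigma>. x \<in> YY q s ord \<sigma>")
    case True
    then show ?thesis using YY_down_index_eq that toggle_vertex_YY by metis
  next
    case False
    then have "\<not> (\<exists>\<sigma>. y \<in> YY q s ord \<sigma>)" using that down_index_pos by metis
    then show ?thesis using False by (simp add: toggle_vertex_def)
  qed
qed

lemma matching_eq_toggle:
  "matching q s ord = toggle_matching (L2 q) (down_index q s ord) (toggle_vertex q s ord)"
proof (rule equalityI; rule subrelI)
  fix x y assume "(x, y) \<in> matching q s ord"
  then obtain \<sigma> where \<sigma>: "x \<in> YY q s ord \<sigma>" "y \<in> YY q s ord \<sigma>" "omega q s \<sigma> \<in> x" "y = x - {omega q s \<sigma>}"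
    by (auto simp: matching_def)
  then show "(x, y) \<in> toggle_matching (L2 q) (down_index q s ord) (toggle_vertex q s ord)"
    using toggle_vertex_YY[of x \<sigma>] down_index_YY[of _ \<sigma>]
    by (auto simp: toggle_matching_def YY_def)
next
  fix x y assume "(x, y) \<in> toggle_matching (L2 q) (down_index q s ord) (toggle_vertex q s ord)"
  then obtain v where v: "x \<in> L2 q" "y \<in> L2 q" "down_index q s ord x = down_index q s ord y"
      "v \<in> x" "toggle_vertex q s ord x = Some v" "y = x - {v}"
    by (auto simp: toggle_matching_def)
  then obtain \<sigma> where \<sigma>: "x \<in> YY q s ord \<sigma>" by (auto simp: toggle_vertex_def split: if_splits)
  then have "y \<in> YY q s ord \<sigma>" "v = omega q s \<sigma>" "\<sigma> \<in> NN q s"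
    using YY_down_index_eq[of x \<sigma> y] v toggle_vertex_YY[OF \<sigma>] by (auto simp: YY_def)
  then show "(x, y) \<in> matching q s ord" using v \<sigma> by (auto simp: matching_def)
qed

text \<open>By \<open>avoid\<close>, adding or deleting the toggled vertex neither completes nor
  destroys an element of \<open>NN\<close>, so both versions of the face stay in the fibre of
  \<open>\<sigma>\<close>.\<close>

lemma matching_not_critical:
  assumes \<sigma>: "x \<in> YY q s ord \<sigma>" and L2: "insert (omega q s \<sigma>) x \<in> L2 q"
    and avoid: "\<And>\<sigma>'. \<sigma>' \<in> NN q s \<Longrightarrow> \<sigma>' \<subseteq> insert (omega q s \<sigma>) x \<Longrightarrow> omega q s \<sigma> \<notin> \<sigma>'"
  shows "x \<notin> critical_faces (L2 q) (matching q s ord)"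
proof -
  let ?w = "omega q s \<sigma>"
  have N: "\<sigma> \<in> NN q s" "\<sigma> \<subseteq> x" "x \<in> L2 q" using \<sigma> by (auto simp: YY_def)
  then have "?w \<notin> \<sigma>" using avoid by blast
  then have "x - {?w} \<in> YY q s ord \<sigma>" "insert ?w x \<in> YY q s ord \<sigma>"
    using \<sigma> L2 L2_subset[OF N(3), of "x - {?w}"] avoid by (auto simp: YY_def)
  then have "(insert ?w x, x - {?w}) \<in> matching q s ord"
    using N unfolding matching_def by auto
  moreover have "x = insert ?w x \<or> x = x - {?w}" by auto
  ultimately show ?thesis unfolding critical_faces_def by force
qed

end

section \<open>Critical faces of the matching\<close>

lemma type_ii_mem_NN:
  assumes "s < j" "j \<le> q"
    and "\<And>i. i \<in> {2..s} \<Longrightarrow> ee i (t i) \<in> x" "x \<subseteq> off_diagonal q"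
    and "t ` {2..s} = {1, j}"
  shows "\<exists>\<sigma>. \<sigma> \<in> NN q s \<and> type_ii q s \<sigma> j \<and> \<sigma> \<subseteq> x"
proof -
  define \<sigma> where "\<sigma> = (\<lambda>k. ee k (t k)) ` {2..s}"
  have "type_ii q s \<sigma> j" using assms by (auto simp: type_ii_def \<sigma>_def)
  moreover have "\<sigma> \<subseteq> x" using assms by (auto simp: \<sigma>_def)
  moreover from this have "\<sigma> \<in> L2 q" using assms by (auto simp: L2_iff)
  ultimately show ?thesis unfolding NN_def by blast
qed

text \<open>Let \<open>\<sigma>\<close> be the largest element of \<open>NN\<close> in the face. A
  critical face does not allow \<open>omega q s \<sigma>\<close> to be toggled. Toggling always
  works for types (ii) and (iii) and for type (i) with index other than 1. For index 1 it fails only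
  if the loop \<open>ee 1 1\<close> does not fit, and then maximality of \<open>\<sigma>\<close>
  excludes types (ii) and (iii), which is the second alternative.\<close>

lemma critical_cases:
  assumes s: "3 \<le> s" and adm: "admissible_order q s ord"
    and x: "x \<in> critical_faces (L2 q) (matching q s ord)"
  obtains "\<And>\<sigma>. \<sigma> \<in> NN q s \<Longrightarrow> \<not> \<sigma> \<subseteq> x"
  | "x \<subseteq> off_diagonal q" "\<And>k. k \<in> {2..s} \<Longrightarrow> ee k 1 \<in> x"
    "\<And>k j. k \<in> {2..s} \<Longrightarrow> s < j \<Longrightarrow> ee k j \<notin> x"
    "\<And>j u. s < u \<Longrightarrow> s < j \<Longrightarrow> ee j u \<notin> x"
proof (cases "\<exists>\<sigma>\<in>NN q s. \<sigma> \<subseteq> x")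
  case False
  then show thesis using that(1) by blast
next
  case True
  have lin: "linear_order_on (NN q s) ord" using adm by (simp add: admissible_order_def)
  have xL: "x \<in> L2 q" using x by (simp add: critical_faces_def)
  obtain \<sigma> where \<sigma>: "x \<in> YY q s ord \<sigma>" using YY_exists[OF lin xL] True by blast
  then have N: "\<sigma> \<in> NN q s" "\<sigma> \<subseteq> x" by (auto simp: YY_def)
  then obtain j where j: "is_type q s \<sigma> j" using NN_is_type by blast
  have w: "omega q s \<sigma> = ee 1 j" by (rule omega_is_type[OF s j])
  have sets: "2 \<in> {2..s}" "3 \<in> {2..s}" using s by auto
  have crit: False if "insert (ee 1 j) x \<in> L2 q"
    "\<And>\<sigma>'. \<sigma>' \<in> NN q s \<Longrightarrow> \<sigma>' \<subseteq> insert (ee 1 j) x \<Longrightarrow> ee 1 j \<notin> \<sigma>'"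
    using matching_not_critical[OF lin \<sigma>] x that by (simp add: w)
  \<comment> \<open>In an element of \<open>NN\<close> the neighbours of 1 all lie in
    \<open>{2..s}\<close>.\<close>
  have avoid: "ee 1 l \<notin> \<sigma>'" if "\<sigma>' \<in> NN q s" "s < l \<or> l = 1" for \<sigma>' l
  proof
    assume a: "ee 1 l \<in> \<sigma>'"
    from that obtain j' where "is_type q s \<sigma>' j'" using NN_is_type by blast
    then consider "type_i q s \<sigma>' j'" | "type_ii q s \<sigma>' j'" | "type_iii q s \<sigma>' j'"
      by (auto simp: is_type_def)
    then show False
      using a that(2) s by cases (auto simp: type_i_def type_ii_def type_iii_def ee_eq_iff)
  qed
  have j_big: False if "s < j" "j \<le> q" and off: "x \<subseteq> off_diagonal q"
  proof (rule crit)
    have "ee 1 j \<in> off_diagonal q" using that s by (auto simp: ee_in_off_diagonal)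
    then show "insert (ee 1 j) x \<in> L2 q" using off by (auto simp: L2_iff)
  qed (use avoid that in blast)
  have star_1: "i = 1" if "ee 2 1 \<in> star q i" "ee 3 1 \<in> star q i" for i
    using that by (auto simp: ee_in_star)
  from j consider "type_i q s \<sigma> j" | "type_ii q s \<sigma> j" | "type_iii q s \<sigma> j"
    by (auto simp: is_type_def)
  then show thesis
  proof cases
    case 1
    then have \<sigma>_eq: "\<sigma> = (\<lambda>k. ee k j) ` {2..s}" and jq: "j \<in> {1..q}" by (auto simp: type_i_def)
    have in_x: "ee k j \<in> x" if "k \<in> {2..s}" for k using that N \<sigma>_eq by blast
    have star_j: "i = j" if "x \<subseteq> star q i" for i
    proof -
      have "ee 2 j \<in> star q i" "ee 3 j \<in> star q i" using that in_x sets by blast+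
      then show ?thesis by (auto simp: ee_in_star)
    qed
    show thesis
    proof (cases "j = 1")
      case False
      have False
      proof (rule crit)
        show "insert (ee 1 j) x \<in> L2 q"
        proof (cases "x \<subseteq> off_diagonal q")
          case True
          then show ?thesis using jq False by (auto simp: L2_iff ee_in_off_diagonal)
        next
          case False
          then obtain i where "i \<in> {1..q}" "x \<subseteq> star q i" using xL unfolding L2_iff by blast
          then show ?thesis using star_j jq by (auto simp: L2_iff ee_in_star)
        qed
        show "ee 1 j \<notin> \<sigma>'" if \<sigma>': "\<sigma>' \<in> NN q s" "\<sigma>' \<subseteq> insert (ee 1 j) x" for \<sigma>'
        proof (cases "s < j")
          case True
          then show ?thesis using avoid \<sigma>' by blast
        next
          case False
          with \<open>j \<noteq> 1\<close> jq have js: "j \<in> {2..s}" by auto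
          \<comment> \<open>For \<open>j\<close> in \<open>{2..s}\<close> the edge
            \<open>ee 1 j\<close> does occur in \<open>NN\<close>. But now \<open>\<sigma>\<close>
            contains the loop \<open>ee j j\<close>, so everything lies in the star of
            \<open>j\<close>, which contains no element of \<open>NN\<close> through
            \<open>ee 1 j\<close>.\<close>
          have "ee j j \<in> x" using in_x js by blast
          then have "\<not> x \<subseteq> off_diagonal q" by (auto simp: ee_in_off_diagonal)
          then obtain i where "i \<in> {1..q}" "x \<subseteq> star q i" using xL unfolding L2_iff by blast
          then have "insert (ee 1 j) x \<subseteq> star q j" using star_j jq by (auto simp: ee_in_star)
          then have sub: "\<sigma>' \<subseteq> star q j" using \<sigma>' by blast
          show ?thesis
          proof
            assume a: "ee 1 j \<in> \<sigma>'"
            from \<sigma>' obtain j' where "is_type q s \<sigma>' j'" using NN_is_type by blast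
            then consider "type_i q s \<sigma>' j'" | "type_ii q s \<sigma>' j'" | "type_iii q s \<sigma>' j'"
              by (auto simp: is_type_def)
            then show False
            proof cases
              case 1
              then have \<sigma>'_eq: "\<sigma>' = (\<lambda>k. ee k j') ` {2..s}" by (simp add: type_i_def)
              then have "j' = 1" using a js by (auto simp: ee_eq_iff)
              then have "ee 2 1 \<in> star q j" "ee 3 1 \<in> star q j" using sub \<sigma>'_eq sets by blast+
              then show False using star_1 \<open>j \<noteq> 1\<close> by blast
            next
              case 2
              then obtain a b where ab: "a \<in> {2..s}" "b \<in> {2..s}" "a \<noteq> b"
                "ee a 1 \<in> \<sigma>'" "ee b j' \<in> \<sigma>'" "s < j'"
                by (rule type_ii_E)
              then have "ee a 1 \<in> star q j" "ee b j' \<in> star q j" using sub by blast+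
              then show False using ab js by (auto simp: ee_in_star)
            next
              case 3
              then have "ee 2 1 \<in> star q j" "ee 3 1 \<in> star q j"
                using sub sets by (auto simp: type_iii_def)
              then show False using star_1 \<open>j \<noteq> 1\<close> by blast
            qed
          qed
        qed
      qed
      then show thesis ..
    next
      case True
      \<comment> \<open>Inside the star of 1 the loop \<open>ee 1 1\<close> could be
        toggled.\<close>
      have "\<not> x \<subseteq> star q 1"
      proof
        assume "x \<subseteq> star q 1"
        then have "insert (ee 1 1) x \<in> L2 q" using jq by (auto simp: L2_iff ee_in_star)
        then show False using crit avoid True by blast
      qed
      then have off: "x \<subseteq> off_diagonal q" using xL star_j True by (auto simp: L2_iff)
      have k1: "ee k 1 \<in> x" if "k \<in> {2..s}" for k using in_x that True by simp
      \<comment> \<open>Such a \<open>\<sigma>'\<close> would follow \<open>\<sigma>\<close> by its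
        type and precede it by maximality; they cannot be equal, since the index of
        \<open>\<sigma>\<close> is 1.\<close>
      have later: False if \<sigma>': "\<sigma>' \<in> NN q s" "\<sigma>' \<subseteq> x"
        and ty: "type_ii q s \<sigma>' j' \<or> type_iii q s \<sigma>' j'" for \<sigma>' j'
      proof -
        have "(\<sigma>, \<sigma>') \<in> ord" using adm N \<sigma>' ty 1 unfolding admissible_order_def by blast
        moreover have "(\<sigma>', \<sigma>) \<in> ord" using \<sigma> \<sigma>' by (auto simp: YY_def)
        ultimately have "\<sigma>' = \<sigma>" using ord_antisym[OF lin] by blast
        then have "is_type q s \<sigma> j'" using ty by (auto simp: is_type_def)
        then have "j' = j" using j is_type_unique[OF s] by blast
        moreover have "s < j'" using ty by (auto simp: type_ii_def type_iii_def)
        ultimately show False using True s by simp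
      qed
      show thesis
      proof (rule that(2)[OF off k1])
        fix k l assume k: "k \<in> {2..s}" "s < l"
        show "ee k l \<notin> x"
        proof
          assume kl: "ee k l \<in> x"
          then have "l \<le> q" using off by (auto simp: ee_in_off_diagonal subset_iff)
          \<comment> \<open>One edge goes to \<open>l\<close>, all others to 1. That 1 is attained
            needs a second element \<open>k'\<close> of \<open>{2..s}\<close>.\<close>
          define t where "t = (\<lambda>i. if i = k then l else 1)"
          obtain k' where "k' \<in> {2..s}" "k' \<noteq> k" using sets by (metis numeral_eq_iff num.distinct(5))
          then have "t ` {2..s} = {1, l}" using k by (auto simp: t_def)
          then have "\<exists>\<sigma>. \<sigma> \<in> NN q s \<and> type_ii q s \<sigma> l \<and> \<sigma> \<subseteq> x"
            using k kl k1 off \<open>l \<le> q\<close> s by (intro type_ii_mem_NN[of s l q t]) (auto simp: t_def)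
          then show False using later by blast
        qed
      next
        fix l u assume lu: "s < u" "s < l"
        show "ee l u \<notin> x"
        proof
          assume a: "ee l u \<in> x"
          \<comment> \<open>Type (iii) names the larger end first.\<close>
          define M where "M = max l u"
          define m where "m = min l u"
          have Mm: "ee l u = ee M m" by (auto simp: M_def m_def ee_eq_iff max_def min_def)
          have "l \<noteq> u" "l \<le> q" "u \<le> q" using a off by (auto simp: ee_in_off_diagonal subset_iff)
          then have b: "s < m" "m < M" "M \<le> q" using lu by (auto simp: M_def m_def)
          let ?\<sigma> = "insert (ee M m) ((\<lambda>k. ee k 1) ` {2..s})"
          have "type_iii q s ?\<sigma> M" "?\<sigma> \<subseteq> x" using b a k1 Mm by (auto simp: type_iii_def)
          moreover from this have "?\<sigma> \<in> NN q s" using L2_subset[OF xL] by (auto simp: NN_def)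
          ultimately show False using later by blast
        qed
      qed
    qed
  next
    case 2
    then obtain a b where ab: "a \<in> {2..s}" "b \<in> {2..s}" "a \<noteq> b"
      "ee a 1 \<in> \<sigma>" "ee b j \<in> \<sigma>" "s < j" "j \<le> q"
      by (rule type_ii_E)
    have "\<not> x \<subseteq> star q i" for i
    proof
      assume "x \<subseteq> star q i"
      then have "ee a 1 \<in> star q i" "ee b j \<in> star q i" using ab N by blast+
      then show False using ab by (auto simp: ee_in_star)
    qed
    then show thesis using j_big[OF ab(6,7)] xL unfolding L2_iff by blast
  next
    case 3
    then obtain u where u: "s < u" "u < j" "j \<le> q" and \<sigma>_eq: "\<sigma> = insert (ee j u) ((\<lambda>k. ee k 1) ` {2..s})"
      by (auto simp: type_iii_def)
    have "\<not> x \<subseteq> star q i" for i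
    proof
      assume "x \<subseteq> star q i"
      then have st: "ee 2 1 \<in> star q i" "ee 3 1 \<in> star q i" "ee j u \<in> star q i"
        using N \<sigma>_eq sets by blast+
      then have "i = 1" by (intro star_1)
      then show False using st(3) u s by (auto simp: ee_in_star)
    qed
    then have "x \<subseteq> off_diagonal q" using xL unfolding L2_iff by blast
    then have False using j_big u by simp
    then show thesis ..
  qed
qed

text \<open>Every element of \<open>NN\<close> has two different vertices. Cardinality 0 is included
  because the empty face carries the augmentation.\<close>

lemma small_face_critical:
  assumes s: "3 \<le> s" and x: "x \<in> L2 q" "card x \<le> 1"
  shows "x \<in> critical_faces (L2 q) (matching q s ord)"
proof -
  have no: "\<sigma> \<notin> NN q s" if "\<sigma> \<subseteq> y" "card y \<le> 1" "y \<in> L2 q" for \<sigma> y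
  proof
    assume "\<sigma> \<in> NN q s"
    then obtain j where "is_type q s \<sigma> j" using NN_is_type by blast
    then consider "type_i q s \<sigma> j" | "type_ii q s \<sigma> j" | "type_iii q s \<sigma> j"
      by (auto simp: is_type_def)
    then have "\<exists>a b. a \<in> \<sigma> \<and> b \<in> \<sigma> \<and> a \<noteq> b"
    proof cases
      case 1
      then have "ee 2 j \<in> \<sigma>" "ee 3 j \<in> \<sigma>" using s by (auto simp: type_i_def)
      moreover have "ee 2 j \<noteq> ee 3 j" by (auto simp: ee_eq_iff)
      ultimately show ?thesis by blast
    next
      case 2
      then obtain a b where ab: "a \<in> {2..s}" "b \<in> {2..s}" "a \<noteq> b" "ee a 1 \<in> \<sigma>" "ee b j \<in> \<sigma>" "s < j"
        by (rule type_ii_E)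
      then have "ee a 1 \<noteq> ee b j" by (auto simp: ee_eq_iff)
      then show ?thesis using ab by blast
    next
      case 3
      then have "ee 2 1 \<in> \<sigma>" "ee 3 1 \<in> \<sigma>" using s by (auto simp: type_iii_def)
      moreover have "ee 2 1 \<noteq> ee 3 1" by (auto simp: ee_eq_iff)
      ultimately show ?thesis by blast
    qed
    then obtain a b where ab: "a \<in> \<sigma>" "b \<in> \<sigma>" "a \<noteq> b" by blast
    then have "card {a, b} \<le> card y" using L2_finite_face that by (intro card_mono) auto
    then show False using that ab by simp
  qed
  have "e \<in> matching q s ord \<Longrightarrow> x \<noteq> fst e \<and> x \<noteq> snd e" for e
    using no[of _ x] x by (cases e) (auto simp: matching_def YY_def)
  then show ?thesis using x by (auto simp: critical_faces_def)
qed

lemma LD_cells_0: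
  assumes "3 \<le> s"
  shows "LD_cells q s ord 0 = (\<lambda>v. {v}) ` vertices q"
proof (rule equalityI; rule subsetI)
  fix x assume "x \<in> LD_cells q s ord 0"
  then have "x \<in> L2 q" "card x = 1" by (auto simp: LD_cells_def morse_cells_def critical_faces_def)
  then show "x \<in> (\<lambda>v. {v}) ` vertices q" using L2_vertices by (auto simp: card_1_singleton_iff)
next
  fix x assume "x \<in> (\<lambda>v. {v}) ` vertices q"
  then show "x \<in> LD_cells q s ord 0"
    using small_face_critical[OF assms] singleton_L2 by (auto simp: LD_cells_def morse_cells_def)
qed

lemma card_LD_cells_0: "3 \<le> s \<Longrightarrow> card (LD_cells q s ord 0) = (q + 1) choose 2"
  by (simp add: LD_cells_0 card_image card_vertices)

section \<open>Strands of the labelled complex\<close>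

text \<open>Divisibility of monomials; the order that comes with \<open>poly_mapping\<close> is
  lexicographic and needs ordered variables.\<close>

definition exp_le :: "('x \<Rightarrow>\<^sub>0 nat) \<Rightarrow> ('x \<Rightarrow>\<^sub>0 nat) \<Rightarrow> bool" where
  "exp_le t a \<longleftrightarrow> (\<forall>x. Poly_Mapping.lookup t x \<le> Poly_Mapping.lookup a x)"

lemma exp_le_trans: "exp_le t u \<Longrightarrow> exp_le u a \<Longrightarrow> exp_le t a"
  unfolding exp_le_def using le_trans by blast

lemma exp_le_refl [simp]: "exp_le t t"
  by (simp add: exp_le_def)

lemma lookup_lcm_exp:
  assumes "finite T"
  shows "Poly_Mapping.lookup (lcm_exp T) x = Max (insert 0 ((\<lambda>t. Poly_Mapping.lookup t x) ` T))"
proof -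
  have "{x. Max (insert 0 ((\<lambda>t. Poly_Mapping.lookup t x) ` T)) \<noteq> 0} \<subseteq> (\<Union>t\<in>T. Poly_Mapping.keys t)"
  proof clarify
    fix x assume "0 < Max (insert 0 ((\<lambda>t. Poly_Mapping.lookup t x) ` T))"
    then obtain t where "t \<in> T" "0 < Poly_Mapping.lookup t x"
      using assms by (auto simp: Max_gr_iff)
    then show "x \<in> (\<Union>t\<in>T. Poly_Mapping.keys t)" by (auto simp: in_keys_iff)
  qed
  then have "finite {x. Max (insert 0 ((\<lambda>t. Poly_Mapping.lookup t x) ` T)) \<noteq> 0}"
    by (rule finite_subset) (use assms in auto)
  then show ?thesis by (simp add: lcm_exp_def)
qed

lemma lcm_exp_le_iff: "finite T \<Longrightarrow> exp_le (lcm_exp T) a \<longleftrightarrow> (\<forall>t\<in>T. exp_le t a)"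
  by (auto simp: exp_le_def lookup_lcm_exp)

lemma le_lcm_exp: "finite T \<Longrightarrow> t \<in> T \<Longrightarrow> exp_le t (lcm_exp T)"
  using lcm_exp_le_iff exp_le_refl by blast

lemma less_lookup_lcm_exp:
  "finite T \<Longrightarrow> n < Poly_Mapping.lookup (lcm_exp T) x \<longleftrightarrow> (\<exists>t\<in>T. n < Poly_Mapping.lookup t x)"
  by (auto simp: lookup_lcm_exp Max_gr_iff)

lemma vertex_label_ee: "vertex_label m (ee i j) = m i + m j"
  by (simp add: vertex_label_def ee_def)

text \<open>An induced subcomplex of \<open>L2 q\<close> all of whose faces are matched: a face with loop at \<open>i\<close> is
  toggled at an edge \<open>ee i j\<close>, a face without loops at a fixed edge.\<close>

lemma induced_acyclic:
  fixes V :: "(vertex \<times> vertex) set" and x :: "vertex set \<Rightarrow> 'k::comm_ring_1"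
  assumes V: "linear_order_on (vertices q) V" and S: "S \<subseteq> vertices q" "S \<noteq> {}"
    and loop: "\<And>i u v. ee i i \<in> S \<Longrightarrow> ee u v \<in> S \<Longrightarrow> ee i u \<in> S"
    and K: "K = {x \<in> L2 q. x \<subseteq> S}"
    and x_deg: "\<And>y. y \<in> K \<Longrightarrow> x y \<noteq> 0 \<Longrightarrow> card y = n"
    and cycle: "\<And>z. z \<in> K \<Longrightarrow> (\<Sum>y\<in>K. x y * boundary_coeff V y z) = 0"
  shows "\<exists>w. (\<forall>u. w u \<noteq> 0 \<longrightarrow> u \<in> K \<and> card u = Suc n) \<and>
             (\<forall>y\<in>K. x y = (\<Sum>u\<in>K. w u * boundary_coeff V u y))"
proof -
  have finK: "finite K" using finite_L2 K by auto
  have K_closed: "y \<in> K" if "z \<in> K" "y \<subseteq> z" for y z using that L2_subset by (auto simp: K)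
  have fin_face: "finite y" if "y \<in> K" for y using that L2_finite_face by (auto simp: K)
  \<comment> \<open>If every face can be toggled without leaving \<open>K\<close> or its fibre, no
    face is critical, the empty face included.\<close>
  have perfect: ?thesis if "toggle K I w" and toggled: "\<And>y. y \<in> K \<Longrightarrow> \<exists>v. w y = Some v \<and>
      insert v y \<in> K \<and> w (insert v y) = Some v \<and> w (y - {v}) = Some v \<and> I (insert v y) = I y \<and> I (y - {v}) = I y" for I w
  proof -
    interpret toggle K I w by fact
    interpret morse_paths_sum K card "boundary_coeff V :: _ \<Rightarrow> _ \<Rightarrow> 'k" "M \<inter> K \<times> K" pot
      "\<lambda>x y. of_int (morse_incidence K V M x y)"
    proof (rule morse_paths_sum_subcomplex[OF V])
      show "y \<subseteq> vertices q" if "y \<in> K" for y using that L2_vertices by (auto simp: K)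
    qed (use K_closed in \<open>auto simp: toggle_matching_def\<close>)
    have "crit = {}"
    proof -
      have False if y: "y \<in> crit" for y
      proof -
        have yK: "y \<in> K" using y by (rule crit_K)
        then obtain v where v: "w y = Some v" "insert v y \<in> K" "w (insert v y) = Some v"
          "I (insert v y) = I y" "I (y - {v}) = I y"
          using toggled[of y] by auto
        have "(insert v y, y - {v}) \<in> M"
          using v yK K_closed[OF yK, of "y - {v}"] by (auto simp: toggle_matching_def)
        then have "(insert v y, y - {v}) \<in> M \<inter> K \<times> K" by (auto simp: toggle_matching_def)
        moreover have "y = insert v y \<or> y = y - {v}" by auto
        ultimately show False using crit_notin[OF y] by metis
      qed
      then show ?thesis by blast
    qed
    then show ?thesis using perfect_exact[of x n] x_deg cycle by blast
  qed
  show ?thesis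
  proof (cases "S \<subseteq> range (\<lambda>i. ee i i)")
    case True
    obtain i where i: "ee i i \<in> S" using S True by blast
    \<comment> \<open>A second loop \<open>ee j j\<close> would put the edge \<open>ee i j\<close>
      into \<open>S\<close> by \<open>loop\<close>.\<close>
    have "S = {ee i i}"
    proof -
      have "v = ee i i" if v: "v \<in> S" for v
      proof -
        obtain j where "v = ee j j" using True v by blast
        then have "ee i j \<in> S" using loop[OF i] v by blast
        then show ?thesis using True \<open>v = ee j j\<close> by (auto simp: ee_eq_iff)
      qed
      then show ?thesis using i by blast
    qed
    then have "insert (ee i i) y \<in> K" if "y \<in> K" for y
      using that singleton_L2[of "ee i i" q] S by (auto simp: K subset_singleton_iff)
    then show ?thesis
      using finK fin_face by (intro perfect[of "\<lambda>_. 0" "\<lambda>_. Some (ee i i)"]) (unfold_locales, auto)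
  next
    case False
    then obtain v\<^sub>0 where v0: "v\<^sub>0 \<in> S" "v\<^sub>0 \<notin> range (\<lambda>i. ee i i)" by blast
    \<comment> \<open>A face with a loop at \<open>i\<close> lies in the star of \<open>i\<close>,
      so only an edge at \<open>i\<close> can be toggled there. One exists: apply
      \<open>loop\<close> to the two ends of \<open>v\<^sub>0\<close>.\<close>
    define c where "c i = (SOME j. j \<noteq> i \<and> ee i j \<in> S)" for i
    have c: "c i \<noteq> i \<and> ee i (c i) \<in> S" if i: "ee i i \<in> S" for i
    proof -
      obtain a b where ab: "v\<^sub>0 = ee a b" using v0 S vertices_E by blast
      then have "a \<noteq> b" using v0 by auto
      have "ee i a \<in> S" "ee i b \<in> S"
        using loop[OF i, of a b] loop[OF i, of b a] v0 ab ee_commute[of a b] by auto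
      then have "\<exists>j. j \<noteq> i \<and> ee i j \<in> S" using \<open>a \<noteq> b\<close> by (cases "a = i") auto
      then show ?thesis unfolding c_def by (rule someI_ex)
    qed
    define loops where "loops y = {i. ee i i \<in> y}" for y :: "vertex set"
    define g where "g T = (if T = {} then v\<^sub>0 else ee (the_elem T) (c (the_elem T)))" for T
    have fin_loops: "finite (loops y)" if "y \<in> K" for y
    proof -
      have "inj_on (\<lambda>i. ee i i) (loops y)" by (auto simp: inj_on_def ee_eq_iff)
      moreover have "(\<lambda>i. ee i i) ` loops y \<subseteq> y" by (auto simp: loops_def)
      ultimately show ?thesis using fin_face[OF that] inj_on_finite by blast
    qed
    have loops_mono: "loops y \<subseteq> loops z" if "y \<subseteq> z" for y z using that by (auto simp: loops_def)
    have star_loop: "y \<subseteq> star q i \<and> loops y = {i}" if "y \<in> K" "ee i i \<in> y" for y i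
    proof -
      have "\<not> y \<subseteq> off_diagonal q" using that by (auto simp: ee_in_off_diagonal)
      then obtain l where l: "y \<subseteq> star q l"
        using \<open>y \<in> K\<close> unfolding K L2_iff by blast
      then have "l = i" using that by (auto simp: ee_in_star)
      then show ?thesis using l that by (auto simp: loops_def ee_in_star)
    qed
    have no_loop: "y \<subseteq> off_diagonal q" if "y \<in> K" "loops y = {}" for y
    proof
      fix v assume "v \<in> y"
      moreover have "v \<in> vertices q" using \<open>v \<in> y\<close> that(1) S by (auto simp: K)
      moreover from this obtain i j where "v = ee i j" "i \<in> {1..q}" "j \<in> {1..q}"
        by (rule vertices_E)
      ultimately show "v \<in> off_diagonal q"
        using that(2) by (auto simp: loops_def ee_in_off_diagonal)
    qed
    show ?thesis
    \<comment> \<open>The number of loops, 0 or 1, suffices as fibre index: comparable faces with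
      equally many loops have the same loops. The toggled edge is not a loop, so the index is
      preserved.\<close>
    proof (rule perfect[of "\<lambda>y. card (loops y)" "\<lambda>y. Some (g (loops y))"])
      show "toggle K (\<lambda>y. card (loops y)) (\<lambda>y. Some (g (loops y)))"
      proof
        show "card (loops y) \<le> card (loops z)" if "z \<in> K" "y \<in> K" "y \<subseteq> z" for y z
          using that fin_loops loops_mono by (intro card_mono)
        show "Some (g (loops y)) = Some (g (loops z))"
          if "z \<in> K" "y \<in> K" "y \<subseteq> z" "card (loops y) = card (loops z)" for y z
          using that fin_loops loops_mono card_subset_eq by metis
      qed (use finK fin_face in auto)
      fix y assume y: "y \<in> K"
      have "insert (g (loops y)) y \<in> K \<and> (\<forall>i. g (loops y) \<noteq> ee i i)"
      proof (cases "loops y = {}")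
        case True
        have "v\<^sub>0 \<in> vertices q" using v0 S by blast
        then obtain a b where ab: "v\<^sub>0 = ee a b" "a \<in> {1..q}" "b \<in> {1..q}"
          by (rule vertices_E)
        then have "a \<noteq> b" using v0 by auto
        then show ?thesis
          using no_loop[OF y True] v0 y ab True
          by (auto simp: g_def K L2_iff ee_in_off_diagonal ee_eq_iff)
      next
        case False
        then obtain i where i: "ee i i \<in> y" by (auto simp: loops_def)
        then have st: "y \<subseteq> star q i" "loops y = {i}" using star_loop[OF y] by auto
        have "ee i i \<in> S" using i y by (auto simp: K)
        then have ci: "c i \<noteq> i" "ee i (c i) \<in> S" using c by auto
        then have "ee i (c i) \<in> vertices q" using S by blast
        then show ?thesis using st ci y
          by (auto simp: g_def K L2_iff ee_in_star ee_in_vertices ee_eq_iff)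
      qed
      moreover from this have "loops (insert (g (loops y)) y) = loops y"
        "loops (y - {g (loops y)}) = loops y"
        unfolding loops_def by (metis insert_iff, metis Diff_iff singletonD)
      ultimately show "\<exists>v. Some (g (loops y)) = Some v \<and> insert v y \<in> K \<and>
          Some (g (loops (insert v y))) = Some v \<and> Some (g (loops (y - {v}))) = Some v \<and>
          card (loops (insert v y)) = card (loops y) \<and> card (loops (y - {v})) = card (loops y)"
        by auto
    qed
  qed
qed

section \<open>Labels along the matching and the strands they define\<close>

locale labelling =
  fixes q s :: nat and ord :: "(vertex set \<times> vertex set) set" and V :: "(vertex \<times> vertex) set"
    and m :: "nat \<Rightarrow> ('x \<Rightarrow>\<^sub>0 nat)"
  assumes s: "3 \<le> s" and sq: "s \<le> q" and adm: "admissible_order q s ord"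
    and V: "linear_order_on (vertices q) V"
    and square_free: "i \<in> {1..q} \<Longrightarrow> Poly_Mapping.lookup (m i) x \<le> 1"
    and cover: "Poly_Mapping.lookup (m 1) x \<noteq> 0 \<Longrightarrow> \<exists>k\<in>{2..s}. Poly_Mapping.lookup (m k) x \<noteq> 0"
begin

lemma lin: "linear_order_on (NN q s) ord"
  using adm by (simp add: admissible_order_def)

abbreviation label :: "vertex set \<Rightarrow> ('x \<Rightarrow>\<^sub>0 nat)" where "label \<equiv> face_label m"

lemma label_le_iff: "x \<in> L2 q \<Longrightarrow> exp_le (label x) a \<longleftrightarrow> (\<forall>v\<in>x. exp_le (vertex_label m v) a)"
  using L2_finite_face by (simp add: face_label_def lcm_exp_le_iff)

lemma label_mono: "x \<in> L2 q \<Longrightarrow> y \<subseteq> x \<Longrightarrow> exp_le (label y) (label x)"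
  using label_le_iff[of x "label x"] label_le_iff[of y] L2_subset by auto

text \<open>Exponent by exponent: if \<open>m 1\<close> has exponent 0, an edge of
  \<open>\<sigma>\<close> at \<open>j\<close> suffices. Otherwise \<open>cover\<close> gives
  \<open>k\<close> with exponent 1 in \<open>m k\<close>, and \<open>\<sigma>\<close> joins
  \<open>k\<close> to 1 or to \<open>j\<close>. An edge to \<open>j\<close> has the required
  exponent with \<open>m k\<close> in the place of \<open>m 1\<close>; an edge to 1 has exponent 2,
  the largest possible.\<close>

lemma omega_label_le:
  assumes \<sigma>: "\<sigma> \<in> NN q s"
  shows "exp_le (vertex_label m (omega q s \<sigma>)) (label \<sigma>)"
  unfolding exp_le_def
proof
  fix x
  let ?l = "\<lambda>i. Poly_Mapping.lookup (m i) x"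
  have L2: "\<sigma> \<in> L2 q" using \<sigma> NN_L2 by blast
  have fin: "finite \<sigma>" using L2 by (rule L2_finite_face)
  obtain j where j: "is_type q s \<sigma> j" using \<sigma> NN_is_type by blast
  have w: "omega q s \<sigma> = ee 1 j" by (rule omega_is_type[OF s j])
  have jq: "j \<in> {1..q}" using j by (auto simp: is_type_def type_i_def type_ii_def type_iii_def)
  have le1: "?l 1 \<le> 1" "?l j \<le> 1" using square_free jq s sq by auto
  have mem: "?l a + ?l b \<le> Poly_Mapping.lookup (label \<sigma>) x" if "ee a b \<in> \<sigma>" for a b
  proof -
    have "exp_le (vertex_label m (ee a b)) (label \<sigma>)"
      unfolding face_label_def using fin that by (intro le_lcm_exp) auto
    then show ?thesis unfolding exp_le_def vertex_label_ee lookup_add by (rule spec)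
  qed
  have "?l 1 + ?l j \<le> Poly_Mapping.lookup (label \<sigma>) x"
  proof (cases "?l 1 = 0")
    case True
    have "\<exists>a. ee a j \<in> \<sigma> \<or> ee j a \<in> \<sigma>"
      using j unfolding is_type_def
    proof (elim disjE)
      assume "type_i q s \<sigma> j"
      then have "ee 2 j \<in> \<sigma>" using s by (auto simp: type_i_def)
      then show ?thesis by blast
    next
      assume "type_ii q s \<sigma> j"
      then show ?thesis by (rule type_ii_E) blast
    next
      assume "type_iii q s \<sigma> j"
      then show ?thesis by (auto simp: type_iii_def)
    qed
    then show ?thesis using True mem by (metis add.commute add_0 add_leD2)
  next
    case False
    then obtain k where k: "k \<in> {2..s}" "?l k \<noteq> 0" using cover by blast
    have one: "?l 1 + ?l j \<le> ?l k + ?l 1" if "?l j \<le> ?l 1" using that k le1 by simp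
    from j show ?thesis unfolding is_type_def
    proof (elim disjE)
      assume "type_i q s \<sigma> j"
      then have "ee k j \<in> \<sigma>" using k by (auto simp: type_i_def)
      then show ?thesis using mem[of k j] le1 k by simp
    next
      assume "type_ii q s \<sigma> j"
      then obtain t where t: "t ` {2..s} = {1, j}" "\<sigma> = (\<lambda>k. ee k (t k)) ` {2..s}"
        by (rule type_ii_E)
      then have "t k = 1 \<or> t k = j" "ee k (t k) \<in> \<sigma>" using k by blast+
      then show ?thesis using mem[of k "t k"] le1 k False by auto
    next
      assume "type_iii q s \<sigma> j"
      then have "ee k 1 \<in> \<sigma>" using k by (auto simp: type_iii_def)
      then show ?thesis using mem[of k 1] le1 k False by simp
    qed
  qed
  then show "Poly_Mapping.lookup (vertex_label m (omega q s \<sigma>)) x \<le> Poly_Mapping.lookup (label \<sigma>) x"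
    by (simp add: w vertex_label_ee lookup_add)
qed

lemma matching_label:
  assumes "(u, l) \<in> matching q s ord"
  shows "exp_le (label u) a \<longleftrightarrow> exp_le (label l) a"
proof -
  from assms obtain \<sigma> where \<sigma>: "\<sigma> \<in> NN q s" "u \<in> L2 q" "l \<in> L2 q" "\<sigma> \<subseteq> l" "omega q s \<sigma> \<in> u" "l = u - {omega q s \<sigma>}"
    unfolding matching_def YY_def by blast
  then have u: "u = insert (omega q s \<sigma>) l" by blast
  have "exp_le (vertex_label m (omega q s \<sigma>)) a" if "exp_le (label l) a"
    using omega_label_le[OF \<sigma>(1)] label_mono[OF \<sigma>(3,4)] that exp_le_trans by blast
  then show ?thesis
    using label_le_iff[OF \<sigma>(2)] label_le_iff[OF \<sigma>(3)] unfolding u by auto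
qed

abbreviation A :: "(vertex set \<times> vertex set) set" where "A \<equiv> matching q s ord"

definition strand :: "('x \<Rightarrow>\<^sub>0 nat) \<Rightarrow> vertex set set" where
  "strand a = {x \<in> L2 q. exp_le (label x) a}"

sublocale toggle "L2 q" "down_index q s ord" "toggle_vertex q s ord"
  by (rule toggle_L2[OF lin])

lemma A_eq: "M = A"
  by (rule matching_eq_toggle[OF lin, symmetric])

lemma strand_closed: "x \<in> strand a \<Longrightarrow> y \<subseteq> x \<Longrightarrow> y \<in> strand a"
  using L2_subset[of x q y] label_mono[of x y] exp_le_trans[of "label y" "label x" a]
  unfolding strand_def by simp

lemma strand_up: "(u, l) \<in> A \<Longrightarrow> l \<in> strand a \<Longrightarrow> u \<in> strand a"
  using matching_label[of u l a] M_face_edges unfolding strand_def A_eq by (auto simp: face_edges_def)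

lemma morse_strand:
  "morse_paths_sum (strand a) card (boundary_coeff V :: _ \<Rightarrow> _ \<Rightarrow> 'k::comm_ring_1)
     (A \<inter> strand a \<times> strand a) pot (\<lambda>x y. of_int (LD_incidence q s ord V x y))"
  unfolding LD_incidence_def A_eq[symmetric]
proof (rule morse_paths_sum_subcomplex[OF V])
  show "strand a \<subseteq> L2 q" by (auto simp: strand_def)
  show "u \<in> strand a" if "(u, l) \<in> M" "l \<in> strand a" for u l
    using strand_up that unfolding A_eq .
qed (rule L2_vertices, assumption, rule strand_closed)

lemma crit_strand:
  "morse_data.crit (strand a) (A \<inter> strand a \<times> strand a) = critical_faces (L2 q) A \<inter> strand a"
  unfolding A_eq[symmetric]
\<comment> \<open>The set of critical faces does not depend on the coefficients, so any ring will
  do.\<close>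
proof (rule crit_subcomplex[where V = V and 'k = int])
  show "morse_data (strand a) card (boundary_coeff V :: _ \<Rightarrow> _ \<Rightarrow> int) (M \<inter> strand a \<times> strand a) pot"
    using morse_strand[of a] unfolding A_eq morse_paths_sum_def by (rule conjunct1)
  show "strand a \<subseteq> L2 q" by (auto simp: strand_def)
  show "u \<in> strand a" if "(u, l) \<in> M" "l \<in> strand a" for u l
    using strand_up that unfolding A_eq .
qed (rule strand_closed)

text \<open>The degrees start at cardinality 1 because a strand without vertices is
  \<open>{{}}\<close>, whose reduced homology sits in the empty face.\<close>

lemma strand_acyclic:
  fixes x :: "vertex set \<Rightarrow> 'k::comm_ring_1"
  assumes x_deg: "\<And>y. y \<in> strand a \<Longrightarrow> x y \<noteq> 0 \<Longrightarrow> card y = Suc n"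
    and cycle: "\<And>z. z \<in> strand a \<Longrightarrow> (\<Sum>y\<in>strand a. x y * boundary_coeff V y z) = 0"
  shows "\<exists>w. (\<forall>u. w u \<noteq> 0 \<longrightarrow> u \<in> strand a \<and> card u = Suc (Suc n)) \<and>
             (\<forall>y\<in>strand a. x y = (\<Sum>u\<in>strand a. w u * boundary_coeff V u y))"
proof -
  define S where "S = {v \<in> vertices q. exp_le (vertex_label m v) a}"
  have strand_S: "strand a = {x \<in> L2 q. x \<subseteq> S}"
    using label_le_iff L2_vertices[of _ q] unfolding strand_def S_def by blast
  show ?thesis
  proof (cases "S = {}")
    case True
    then have "x y = 0" if "y \<in> strand a" for y using that x_deg[of y] by (auto simp: strand_S)
    then show ?thesis by (intro exI[of _ "\<lambda>_. 0"]) auto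
  next
    case False
    show ?thesis
    proof (rule induced_acyclic[OF V _ False _ strand_S x_deg cycle])
      fix i u v assume iu: "ee i i \<in> S" "ee u v \<in> S"
      then have iuv: "i \<in> {1..q}" "u \<in> {1..q}" "v \<in> {1..q}" by (auto simp: S_def ee_in_vertices)
      \<comment> \<open>If \<open>m i\<close> has exponent 0, the bound from \<open>ee u v\<close>
        suffices. If it has exponent 1, the loop makes the right side at least 2, and the left side
        is at most 2 by square-freeness.\<close>
      have "Poly_Mapping.lookup (m i) x + Poly_Mapping.lookup (m u) x \<le> Poly_Mapping.lookup a x" for x
      proof -
        have "Poly_Mapping.lookup (m i) x + Poly_Mapping.lookup (m i) x \<le> Poly_Mapping.lookup a x"
          "Poly_Mapping.lookup (m u) x + Poly_Mapping.lookup (m v) x \<le> Poly_Mapping.lookup a x"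
          using iu by (auto simp: S_def vertex_label_ee exp_le_def lookup_add)
        then show ?thesis using square_free[OF iuv(1), of x] square_free[OF iuv(2), of x] by linarith
      qed
      then show "ee i u \<in> S"
        using iuv by (auto simp: S_def ee_in_vertices vertex_label_ee exp_le_def lookup_add)
    qed (auto simp: S_def)
  qed
qed

section \<open>Exactness on the critical cells of a strand\<close>

definition cells :: "nat \<Rightarrow> ('x \<Rightarrow>\<^sub>0 nat) \<Rightarrow> vertex set set" where
  "cells i a = {\<sigma> \<in> LD_cells q s ord i. exp_le (label \<sigma>) a}"

lemma finite_LD_cells: "finite (LD_cells q s ord i)"
  by (rule finite_subset[OF _ finite_L2[of q]])
    (auto simp: LD_cells_def morse_cells_def critical_faces_def)

lemma cells_eq: "cells i a = {t \<in> critical_faces (L2 q) A \<inter> strand a. card t = Suc i}"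
  by (auto simp: cells_def LD_cells_def morse_cells_def strand_def critical_faces_def)

abbreviation inc :: "vertex set \<Rightarrow> vertex set \<Rightarrow> 'k::comm_ring_1" where
  "inc \<tau> \<sigma> \<equiv> of_int (LD_incidence q s ord V \<tau> \<sigma>)"

text \<open>A vertex is critical and its boundary is the empty face with sign 1. This is what
  identifies the last Morse differential with the augmentation.\<close>

lemma inc_empty:
  assumes "v \<in> vertices q" shows "inc {v} {} = (1 :: 'k::comm_ring_1)"
proof -
  let ?a = "label {v}"
  interpret morse_paths_sum "strand ?a" card "boundary_coeff V :: _ \<Rightarrow> _ \<Rightarrow> 'k"
    "A \<inter> strand ?a \<times> strand ?a" pot "\<lambda>x y. inc x y"
    by (rule morse_strand)
  have v: "{v} \<in> strand ?a" using singleton_L2[OF assms] by (simp add: strand_def)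
  then have e: "{} \<in> strand ?a" using strand_closed by blast
  have "{v} \<in> crit" using v small_face_critical[OF s singleton_L2[OF assms]] by (simp add: crit_strand)
  then have "inc {v} {} = (\<Sum>z\<in>strand ?a. boundary_coeff V {v} z * inc z {} :: 'k)"
    using D_W_crit[of "{v}" "{}"] e by simp
  also have "\<dots> = (\<Sum>z\<in>{{}}. boundary_coeff V {v} z * inc z {})"
  proof (rule sum.mono_neutral_right)
    show "\<forall>z\<in>strand ?a - {{}}. boundary_coeff V {v} z * inc z {} = (0 :: 'k)"
      by (auto simp: boundary_coeff_def subset_singleton_iff)
  qed (use e finK in auto)
  also have "\<dots> = 1" using W_self[OF e] by (simp add: boundary_coeff_def simplicial_incidence_def)
  finally show ?thesis .
qed

text \<open>For \<open>i = 0\<close> the cycle condition concerns the empty face, which belongs to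
  no \<open>cells n a\<close>, and says that the coefficients sum to 0. Thus one statement covers
  the augmentation and all differentials.\<close>

lemma morse_cells_exact:
  fixes z :: "vertex set \<Rightarrow> 'k::comm_ring_1"
  assumes cycle: "\<And>\<sigma>. \<lbrakk>\<sigma> \<in> critical_faces (L2 q) A \<inter> strand a; card \<sigma> = i\<rbrakk> \<Longrightarrow>
      (\<Sum>\<tau>\<in>cells i a. z \<tau> * inc \<tau> \<sigma>) = 0"
  shows "\<exists>w. \<forall>\<sigma>\<in>cells i a. z \<sigma> = (\<Sum>\<tau>\<in>cells (Suc i) a. w \<tau> * inc \<tau> \<sigma>)"
proof -
  interpret morse_paths_sum "strand a" card "boundary_coeff V :: _ \<Rightarrow> _ \<Rightarrow> 'k"
    "A \<inter> strand a \<times> strand a" pot "\<lambda>x y. inc x y"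
    by (rule morse_strand)
  have cells: "cells n a = {t \<in> crit. card t = Suc n}" for n
    by (simp add: cells_eq crit_strand)
  define z' where "z' t = (if t \<in> cells i a then z t else 0)" for t
  have sums: "(\<Sum>t\<in>crit. g t) = (\<Sum>t\<in>cells n a. g t)" if "\<And>t. t \<in> crit \<Longrightarrow> card t \<noteq> Suc n \<Longrightarrow> g t = 0"
    for g :: "vertex set \<Rightarrow> 'k" and n
    using finite_crit that by (intro sum.mono_neutral_right) (auto simp: cells)
  have "\<exists>w. (\<forall>t. w t \<noteq> 0 \<longrightarrow> t \<in> crit \<and> card t = Suc (Suc i)) \<and>
             (\<forall>s\<in>crit. card s = Suc i \<longrightarrow> z' s = (\<Sum>t\<in>crit. w t * inc t s))"
  proof (rule morse_exact)
    show "card t = Suc i" if "z' t \<noteq> 0" for t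
      using that by (auto simp: z'_def cells split: if_splits)
    show "(\<Sum>t\<in>crit. z' t * inc t \<sigma>) = 0" if "\<sigma> \<in> crit" "card \<sigma> = i" for \<sigma>
    proof -
      have "(\<Sum>t\<in>crit. z' t * inc t \<sigma>) = (\<Sum>t\<in>cells i a. z' t * inc t \<sigma>)"
        by (rule sums) (auto simp: z'_def cells)
      also have "\<dots> = (\<Sum>t\<in>cells i a. z t * inc t \<sigma>)" by (simp add: z'_def)
      also have "\<dots> = 0" using cycle that by (simp add: crit_strand)
      finally show ?thesis .
    qed
  qed (rule strand_acyclic)
  then obtain w where w: "\<And>t. w t \<noteq> 0 \<Longrightarrow> t \<in> crit \<and> card t = Suc (Suc i)"
    "\<And>s. s \<in> crit \<Longrightarrow> card s = Suc i \<Longrightarrow> z' s = (\<Sum>t\<in>crit. w t * inc t s)" by blast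
  have "z \<sigma> = (\<Sum>\<tau>\<in>cells (Suc i) a. w \<tau> * inc \<tau> \<sigma>)" if "\<sigma> \<in> cells i a" for \<sigma>
  proof -
    have "z \<sigma> = z' \<sigma>" using that by (simp add: z'_def)
    also have "\<dots> = (\<Sum>t\<in>crit. w t * inc t \<sigma>)" using that by (intro w(2)) (auto simp: cells)
    also have "\<dots> = (\<Sum>\<tau>\<in>cells (Suc i) a. w \<tau> * inc \<tau> \<sigma>)" by (rule sums) (use w(1) in force)
    finally show ?thesis .
  qed
  then show ?thesis by blast
qed

lemma cells_exact:
  fixes z :: "vertex set \<Rightarrow> 'k::comm_ring_1"
  assumes "\<And>\<sigma>. \<sigma> \<in> cells i a \<Longrightarrow> (\<Sum>\<tau>\<in>cells (Suc i) a. z \<tau> * inc \<tau> \<sigma>) = 0"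
  shows "\<exists>w. \<forall>\<sigma>\<in>cells (Suc i) a. z \<sigma> = (\<Sum>\<tau>\<in>cells (Suc (Suc i)) a. w \<tau> * inc \<tau> \<sigma>)"
  by (rule morse_cells_exact) (use assms in \<open>simp add: cells_eq\<close>)

lemma cells_0: "cells 0 a = (\<lambda>v. {v}) ` {v \<in> vertices q. exp_le (vertex_label m v) a}"
  using label_le_iff singleton_L2 by (auto simp: cells_def LD_cells_0[OF s])

lemma cells_exact_0:
  fixes z :: "vertex set \<Rightarrow> 'k::comm_ring_1"
  assumes "(\<Sum>\<tau>\<in>cells 0 a. z \<tau>) = 0"
  shows "\<exists>w. \<forall>\<sigma>\<in>cells 0 a. z \<sigma> = (\<Sum>\<tau>\<in>cells 1 a. w \<tau> * inc \<tau> \<sigma>)"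
  unfolding One_nat_def
proof (rule morse_cells_exact)
  fix \<sigma> assume "\<sigma> \<in> critical_faces (L2 q) A \<inter> strand a" "card \<sigma> = 0"
  then have "\<sigma> = {}" using L2_finite_face by (auto simp: strand_def)
  have "(\<Sum>\<tau>\<in>cells 0 a. z \<tau> * inc \<tau> \<sigma>) = (\<Sum>\<tau>\<in>cells 0 a. z \<tau>)"
    unfolding \<open>\<sigma> = {}\<close> by (intro sum.cong) (auto simp: cells_0 inc_empty)
  then show "(\<Sum>\<tau>\<in>cells 0 a. z \<tau> * inc \<tau> \<sigma>) = 0" using assms by simp
qed

lemma inc_inc:
  assumes "\<tau> \<in> cells (Suc (Suc i)) a" "\<rho> \<in> cells i a"
  shows "(\<Sum>\<sigma>\<in>cells (Suc i) a. inc \<tau> \<sigma> * inc \<sigma> \<rho>) = (0 :: 'k::comm_ring_1)"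
proof -
  interpret morse_paths_sum "strand a" card "boundary_coeff V :: _ \<Rightarrow> _ \<Rightarrow> 'k"
    "A \<inter> strand a \<times> strand a" pot "\<lambda>x y. inc x y"
    by (rule morse_strand)
  have cells: "cells n a = {t \<in> crit. card t = Suc n}" for n
    by (simp add: cells_eq crit_strand)
  show ?thesis
    using morse_boundary_boundary[of \<tau> \<rho>] assms by (simp add: cells)
qed

lemma inc_0:
  assumes "\<tau> \<in> cells 1 a"
  shows "(\<Sum>\<sigma>\<in>cells 0 a. inc \<tau> \<sigma>) = (0 :: 'k::comm_ring_1)"
proof -
  interpret morse_paths_sum "strand a" card "boundary_coeff V :: _ \<Rightarrow> _ \<Rightarrow> 'k"
    "A \<inter> strand a \<times> strand a" pot "\<lambda>x y. inc x y"
    by (rule morse_strand)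
  have cells: "cells n a = {t \<in> crit. card t = Suc n}" for n
    by (simp add: cells_eq crit_strand)
  have "\<tau> \<in> strand a" using assms by (simp add: cells_eq)
  then have "{} \<in> strand a" using strand_closed by blast
  moreover have "{} \<in> critical_faces (L2 q) A"
    using small_face_critical[OF s, of "{}" q ord] by (simp add: L2_iff)
  ultimately have "{} \<in> crit" by (simp add: crit_strand)
  have "(\<Sum>\<sigma>\<in>cells 0 a. inc \<tau> \<sigma>) = (\<Sum>\<sigma>\<in>cells 0 a. inc \<tau> \<sigma> * inc \<sigma> {} :: 'k)"
    by (intro sum.cong) (auto simp: cells_0 inc_empty)
  also have "\<dots> = 0"
    using morse_boundary_boundary[OF _ \<open>{} \<in> crit\<close>, of \<tau>] assms by (simp add: cells)
  finally show ?thesis .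
qed

text \<open>A nonzero incidence needs a gradient path, and along it labels only shrink in
  divisibility: a downward step loses a vertex, an upward step gains one whose label already
  divides.\<close>

lemma inc_label:
  assumes "\<tau> \<in> L2 q" "\<sigma> \<in> L2 q" "LD_incidence q s ord V \<tau> \<sigma> \<noteq> 0"
  shows "exp_le (label \<sigma>) (label \<tau>)"
proof -
  have "exp_le (label \<sigma>) (label \<tau>)"
    if "p \<in> morse_paths (L2 q) A \<tau> \<sigma>" "\<tau> \<in> L2 q" for p
    using that
  proof (induction p arbitrary: \<tau>)
    case (Cons x p)
    show ?case
    proof (cases p)
      case Nil
      then show ?thesis using Cons.prems by (auto simp: morse_paths_def)
    next
      case (Cons y r)
      then have xy: "x = \<tau>" "(\<tau>, y) \<in> morse_graph (L2 q) A" "p \<in> morse_paths (L2 q) A y \<sigma>"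
        using Cons.prems by (auto simp: morse_paths_def)
      have "y \<in> L2 q \<and> exp_le (label y) (label \<tau>)"
      proof (cases "(y, \<tau>) \<in> A")
        case True
        then show ?thesis
          using matching_label[OF True, of "label \<tau>"] by (auto simp: matching_def YY_def)
      next
        case False
        then show ?thesis using xy(2) label_mono by (auto simp: morse_graph_def face_edges_def)
      qed
      then show ?thesis using Cons.IH[OF xy(3)] exp_le_trans by blast
    qed
  qed (simp add: morse_paths_def)
  moreover have "morse_paths (L2 q) A \<tau> \<sigma> \<noteq> {}"
    using assms(3) by (auto simp: LD_incidence_def morse_incidence_def)
  ultimately show ?thesis using assms(1) by blast
qed

end

section \<open>Multigraded resolutions\<close>

definition polys :: "'x set \<Rightarrow> ('x, 'k::field) mpol set" where
  "polys X = {p. \<forall>t \<in> Poly_Mapping.keys p. Poly_Mapping.keys t \<subseteq> X}"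

lemma poly_ring_simps [simp]:
  "carrier (poly_ring X) = polys X" "mult (poly_ring X) = (*)" "one (poly_ring X) = 1"
  "zero (poly_ring X) = 0" "add (poly_ring X) = (+)"
  by (auto simp: poly_ring_def polys_def)

lemma polys_closed [intro, simp]:
  shows "0 \<in> polys X" "1 \<in> polys X"
    and "p \<in> polys X \<Longrightarrow> r \<in> polys X \<Longrightarrow> p + r \<in> polys X"
    and "p \<in> polys X \<Longrightarrow> - p \<in> polys X"
    and "p \<in> polys X \<Longrightarrow> r \<in> polys X \<Longrightarrow> p * r \<in> polys X"
    and "Poly_Mapping.keys t \<subseteq> X \<Longrightarrow> Poly_Mapping.single t c \<in> polys X"
proof -
  show "0 \<in> polys X" "1 \<in> polys X" by (auto simp: polys_def)
  show "p + r \<in> polys X" if "p \<in> polys X" "r \<in> polys X"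
    using that Poly_Mapping.keys_add[of p r] unfolding polys_def by blast
  show "- p \<in> polys X" if "p \<in> polys X" using that by (simp add: polys_def)
  show "p * r \<in> polys X" if pr: "p \<in> polys X" "r \<in> polys X"
    unfolding polys_def
  proof clarify
    fix t x assume t: "t \<in> Poly_Mapping.keys (p * r)" and x: "x \<in> Poly_Mapping.keys t"
    then obtain a b where "t = a + b" "a \<in> Poly_Mapping.keys p" "b \<in> Poly_Mapping.keys r"
      using keys_mult[of p r] by blast
    then show "x \<in> X" using pr x Poly_Mapping.keys_add[of a b] unfolding polys_def by blast
  qed
  show "Poly_Mapping.single t c \<in> polys X" if "Poly_Mapping.keys t \<subseteq> X"
    using that by (auto simp: polys_def)
qed

lemma polys_diff: "p \<in> polys X \<Longrightarrow> r \<in> polys X \<Longrightarrow> p - r \<in> polys X"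
  using polys_closed(3)[of p X "- r"] by simp

lemma polys_sum: "(\<And>b. b \<in> B \<Longrightarrow> f b \<in> polys X) \<Longrightarrow> (\<Sum>b\<in>B. f b) \<in> polys X"
  by (induction B rule: infinite_finite_induct) auto

lemma mon_polys [simp]: "Poly_Mapping.keys t \<subseteq> X \<Longrightarrow> mon t \<in> polys X"
  by (simp add: mon_def)

lemma poly_ring_cring: "cring (poly_ring X :: ('x, 'k::field) mpol ring)"
proof (rule cringI)
  show "abelian_group (poly_ring X :: ('x, 'k) mpol ring)"
  proof (rule abelian_groupI)
    show "\<exists>y\<in>carrier (poly_ring X). y \<oplus>\<^bsub>poly_ring X\<^esub> x = \<zero>\<^bsub>poly_ring X\<^esub>"
      if "x \<in> carrier (poly_ring X)" for x :: "('x, 'k) mpol"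
      using that by (intro bexI[of _ "- x"]) auto
  qed (auto simp: algebra_simps)
  show "comm_monoid (poly_ring X :: ('x, 'k) mpol ring)"
    by (rule comm_monoidI) (auto simp: algebra_simps)
qed (auto simp: algebra_simps)

lemma aug_map_mem: "finite B \<Longrightarrow> ideal J (poly_ring X) \<Longrightarrow> (\<And>b. b \<in> B \<Longrightarrow> \<epsilon> b \<in> J) \<Longrightarrow>
    f \<in> free_mod X B \<Longrightarrow> aug_map B \<epsilon> f \<in> J"
proof -
  assume B: "finite B" and J: "ideal J (poly_ring X)" and \<epsilon>: "\<And>b. b \<in> B \<Longrightarrow> \<epsilon> b \<in> J"
    and f: "f \<in> free_mod X B"
  have "(\<Sum>b\<in>C. f b * \<epsilon> b) \<in> J" if "finite C" "C \<subseteq> B" for C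
    using that
  proof (induction C rule: finite_induct)
    case empty
    show ?case using additive_subgroup.zero_closed[OF ideal.axioms(1)[OF J]] by simp
  next
    case (insert b C)
    then have "f b * \<epsilon> b \<in> J"
      using ideal.I_l_closed[OF J, of "\<epsilon> b" "f b"] \<epsilon> f by (auto simp: free_mod_def)
    then show ?case
      using additive_subgroup.a_closed[OF ideal.axioms(1)[OF J]] insert by simp
  qed
  then show ?thesis using B by (simp add: aug_map_def)
qed

lemma aug_image_ideal:
  assumes "finite B" "\<And>b. b \<in> B \<Longrightarrow> \<epsilon> b \<in> polys X"
  shows "ideal (aug_map B \<epsilon> ` free_mod X B) (poly_ring X :: ('x, 'k::field) mpol ring)"
proof -
  interpret cring "poly_ring X :: ('x, 'k) mpol ring" by (rule poly_ring_cring)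
  let ?J = "aug_map B \<epsilon> ` free_mod X B"
  have add: "aug_map B \<epsilon> f + aug_map B \<epsilon> g = aug_map B \<epsilon> (\<lambda>b. f b + g b)" for f g
    by (simp add: aug_map_def distrib_right sum.distrib)
  have minus: "- aug_map B \<epsilon> f = aug_map B \<epsilon> (\<lambda>b. - f b)" for f
    by (simp add: aug_map_def sum_negf)
  have scale: "r * aug_map B \<epsilon> f = aug_map B \<epsilon> (\<lambda>b. r * f b)" for r f
    by (simp add: aug_map_def sum_distrib_left mult.assoc)
  have carr: "aug_map B \<epsilon> f \<in> polys X" if "f \<in> free_mod X B" for f
    using that assms unfolding aug_map_def by (intro polys_sum) (auto simp: free_mod_def)
  have zero: "aug_map B \<epsilon> (\<lambda>_. 0) = 0" by (simp add: aug_map_def)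
  have closed: "(\<lambda>b. 0) \<in> free_mod X B" "(\<lambda>b. f b + g b) \<in> free_mod X B"
    "(\<lambda>b. - f b) \<in> free_mod X B" "p \<in> polys X \<Longrightarrow> (\<lambda>b. p * f b) \<in> free_mod X B"
    if "f \<in> free_mod X B" "g \<in> free_mod X B" for f g p
    using that by (auto simp: free_mod_def)
  have inv: "\<ominus>\<^bsub>poly_ring X\<^esub> x = - x" if "x \<in> polys X" for x :: "('x, 'k) mpol"
    using minus_equality[of "- x" x] that by simp
  show ?thesis
  proof (intro idealI ring_axioms subgroup.intro)
    show "?J \<subseteq> carrier (add_monoid (poly_ring X))" using carr by auto
    show "\<one>\<^bsub>add_monoid (poly_ring X)\<^esub> \<in> ?J"
      using zero by (intro image_eqI[of _ _ "\<lambda>_. 0"]) (auto simp: free_mod_def)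
    show "x \<otimes>\<^bsub>add_monoid (poly_ring X)\<^esub> y \<in> ?J" if xy: "x \<in> ?J" "y \<in> ?J" for x y
    proof -
      from xy obtain f g where "f \<in> free_mod X B" "g \<in> free_mod X B" "x = aug_map B \<epsilon> f" "y = aug_map B \<epsilon> g"
        by auto
      then show ?thesis using add closed(2) by (intro image_eqI[of _ _ "\<lambda>b. f b + g b"]) auto
    qed
    show "inv\<^bsub>add_monoid (poly_ring X)\<^esub> x \<in> ?J" if x: "x \<in> ?J" for x
    proof -
      from x obtain f where f: "f \<in> free_mod X B" "x = aug_map B \<epsilon> f" by auto
      then have "inv\<^bsub>add_monoid (poly_ring X)\<^esub> x = - x" using inv carr by (simp add: a_inv_def)
      then show ?thesis using f minus closed(3) by (intro image_eqI[of _ _ "\<lambda>b. - f b"]) auto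
    qed
    show l: "x \<otimes>\<^bsub>poly_ring X\<^esub> a \<in> ?J" if a: "a \<in> ?J" "x \<in> carrier (poly_ring X)" for a x
    proof -
      from a obtain f where "f \<in> free_mod X B" "a = aug_map B \<epsilon> f" by auto
      then show ?thesis using a scale closed(4) by (intro image_eqI[of _ _ "\<lambda>b. x * f b"]) auto
    qed
    show "a \<otimes>\<^bsub>poly_ring X\<^esub> x \<in> ?J" if "a \<in> ?J" "x \<in> carrier (poly_ring X)" for a x
      using l[OF that] by (simp add: mult.commute)
  qed
qed

text \<open>Two rounds with the colon ideals of \<open>K\<close>: for a generator \<open>y\<close>
  of the second ideal the \<open>p\<close> with \<open>p \<otimes> y \<in> K\<close> form an ideal,
  which therefore contains the first ideal; then the roles are exchanged.\<close>

lemma (in cring) ideal_prod_genideal_subset: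
  assumes S: "S \<subseteq> carrier R" and T: "T \<subseteq> carrier R" and K: "ideal K R"
    and ST: "\<And>x y. x \<in> S \<Longrightarrow> y \<in> T \<Longrightarrow> x \<otimes> y \<in> K"
  shows "ideal_prod R (Idl S) (Idl T) \<subseteq> K"
proof -
  interpret K: ideal K R by (rule K)
  have colon: "ideal {p \<in> carrier R. p \<otimes> r \<in> K} R" if r: "r \<in> carrier R" for r
  proof (intro idealI subgroup.intro ring_axioms)
    show "x \<otimes>\<^bsub>add_monoid R\<^esub> y \<in> {p \<in> carrier R. p \<otimes> r \<in> K}"
      if "x \<in> {p \<in> carrier R. p \<otimes> r \<in> K}" "y \<in> {p \<in> carrier R. p \<otimes> r \<in> K}" for x y
      using that r by (simp add: l_distr)
    show "inv\<^bsub>add_monoid R\<^esub> x \<in> {p \<in> carrier R. p \<otimes> r \<in> K}"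
      if "x \<in> {p \<in> carrier R. p \<otimes> r \<in> K}" for x
      using that r by (simp add: a_inv_def[symmetric] l_minus)
    show "x \<otimes> a \<in> {p \<in> carrier R. p \<otimes> r \<in> K}"
      if "a \<in> {p \<in> carrier R. p \<otimes> r \<in> K}" "x \<in> carrier R" for a x
      using that r by (simp add: m_assoc K.I_l_closed)
    then show "a \<otimes> x \<in> {p \<in> carrier R. p \<otimes> r \<in> K}"
      if "a \<in> {p \<in> carrier R. p \<otimes> r \<in> K}" "x \<in> carrier R" for a x
      using that m_comm[of a x] by auto
  qed (use r in auto)
  have IS: "Idl S \<subseteq> carrier R" and IT: "Idl T \<subseteq> carrier R"
    using genideal_ideal[OF S] genideal_ideal[OF T]
    by (simp_all add: additive_subgroup.a_subset ideal.axioms(1))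
  have 1: "Idl S \<subseteq> {p \<in> carrier R. p \<otimes> y \<in> K}" if "y \<in> T" for y
    using that T S ST by (intro genideal_minimal colon) auto
  have 2: "Idl T \<subseteq> {r \<in> carrier R. r \<otimes> p \<in> K}" if p: "p \<in> Idl S" for p
  proof (rule genideal_minimal[OF colon])
    show "p \<in> carrier R" using p IS by blast
    show "T \<subseteq> {r \<in> carrier R. r \<otimes> p \<in> K}"
    proof
      fix r assume r: "r \<in> T"
      then have "p \<otimes> r \<in> K" using 1 p by blast
      moreover have "r \<in> carrier R" "p \<in> carrier R" using r T p IS by auto
      ultimately show "r \<in> {r \<in> carrier R. r \<otimes> p \<in> K}" using m_comm[of p r] by simp
    qed
  qed
  show ?thesis
  proof
    fix x assume "x \<in> ideal_prod R (Idl S) (Idl T)"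
    then show "x \<in> K"
    proof (induction rule: ideal_prod.induct)
      case (prod i j)
      then have "j \<otimes> i \<in> K" using 2 by blast
      then show ?case using m_comm[of i j] prod IS IT by (metis subsetD)
    qed (rule K.a_closed)
  qed
qed

lemma mon_add: "mon (t + u) = mon t * mon u"
  by (simp add: mon_def mult_single)

lemma face_label_singleton: "face_label m {v} = vertex_label m v"
  by (rule poly_mapping_eqI) (simp add: face_label_def lookup_lcm_exp)

text \<open>Both inclusions reduce to generators, since the two sides are ideals and the labels of
  the vertices are exactly the products of two generators.\<close>

lemma aug_image_ideal_square:
  fixes m :: "nat \<Rightarrow> ('x \<Rightarrow>\<^sub>0 nat)"
  assumes keys: "\<And>i. i \<in> {1..q} \<Longrightarrow> Poly_Mapping.keys (m i) \<subseteq> X"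
  defines "B \<equiv> (\<lambda>v. {v}) ` vertices q"
  shows "aug_map B (\<lambda>\<sigma>. mon (face_label m \<sigma>)) ` free_mod X B =
    ideal_square X (genideal (poly_ring X) (mon ` m ` {1..q}) :: ('x, 'k::field) mpol set)"
proof -
  interpret cring "poly_ring X :: ('x, 'k) mpol ring" by (rule poly_ring_cring)
  let ?S = "mon ` m ` {1..q} :: ('x, 'k) mpol set"
  let ?\<epsilon> = "\<lambda>\<sigma>. mon (face_label m \<sigma>) :: ('x, 'k) mpol"
  have finB: "finite B" using finite_vertices by (simp add: B_def)
  have S: "?S \<subseteq> carrier (poly_ring X)" using keys by auto
  have id: "ideal (genideal (poly_ring X) ?S) (poly_ring X)" by (rule genideal_ideal[OF S])
  have \<epsilon>: "\<exists>i\<in>{1..q}. \<exists>j\<in>{1..q}. b = {ee i j} \<and> ?\<epsilon> b = mon (m i) * mon (m j)" if b: "b \<in> B" for b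
  proof -
    obtain v where v: "v \<in> vertices q" "b = {v}" using b by (auto simp: B_def)
    then obtain i j where "v = ee i j" "i \<in> {1..q}" "j \<in> {1..q}" by (auto elim: vertices_E)
    then show ?thesis
      using v by (intro bexI[of _ i] bexI[of _ j]) (auto simp: face_label_singleton vertex_label_ee mon_add)
  qed
  have \<epsilon>_carr: "?\<epsilon> b \<in> polys X" if "b \<in> B" for b
    using \<epsilon>[OF that] keys by auto
  show ?thesis
    unfolding ideal_square_def
  proof (rule equalityI)
    show "aug_map B ?\<epsilon> ` free_mod X B \<subseteq>
        ideal_prod (poly_ring X) (genideal (poly_ring X) ?S) (genideal (poly_ring X) ?S)"
    proof clarify
      fix f :: "vertex set \<Rightarrow> ('x, 'k) mpol" assume f: "f \<in> free_mod X B"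
      show "aug_map B ?\<epsilon> f \<in> ideal_prod (poly_ring X) (genideal (poly_ring X) ?S) (genideal (poly_ring X) ?S)"
      proof (rule aug_map_mem[OF finB ideal_prod_is_ideal[OF id id] _ f])
        fix b assume "b \<in> B"
        then obtain i j where ij: "i \<in> {1..q}" "j \<in> {1..q}" "?\<epsilon> b = mon (m i) * mon (m j)"
          using \<epsilon> by blast
        have "mon (m i) \<in> genideal (poly_ring X) ?S" "mon (m j) \<in> genideal (poly_ring X) ?S"
          using genideal_self[OF S] ij by auto
        from ideal_prod.prod[OF this, of "poly_ring X"] show "?\<epsilon> b \<in> ideal_prod (poly_ring X) (genideal (poly_ring X) ?S) (genideal (poly_ring X) ?S)"
          using ij by simp
      qed
    qed
    show "ideal_prod (poly_ring X) (genideal (poly_ring X) ?S) (genideal (poly_ring X) ?S) \<subseteq>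
        aug_map B ?\<epsilon> ` free_mod X B"
    proof (rule ideal_prod_genideal_subset[OF S S aug_image_ideal[OF finB \<epsilon>_carr]])
      fix x y assume "x \<in> ?S" "y \<in> ?S"
      then obtain i j where ij: "i \<in> {1..q}" "j \<in> {1..q}" "x = mon (m i)" "y = mon (m j)" by auto
      let ?b = "{ee i j}"
      have b: "?b \<in> B" using ij by (auto simp: B_def ee_in_vertices)
      have "aug_map B ?\<epsilon> (\<lambda>c. if c = ?b then 1 else 0) = ?\<epsilon> ?b"
        using finB b by (simp add: aug_map_def if_distrib[where f = "\<lambda>x. x * _"] cong: if_cong)
      moreover have "(\<lambda>c. if c = ?b then 1 else 0) \<in> free_mod X B"
        using b by (auto simp: free_mod_def)
      ultimately show "x \<otimes>\<^bsub>poly_ring X\<^esub> y \<in> aug_map B ?\<epsilon> ` free_mod X B"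
        using ij by (force simp: image_iff face_label_singleton vertex_label_ee mon_add)
    qed
  qed
qed

section \<open>Coefficients and divisibility of monomials\<close>

lemma exp_le_add_diff: "exp_le t a \<Longrightarrow> t + (a - t) = a"
  by (rule poly_mapping_eqI) (simp add: exp_le_def lookup_add lookup_minus)

lemma exp_le_add [simp]: "exp_le t (u + t)" "exp_le t (t + u)"
  by (simp_all add: exp_le_def lookup_add)

lemma exp_add_diff [simp]: "(u + t) - t = (u :: 'x \<Rightarrow>\<^sub>0 nat)"
  by (rule poly_mapping_eqI) (simp add: lookup_add lookup_minus)

lemma exp_diff_eq_iff: "exp_le t a \<Longrightarrow> exp_le t b \<Longrightarrow> a - t = b - t \<longleftrightarrow> a = b"
  using exp_le_add_diff by metis

lemma lookup_mult_single:
  fixes p :: "('x, 'k::field) mpol"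
  shows "Poly_Mapping.lookup (p * Poly_Mapping.single t c) a =
    (if exp_le t a then Poly_Mapping.lookup p (a - t) * c else 0)"
proof -
  have inner: "(\<Sum>q. Poly_Mapping.lookup (Poly_Mapping.single t c) q when a = l + q) =
      (c when a = l + t)" for l
  proof -
    have "(\<lambda>q. Poly_Mapping.lookup (Poly_Mapping.single t c) q when a = l + q) =
        (\<lambda>q. (c when a = l + t) when q = t)"
      by (rule ext) (auto simp: lookup_single when_def)
    then show ?thesis by (simp only: Sum_any_when_equal)
  qed
  have "Poly_Mapping.lookup (p * Poly_Mapping.single t c) a =
      (\<Sum>l. Poly_Mapping.lookup p l * (c when a = l + t))"
    unfolding lookup_mult inner ..
  also have "\<dots> = (if exp_le t a then Poly_Mapping.lookup p (a - t) * c else 0)"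
  proof (cases "exp_le t a")
    case True
    then have "a = l + t \<longleftrightarrow> l = a - t" for l
      using exp_le_add_diff[OF True] exp_add_diff[of l t] by (metis add.commute)
    then have "(\<lambda>l. Poly_Mapping.lookup p l * (c when a = l + t)) =
        (\<lambda>l. (Poly_Mapping.lookup p l * c) when l = a - t)"
      by (intro ext) (auto simp: when_def)
    then show ?thesis using True by (simp only: Sum_any_when_equal if_True)
  next
    case False
    then have "a \<noteq> l + t" for l using exp_le_add by metis
    then show ?thesis using False by simp
  qed
  finally show ?thesis .
qed

lemma mon_dvd_iff: "(mon t :: ('x, 'k::field) mpol) dvd mon a \<longleftrightarrow> exp_le t a"
proof
  assume "(mon t :: ('x, 'k) mpol) dvd mon a"
  then obtain p :: "('x, 'k) mpol" where p: "mon a = p * mon t" by (auto simp: dvd_def mult.commute)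
  have "Poly_Mapping.lookup (mon a :: ('x, 'k) mpol) a = 1" by (simp add: mon_def)
  then show "exp_le t a"
    unfolding p by (simp add: mon_def lookup_mult_single split: if_splits)
next
  assume "exp_le t a"
  then have "(mon a :: ('x, 'k) mpol) = mon t * mon (a - t)"
    by (simp add: exp_le_add_diff flip: mon_add)
  then show "(mon t :: ('x, 'k) mpol) dvd mon a" by simp
qed

lemma keys_diff_exp: "Poly_Mapping.keys (a - t :: 'x \<Rightarrow>\<^sub>0 nat) \<subseteq> Poly_Mapping.keys a"
  by (auto simp: in_keys_iff lookup_minus)

section \<open>Gluing exact strands to a resolution\<close>

locale multigraded =
  fixes X :: "'x set" and B :: "nat \<Rightarrow> 'b set" and lab :: "'b \<Rightarrow> ('x \<Rightarrow>\<^sub>0 nat)"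
    and \<kappa> :: "nat \<Rightarrow> 'b \<Rightarrow> 'b \<Rightarrow> 'k::field"
  assumes fin_B: "finite (B i)"
    and lab_X: "b \<in> B i \<Longrightarrow> Poly_Mapping.keys (lab b) \<subseteq> X"
    and lab_le: "\<lbrakk>b \<in> B (Suc i); c \<in> B i; \<kappa> i b c \<noteq> 0\<rbrakk> \<Longrightarrow> exp_le (lab c) (lab b)"
begin

definition C :: "nat \<Rightarrow> ('x \<Rightarrow>\<^sub>0 nat) \<Rightarrow> 'b set" where
  "C i a = {b \<in> B i. exp_le (lab b) a}"

definition D :: "nat \<Rightarrow> 'b \<Rightarrow> 'b \<Rightarrow> ('x, 'k) mpol" where
  "D i b c = Poly_Mapping.single (lab b - lab c) (\<kappa> i b c)"

text \<open>The part of \<open>f\<close> in multidegree \<open>a\<close> has the coordinates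
  \<open>Poly_Mapping.lookup (f b) (a - lab b)\<close> for \<open>lab b\<close> dividing
  \<open>a\<close>; on these the differential acts through the scalars
  \<open>\<kappa>\<close>.\<close>

lemma lookup_free_map:
  assumes c: "c \<in> C i a"
  shows "Poly_Mapping.lookup (free_map (B (Suc i)) (B i) (D i) f c) (a - lab c) =
    (\<Sum>b\<in>C (Suc i) a. Poly_Mapping.lookup (f b) (a - lab b) * \<kappa> i b c)"
proof -
  have c': "c \<in> B i" "exp_le (lab c) a" using c by (auto simp: C_def)
  have "Poly_Mapping.lookup (f b * D i b c) (a - lab c) =
      (if exp_le (lab b) a then Poly_Mapping.lookup (f b) (a - lab b) * \<kappa> i b c else 0)"
    if b: "b \<in> B (Suc i)" for b
  proof (cases "\<kappa> i b c = 0")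
    case False
    then have bc: "exp_le (lab c) (lab b)" using lab_le b c' by blast
    have "exp_le (lab b - lab c) (a - lab c) \<longleftrightarrow> exp_le (lab b) a"
      using bc c'(2) unfolding exp_le_def lookup_minus by (metis diff_le_mono le_diff_iff)
    moreover have "(a - lab c) - (lab b - lab c) = a - lab b"
      using bc by (intro poly_mapping_eqI) (simp add: exp_le_def lookup_minus)
    ultimately show ?thesis by (simp add: D_def lookup_mult_single)
  qed (simp add: D_def)
  then have "Poly_Mapping.lookup (free_map (B (Suc i)) (B i) (D i) f c) (a - lab c) =
      (\<Sum>b\<in>B (Suc i). if exp_le (lab b) a then Poly_Mapping.lookup (f b) (a - lab b) * \<kappa> i b c else 0)"
    using c' by (simp add: free_map_def lookup_sum)
  then show ?thesis using fin_B by (simp add: C_def sum.inter_filter)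
qed

lemma lookup_aug_map:
  "Poly_Mapping.lookup (aug_map (B 0) (\<lambda>b. mon (lab b)) f) a =
    (\<Sum>b\<in>C 0 a. Poly_Mapping.lookup (f b) (a - lab b))"
  using fin_B by (simp add: aug_map_def lookup_sum mon_def lookup_mult_single C_def sum.inter_filter
      cong: if_cong)

lemma D_polys: "b \<in> B (Suc i) \<Longrightarrow> D i b c \<in> polys X"
  using keys_diff_exp[of "lab b" "lab c"] lab_X[of b "Suc i"] by (auto simp: D_def)

lemma free_map_mem: "f \<in> free_mod X (B (Suc i)) \<Longrightarrow> free_map (B (Suc i)) (B i) (D i) f \<in> free_mod X (B i)"
  using D_polys[of _ i] by (auto simp: free_mod_def free_map_def intro!: polys_sum)

lemma poly_eqI_strands:
  assumes "\<And>a. exp_le t a \<Longrightarrow> Poly_Mapping.lookup p (a - t) = Poly_Mapping.lookup r (a - t)"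
  shows "p = (r :: ('x, 'k) mpol)"
proof (rule poly_mapping_eqI)
  fix u
  show "Poly_Mapping.lookup p u = Poly_Mapping.lookup r u"
    using assms[of "u + t"] by simp
qed

text \<open>Solutions of the strands are glued to a preimage; only finitely many multidegrees occur.\<close>

lemma strands_imp_image:
  assumes f: "f \<in> free_mod X (B i)"
    and strands: "\<And>a. \<exists>w. \<forall>c\<in>C i a. Poly_Mapping.lookup (f c) (a - lab c) = (\<Sum>b\<in>C (Suc i) a. w b * \<kappa> i b c)"
  shows "f \<in> free_map (B (Suc i)) (B i) (D i) ` free_mod X (B (Suc i))"
proof -
  obtain w where w: "\<And>a c. c \<in> C i a \<Longrightarrow>
      Poly_Mapping.lookup (f c) (a - lab c) = (\<Sum>b\<in>C (Suc i) a. w a b * \<kappa> i b c)"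
    using strands by metis
  \<comment> \<open>The multidegrees in which \<open>f\<close> lives. Outside \<open>Z\<close> the
    solution 0 is taken, which makes \<open>F\<close> a vector of polynomials.\<close>
  define Z where "Z = (\<Union>c\<in>B i. (\<lambda>t. t + lab c) ` Poly_Mapping.keys (f c))"
  have finZ: "finite Z" using fin_B by (simp add: Z_def)
  have Z_X: "Poly_Mapping.keys a \<subseteq> X" if "a \<in> Z" for a
  proof -
    from that obtain c t where ct: "c \<in> B i" "t \<in> Poly_Mapping.keys (f c)" "a = t + lab c"
      by (auto simp: Z_def)
    then have "Poly_Mapping.keys t \<subseteq> X" using f by (auto simp: free_mod_def polys_def)
    then show ?thesis using ct lab_X[OF ct(1)] Poly_Mapping.keys_add[of t "lab c"] by blast
  qed
  define F where "F b = (if b \<in> B (Suc i)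
      then \<Sum>a\<in>{a \<in> Z. exp_le (lab b) a}. Poly_Mapping.single (a - lab b) (w a b) else 0)" for b
  have "Poly_Mapping.single (a - lab b) (w a b) \<in> polys X" if "a \<in> Z" for a b
    using keys_diff_exp[of a "lab b"] Z_X[OF that] by (intro polys_closed) blast
  then have F_mod: "F \<in> free_mod X (B (Suc i))"
    by (auto simp: free_mod_def F_def intro!: polys_sum)
  \<comment> \<open>Distinct multiples of \<open>lab b\<close> stay distinct after subtracting
    \<open>lab b\<close>, so the summands of \<open>F b\<close> do not interfere.\<close>
  have F: "Poly_Mapping.lookup (F b) (a - lab b) = (if a \<in> Z then w a b else 0)"
    if b: "b \<in> C (Suc i) a" for a b
  proof -
    have b': "b \<in> B (Suc i)" "exp_le (lab b) a" using b by (auto simp: C_def)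
    have "Poly_Mapping.lookup (F b) (a - lab b) =
        (\<Sum>a'\<in>{a' \<in> Z. exp_le (lab b) a'}. w a' b when a' - lab b = a - lab b)"
      using b' by (simp add: F_def lookup_sum lookup_single)
    also have "\<dots> = (\<Sum>a'\<in>{a' \<in> Z. exp_le (lab b) a'}. if a' = a then w a' b else 0)"
      using b' by (intro sum.cong refl) (auto simp: exp_diff_eq_iff when_def)
    also have "\<dots> = (if a \<in> Z then w a b else 0)" using finZ b' by (simp add: sum.delta)
    finally show ?thesis .
  qed
  have "f = free_map (B (Suc i)) (B i) (D i) F"
  proof
    fix c
    show "f c = free_map (B (Suc i)) (B i) (D i) F c"
    proof (cases "c \<in> B i")
      case False
      then show ?thesis using f by (simp add: free_mod_def free_map_def)
    next
      case True
      show ?thesis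
      proof (rule poly_eqI_strands[of "lab c"])
        fix a assume a: "exp_le (lab c) a"
        then have c: "c \<in> C i a" using True by (simp add: C_def)
        show "Poly_Mapping.lookup (f c) (a - lab c) =
            Poly_Mapping.lookup (free_map (B (Suc i)) (B i) (D i) F c) (a - lab c)"
        proof (cases "a \<in> Z")
          case True
          then show ?thesis unfolding lookup_free_map[OF c] w[OF c] by (intro sum.cong) (auto simp: F)
        next
          case False
          have "(a - lab c) + lab c = a" using exp_le_add_diff[OF a] by (simp add: add.commute)
          then have "a - lab c \<notin> Poly_Mapping.keys (f c)" using False True by (force simp: Z_def)
          then have "Poly_Mapping.lookup (f c) (a - lab c) = 0" by (simp add: in_keys_iff)
          then show ?thesis unfolding lookup_free_map[OF c] using False by (simp add: F)
        qed
      qed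
    qed
  qed
  then show ?thesis using F_mod by blast
qed

lemma multigraded_resolution:
  assumes kk: "\<And>i a b c. b \<in> C (Suc (Suc i)) a \<Longrightarrow> c \<in> C i a \<Longrightarrow>
      (\<Sum>x\<in>C (Suc i) a. \<kappa> (Suc i) b x * \<kappa> i x c) = 0"
    and k0: "\<And>a b. b \<in> C (Suc 0) a \<Longrightarrow> (\<Sum>c\<in>C 0 a. \<kappa> 0 b c) = 0"
    and exact: "\<And>i a z. (\<And>c. c \<in> C i a \<Longrightarrow> (\<Sum>b\<in>C (Suc i) a. z b * \<kappa> i b c) = 0) \<Longrightarrow>
      \<exists>w. \<forall>b\<in>C (Suc i) a. z b = (\<Sum>x\<in>C (Suc (Suc i)) a. w x * \<kappa> (Suc i) x b)"
    and exact0: "\<And>a z. (\<Sum>b\<in>C 0 a. z b) = 0 \<Longrightarrow>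
      \<exists>w. \<forall>b\<in>C 0 a. z b = (\<Sum>x\<in>C (Suc 0) a. w x * \<kappa> 0 x b)"
    and image: "aug_map (B 0) (\<lambda>b. mon (lab b)) ` free_mod X (B 0) = M"
  shows "free_resolution X B D (\<lambda>b. mon (lab b)) M"
  unfolding free_resolution_def
proof (intro conjI allI ballI)
  show "finite (B i)" for i by (rule fin_B)
  show "D i b c \<in> carrier (poly_ring X)" if "b \<in> B (Suc i)" for i b c
    using D_polys that by simp
  show "mon (lab b) \<in> carrier (poly_ring X)" if "b \<in> B 0" for b
    using lab_X that by simp
  show "aug_map (B 0) (\<lambda>b. mon (lab b)) ` free_mod X (B 0) = M" by (rule image)
  show "{f \<in> free_mod X (B 0). aug_map (B 0) (\<lambda>b. mon (lab b)) f = 0} =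
      free_map (B (Suc 0)) (B 0) (D 0) ` free_mod X (B (Suc 0))"
  proof (rule equalityI; rule subsetI)
    fix f :: "'b \<Rightarrow> ('x, 'k) mpol"
    assume f: "f \<in> {f \<in> free_mod X (B 0). aug_map (B 0) (\<lambda>b. mon (lab b)) f = 0}"
    then have "(\<Sum>b\<in>C 0 a. Poly_Mapping.lookup (f b) (a - lab b)) = 0" for a
      using lookup_aug_map[of f a] by simp
    then show "f \<in> free_map (B (Suc 0)) (B 0) (D 0) ` free_mod X (B (Suc 0))"
      using f by (intro strands_imp_image exact0) auto
  next
    fix f :: "'b \<Rightarrow> ('x, 'k) mpol"
    assume "f \<in> free_map (B (Suc 0)) (B 0) (D 0) ` free_mod X (B (Suc 0))"
    then obtain g where g: "g \<in> free_mod X (B (Suc 0))" "f = free_map (B (Suc 0)) (B 0) (D 0) g" by blast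
    have "aug_map (B 0) (\<lambda>b. mon (lab b)) f = 0"
    proof (rule poly_mapping_eqI)
      fix a
      have "Poly_Mapping.lookup (aug_map (B 0) (\<lambda>b. mon (lab b)) f) a =
          (\<Sum>c\<in>C 0 a. \<Sum>b\<in>C (Suc 0) a. Poly_Mapping.lookup (g b) (a - lab b) * \<kappa> 0 b c)"
        unfolding lookup_aug_map g by (intro sum.cong refl lookup_free_map)
      also have "\<dots> = (\<Sum>b\<in>C (Suc 0) a. \<Sum>c\<in>C 0 a. Poly_Mapping.lookup (g b) (a - lab b) * \<kappa> 0 b c)"
        by (rule sum.swap)
      also have "\<dots> = 0" by (simp add: k0 flip: sum_distrib_left)
      finally show "Poly_Mapping.lookup (aug_map (B 0) (\<lambda>b. mon (lab b)) f) a = Poly_Mapping.lookup 0 a"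
        by simp
    qed
    then show "f \<in> {f \<in> free_mod X (B 0). aug_map (B 0) (\<lambda>b. mon (lab b)) f = 0}"
      using g free_map_mem by blast
  qed
  fix i
  show "{f \<in> free_mod X (B (Suc i)). free_map (B (Suc i)) (B i) (D i) f = (\<lambda>_. 0)} =
      free_map (B (Suc (Suc i))) (B (Suc i)) (D (Suc i)) ` free_mod X (B (Suc (Suc i)))"
  proof (rule equalityI; rule subsetI)
    fix f :: "'b \<Rightarrow> ('x, 'k) mpol"
    assume f: "f \<in> {f \<in> free_mod X (B (Suc i)). free_map (B (Suc i)) (B i) (D i) f = (\<lambda>_. 0)}"
    then have "(\<Sum>b\<in>C (Suc i) a. Poly_Mapping.lookup (f b) (a - lab b) * \<kappa> i b c) = 0"
      if "c \<in> C i a" for a c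
      using lookup_free_map[OF that, of f] by simp
    then show "f \<in> free_map (B (Suc (Suc i))) (B (Suc i)) (D (Suc i)) ` free_mod X (B (Suc (Suc i)))"
      using f by (intro strands_imp_image exact) auto
  next
    fix f :: "'b \<Rightarrow> ('x, 'k) mpol"
    assume "f \<in> free_map (B (Suc (Suc i))) (B (Suc i)) (D (Suc i)) ` free_mod X (B (Suc (Suc i)))"
    then obtain g where g: "g \<in> free_mod X (B (Suc (Suc i)))"
      "f = free_map (B (Suc (Suc i))) (B (Suc i)) (D (Suc i)) g" by blast
    have "free_map (B (Suc i)) (B i) (D i) f c = 0" for c
    proof (cases "c \<in> B i")
      case True
      show ?thesis
      proof (rule poly_eqI_strands[of "lab c"])
        fix a assume "exp_le (lab c) a"
        then have c: "c \<in> C i a" using True by (simp add: C_def)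
        have "Poly_Mapping.lookup (free_map (B (Suc i)) (B i) (D i) f c) (a - lab c) =
            (\<Sum>b\<in>C (Suc i) a. (\<Sum>x\<in>C (Suc (Suc i)) a.
              Poly_Mapping.lookup (g x) (a - lab x) * \<kappa> (Suc i) x b) * \<kappa> i b c)"
          unfolding lookup_free_map[OF c] g by (intro sum.cong refl) (simp only: lookup_free_map)
        also have "\<dots> = (\<Sum>b\<in>C (Suc i) a. \<Sum>x\<in>C (Suc (Suc i)) a.
              Poly_Mapping.lookup (g x) (a - lab x) * (\<kappa> (Suc i) x b * \<kappa> i b c))"
          by (simp add: sum_distrib_right mult.assoc)
        also have "\<dots> = (\<Sum>x\<in>C (Suc (Suc i)) a. \<Sum>b\<in>C (Suc i) a.
              Poly_Mapping.lookup (g x) (a - lab x) * (\<kappa> (Suc i) x b * \<kappa> i b c))"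
          by (rule sum.swap)
        also have "\<dots> = 0" using c by (simp add: kk flip: sum_distrib_left)
        finally show "Poly_Mapping.lookup (free_map (B (Suc i)) (B i) (D i) f c) (a - lab c) =
            Poly_Mapping.lookup 0 (a - lab c)" by simp
      qed
    qed (simp add: free_map_def)
    then show "f \<in> {f \<in> free_mod X (B (Suc i)). free_map (B (Suc i)) (B i) (D i) f = (\<lambda>_. 0)}"
      using g free_map_mem by auto
  qed
qed

end

lemma (in labelling) LD_supports:
  assumes keys: "\<And>i. i \<in> {1..q} \<Longrightarrow> Poly_Mapping.keys (m i) \<subseteq> X"
  shows "LD_supports_free_resolution X q s ord V m
    (ideal_square X (genideal (poly_ring X) (mon ` m ` {1..q}) :: ('x, 'k::field) mpol set))"
proof -
  have cell_L2: "\<sigma> \<in> L2 q" if "\<sigma> \<in> LD_cells q s ord i" for \<sigma> i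
    using that by (auto simp: LD_cells_def morse_cells_def critical_faces_def)
  have label_keys: "Poly_Mapping.keys (label \<sigma>) \<subseteq> X" if "\<sigma> \<in> L2 q" for \<sigma>
  proof
    fix x assume "x \<in> Poly_Mapping.keys (label \<sigma>)"
    then have "0 < Poly_Mapping.lookup (lcm_exp (vertex_label m ` \<sigma>)) x"
      by (simp add: in_keys_iff face_label_def)
    then obtain v where v: "v \<in> \<sigma>" "0 < Poly_Mapping.lookup (vertex_label m v) x"
      using L2_finite_face[OF \<open>\<sigma> \<in> L2 q\<close>] by (auto simp: less_lookup_lcm_exp)
    then have "v \<in> vertices q" using L2_vertices that by blast
    then obtain i j where ij: "v = ee i j" "i \<in> {1..q}" "j \<in> {1..q}" by (rule vertices_E)
    then have "x \<in> Poly_Mapping.keys (m i) \<or> x \<in> Poly_Mapping.keys (m j)"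
      using v by (auto simp: vertex_label_ee lookup_add in_keys_iff)
    then show "x \<in> X" using keys ij by blast
  qed
  interpret mg: multigraded X "LD_cells q s ord" label "\<lambda>i \<tau> \<sigma>. inc \<tau> \<sigma> :: 'k"
  proof
    show "finite (LD_cells q s ord i)" for i by (rule finite_LD_cells)
    show "Poly_Mapping.keys (label b) \<subseteq> X" if "b \<in> LD_cells q s ord i" for b i
      using cell_L2[OF that] by (rule label_keys)
    show "exp_le (label c) (label b)"
      if "b \<in> LD_cells q s ord (Suc i)" "c \<in> LD_cells q s ord i" "inc b c \<noteq> (0 :: 'k)" for i b c
      using that cell_L2 by (intro inc_label) auto
  qed
  have C: "mg.C = cells" by (intro ext) (simp add: mg.C_def cells_def)
  have res: "free_resolution X (LD_cells q s ord) mg.D (\<lambda>\<sigma>. mon (label \<sigma>))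
      (ideal_square X (genideal (poly_ring X) (mon ` m ` {1..q}) :: ('x, 'k) mpol set))"
  proof (rule mg.multigraded_resolution; (unfold C)?)
    show "aug_map (LD_cells q s ord 0) (\<lambda>\<sigma>. mon (label \<sigma>)) ` free_mod X (LD_cells q s ord 0) =
        ideal_square X (genideal (poly_ring X) (mon ` m ` {1..q}) :: ('x, 'k) mpol set)"
      unfolding LD_cells_0[OF s] by (rule aug_image_ideal_square) (rule keys)
    show "\<exists>w. \<forall>b\<in>cells (Suc i) a. z b = (\<Sum>x\<in>cells (Suc (Suc i)) a. w x * inc x b)"
      if "\<And>c. c \<in> cells i a \<Longrightarrow> (\<Sum>b\<in>cells (Suc i) a. z b * inc b c) = 0"
      for i a and z :: "vertex set \<Rightarrow> 'k"
      using that by (rule cells_exact)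
    show "\<exists>w. \<forall>b\<in>cells 0 a. z b = (\<Sum>x\<in>cells (Suc 0) a. w x * inc x b)"
      if "(\<Sum>b\<in>cells 0 a. z b) = 0" for a and z :: "vertex set \<Rightarrow> 'k"
      using cells_exact_0[OF that] by simp
  qed (use inc_inc inc_0 in simp_all)
  have D: "mg.D = (\<lambda>i \<tau> \<sigma>. Poly_Mapping.single (label \<tau> - label \<sigma>) (inc \<tau> \<sigma>))"
    by (intro ext) (simp add: mg.D_def)
  show ?thesis
    unfolding LD_supports_free_resolution_def
    using res cell_L2 by (auto simp: D mon_dvd_iff intro!: inc_label)
qed

section \<open>The extremal ideal\<close>

lemma type_i_mem_NN:
  assumes "y \<in> L2 q" "j \<in> {1..q}" "\<And>k. k \<in> {2..s} \<Longrightarrow> ee k j \<in> y"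
  shows "\<exists>\<sigma>\<in>NN q s. \<sigma> \<subseteq> y"
proof (rule bexI)
  show "(\<lambda>k. ee k j) ` {2..s} \<subseteq> y" using assms by auto
  then show "(\<lambda>k. ee k j) ` {2..s} \<in> NN q s"
    using assms L2_subset unfolding NN_def type_i_def by blast
qed

lemma loop_star: "x \<in> L2 q \<Longrightarrow> ee i i \<in> x \<Longrightarrow> x \<subseteq> star q i"
proof -
  assume x: "x \<in> L2 q" "ee i i \<in> x"
  then have "\<not> x \<subseteq> off_diagonal q" by (auto simp: ee_in_off_diagonal)
  then obtain l where "x \<subseteq> star q l" using x unfolding L2_iff by blast
  moreover from this have "l = i" using x by (auto simp: ee_in_star)
  ultimately show ?thesis by simp
qed

text \<open>For \<open>C\<close> in \<open>QD\<close>, \<open>touches\<close> says that the variable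
  \<open>C\<close> divides the label of the face and \<open>covers\<close> that its square does; see
  \<open>extremal_label_touches\<close>.\<close>

definition touches :: "vertex set \<Rightarrow> nat set \<Rightarrow> bool" where
  "touches x C \<longleftrightarrow> (\<exists>i j. ee i j \<in> x \<and> i \<in> C)"

definition covers :: "vertex set \<Rightarrow> nat set \<Rightarrow> bool" where
  "covers x C \<longleftrightarrow> (\<exists>i j. ee i j \<in> x \<and> i \<in> C \<and> j \<in> C)"

definition plain_face :: "nat \<Rightarrow> nat \<Rightarrow> vertex set \<Rightarrow> bool" where
  "plain_face q s x \<longleftrightarrow> (\<forall>\<sigma>\<in>NN q s. \<not> \<sigma> \<subseteq> x)"

text \<open>The second alternative of \<open>critical_cases\<close>; the first is
  \<open>plain_face\<close>.\<close>

definition full_face :: "nat \<Rightarrow> nat \<Rightarrow> vertex set \<Rightarrow> bool" where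
  "full_face q s x \<longleftrightarrow> x \<subseteq> off_diagonal q \<and> (\<forall>k\<in>{2..s}. ee k 1 \<in> x) \<and>
     (\<forall>k\<in>{2..s}. \<forall>j>s. ee k j \<notin> x) \<and> (\<forall>u>s. \<forall>j>s. ee j u \<notin> x)"

text \<open>Every edge of \<open>x\<close> is detected in \<open>y\<close> by sets of
  \<open>QD\<close>. A set containing 1 is available only if it meets \<open>{2..s}\<close>, so the
  edges at 1 are the difficulty; the cure is to include some \<open>k\<close> in
  \<open>{2..s}\<close> at which the face to be tested has no interfering edge.\<close>

lemma critical_face_subset:
  assumes s: "3 \<le> s" "s \<le> q" and L2: "x \<in> L2 q" "y \<in> L2 q"
    and x: "plain_face q s x \<or> full_face q s x" and y: "plain_face q s y \<or> full_face q s y"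
    and t: "\<And>C. C \<in> QD q s \<Longrightarrow> touches x C \<longleftrightarrow> touches y C"
    and c: "\<And>C. C \<in> QD q s \<Longrightarrow> covers x C \<longleftrightarrow> covers y C"
  shows "x \<subseteq> y"
proof
  fix v assume v: "v \<in> x"
  have single_QD: "{i} \<in> QD q s" if "i \<in> {1..q}" "i \<noteq> 1" for i using that by (auto simp: QD_def)
  have pair_QD: "{1, k} \<in> QD q s" if "k \<in> {2..s}" for k using that s by (auto simp: QD_def)
  have touch_star: "ee i j \<in> z" if "touches z {j}" "z \<subseteq> star q i" "j \<noteq> i" for z i j
    using that by (auto simp: touches_def ee_in_star ee_commute[of i j] dest!: subsetD)
  have loop: "ee i i \<in> z \<longleftrightarrow> covers z {i}" for z i by (auto simp: covers_def)
  have loop_iff: "ee i i \<in> x \<longleftrightarrow> ee i i \<in> y" if "i \<in> {1..q}" "i \<noteq> 1" for i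
    unfolding loop using c single_QD that by blast
  have not_full: "plain_face q s z" if "ee i i \<in> z" "plain_face q s z \<or> full_face q s z" for z i
    using that by (auto simp: full_face_def ee_in_off_diagonal dest!: subsetD)
  have missing: "\<exists>k\<in>{2..s}. ee k j \<notin> z" if "plain_face q s z" "z \<in> L2 q" "j \<in> {1..q}" for z j
    using type_i_mem_NN[of z q j s] that unfolding plain_face_def by blast
  \<comment> \<open>\<open>{1}\<close> is not in \<open>QD\<close>. But \<open>z\<close> is plain,
    so it misses some \<open>ee k 1\<close> and does not touch \<open>{k}\<close>; then
    \<open>{1, k}\<close> plays the role of \<open>{1}\<close> for both faces.\<close>
  have loop_1: "ee 1 1 \<in> z'"
    if z: "ee 1 1 \<in> z" "z \<in> L2 q" "plain_face q s z \<or> full_face q s z"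
      and t: "\<And>C. C \<in> QD q s \<Longrightarrow> touches z C \<longleftrightarrow> touches z' C"
      and c: "\<And>C. C \<in> QD q s \<Longrightarrow> covers z C \<longleftrightarrow> covers z' C" for z z'
  proof -
    have "z \<subseteq> star q 1" using loop_star z by blast
    obtain k where k: "k \<in> {2..s}" "ee k 1 \<notin> z"
      using missing[of z 1] not_full[of 1 z] z s by auto
    then have "\<not> touches z {k}" using touch_star[of z k 1] \<open>z \<subseteq> star q 1\<close> by (auto simp: ee_commute)
    then have no: "\<not> touches z' {k}" using t single_QD[of k] k s by auto
    have "covers z {1, k}" using z by (auto simp: covers_def)
    then have "covers z' {1, k}" using c pair_QD k by blast
    then obtain a b where ab: "ee a b \<in> z'" "a \<in> {1, k}" "b \<in> {1, k}" by (auto simp: covers_def)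
    then have "ee b a \<in> z'" using ee_commute[of a b] by simp
    then have "a \<noteq> k" "b \<noteq> k" using no ab(1) unfolding touches_def by blast+
    then show ?thesis using ab by auto
  qed
  have "v \<in> vertices q" using v L2 L2_vertices by blast
  then obtain a b where ab: "v = ee a b" "a \<in> {1..q}" "b \<in> {1..q}" by (rule vertices_E)
  consider (loop) i where "i \<in> {1..q}" "i \<noteq> 1" "ee i i \<in> x" | (loop1) "ee 1 1 \<in> x"
    | (none) "\<And>i. i \<in> {1..q} \<Longrightarrow> ee i i \<notin> x" by metis
  then show "v \<in> y"
  proof cases
    case loop
    then have iy: "ee i i \<in> y" using loop_iff by blast
    have st: "x \<subseteq> star q i" "y \<subseteq> star q i" using loop_star L2 loop iy by blast+
    then have "v \<in> star q i" using v by blast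
    then obtain j where j: "v = ee i j" "j \<in> {1..q}" by (auto simp: star_def)
    consider "j = i" | "j \<noteq> i" "j \<noteq> 1" | "j = 1" by blast
    then show ?thesis
    proof cases
      case 1
      then show ?thesis using iy j by simp
    next
      case 2
      have "touches x {j}" using v j ee_commute[of i j] by (auto simp: touches_def)
      then have "touches y {j}" using t single_QD 2 j by blast
      then show ?thesis using touch_star st 2 j by blast
    next
      case 3
      \<comment> \<open>Again \<open>{1}\<close> is replaced by \<open>{1, k}\<close> with an
        untouched \<open>k\<close>.\<close>
      obtain k where k: "k \<in> {2..s}" "ee k i \<notin> x"
        using missing[of x i] not_full[OF loop(3) x] L2 loop by auto
      then have "k \<noteq> i" using loop by auto
      have kq: "k \<in> {1..q}" "k \<noteq> 1" using k s by auto
      have "\<not> touches x {k}"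
        using touch_star[of x k i] st k \<open>k \<noteq> i\<close> by (auto simp: ee_commute)
      then have no: "\<not> touches y {k}" using t single_QD kq by blast
      have "touches x {1, k}" using v j 3 ee_commute[of i j] by (auto simp: touches_def)
      then have "touches y {1, k}" using t pair_QD k by blast
      with no have "touches y {1}" by (auto simp: touches_def)
      then show ?thesis using touch_star st loop 3 j by auto
    qed
  next
    case loop1
    then have y1: "ee 1 1 \<in> y" using loop_1[of x y] L2 x t c by blast
    have st: "x \<subseteq> star q 1" "y \<subseteq> star q 1" using loop_star L2 loop1 y1 by blast+
    then have "v \<in> star q 1" using v by blast
    then obtain j where j: "v = ee 1 j" "j \<in> {1..q}" by (auto simp: star_def)
    show ?thesis
    proof (cases "j = 1")
      case False
      have "touches x {j}" using v j ee_commute[of 1 j] by (auto simp: touches_def)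
      then have "touches y {j}" using t single_QD False j by blast
      then show ?thesis using touch_star st False j by blast
    qed (use y1 j in simp)
  next
    case none
    have "ee 1 1 \<notin> y" using loop_1[of y x] L2 y t c none[of 1] s by auto
    then have noy: "ee i i \<notin> y" for i
      using none[of i] loop_iff[of i] L2_vertices[OF L2(2)] by (cases "i = 1") (auto simp: ee_in_vertices)
    have offy: "y \<subseteq> off_diagonal q"
    proof
      fix u assume u: "u \<in> y"
      then have "u \<in> vertices q" using L2 L2_vertices by blast
      then obtain i j where "u = ee i j" "i \<in> {1..q}" "j \<in> {1..q}" by (rule vertices_E)
      then show "u \<in> off_diagonal q" using u noy by (auto simp: ee_in_off_diagonal)
    qed
    have neq: "a \<noteq> b" using v ab none by auto
    show ?thesis
    proof (cases "{a, b} \<in> QD q s")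
      case True
      have "covers x {a, b}" using v ab by (auto simp: covers_def)
      \<comment> \<open>Without loops, an edge with both ends in \<open>{a, b}\<close> can only be
        \<open>ee a b\<close>.\<close>
      then have "covers y {a, b}" using c True by blast
      then obtain d e where "ee d e \<in> y" "d \<in> {a, b}" "e \<in> {a, b}" by (auto simp: covers_def)
      moreover have "d \<noteq> e" using noy calculation by auto
      ultimately show ?thesis using ab ee_commute[of a b] by auto
    next
      case False
      \<comment> \<open>The edges that two-element sets of \<open>QD\<close> cannot see are those
        from 1 to a vertex above \<open>s\<close>.\<close>
      then have "(a = 1 \<and> s < b) \<or> (b = 1 \<and> s < a)"
        using ab neq by (auto simp: QD_def)
      then have "\<exists>j. v = ee 1 j \<and> s < j \<and> j \<le> q"
      proof (elim disjE)
        assume "b = 1 \<and> s < a"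
        then show ?thesis using ab by (intro exI[of _ a]) (simp add: ee_commute)
      qed (use ab in auto)
      then obtain j where j: "v = ee 1 j" "s < j" "j \<le> q" by blast
      have jQ: "{j} \<in> QD q s" using j s by (intro single_QD) auto
      from y show ?thesis
      proof
        assume plain: "plain_face q s y"
        \<comment> \<open>Otherwise each \<open>k\<close> has an edge to 1 or to \<open>j\<close>.
          Neither 1 nor \<open>j\<close> alone serves all \<open>k\<close>, as that would be a face
          of type (i), so both occur and \<open>y\<close> contains a face of type (ii).\<close>
        have "\<exists>k\<in>{2..s}. ee k 1 \<notin> y \<and> ee k j \<notin> y"
        proof (rule ccontr)
          assume a: "\<not> ?thesis"
          define t where "t k = (if ee k 1 \<in> y then 1 else j)" for k
          obtain k where k: "k \<in> {2..s}" "ee k 1 \<notin> y" using missing[OF plain L2(2), of 1] s by auto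
          obtain k' where k': "k' \<in> {2..s}" "ee k' j \<notin> y" using missing[OF plain L2(2), of j] j s by auto
          have "t k = j" "t k' = 1" using k k' a by (auto simp: t_def)
          then have "{1, j} \<subseteq> t ` {2..s}"
            using imageI[OF k(1), of t] imageI[OF k'(1), of t] by simp
          moreover have "t ` {2..s} \<subseteq> {1, j}" by (auto simp: t_def)
          moreover have "ee i (t i) \<in> y" if "i \<in> {2..s}" for i using a that by (auto simp: t_def)
          ultimately have "\<exists>\<sigma>. \<sigma> \<in> NN q s \<and> type_ii q s \<sigma> j \<and> \<sigma> \<subseteq> y"
            using s j offy k by (intro type_ii_mem_NN[of s j q t]) auto
          then show False using plain by (auto simp: plain_face_def)
        qed
        then obtain k where k: "k \<in> {2..s}" "ee k 1 \<notin> y" "ee k j \<notin> y" by blast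
        have "{1, j, k} \<in> QD q s" using k j s by (auto simp: QD_def)
        moreover have "covers x {1, j, k}" using v j by (auto simp: covers_def)
        ultimately have "covers y {1, j, k}" using c by blast
        then obtain d e where "ee d e \<in> y" "d \<in> {1, j, k}" "e \<in> {1, j, k}" by (auto simp: covers_def)
        then show ?thesis using k noy j ee_commute[of 1 k] ee_commute[of j k] ee_commute[of 1 j] by auto
      next
        \<comment> \<open>In a full face all edges at a vertex above \<open>s\<close> go to 1, so
          touching \<open>{j}\<close> is enough.\<close>
        assume full: "full_face q s y"
        have "touches x {j}" using v j ee_commute[of 1 j] by (auto simp: touches_def)
        then have "touches y {j}" using t jQ by blast
        then obtain l where l: "ee j l \<in> y" by (auto simp: touches_def)
        then have "l \<in> {1..q}" using offy by (auto simp: ee_in_off_diagonal dest!: subsetD)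
        moreover have "l \<notin> {2..s}" "\<not> s < l"
          using full l j ee_commute[of j l] by (auto simp: full_face_def)
        ultimately have "l = 1" by auto
        then show ?thesis using l j ee_commute[of 1 j] by simp
      qed
    qed
  qed
qed

lemma finite_QD: "finite (QD q s)"
  by (rule finite_subset[of _ "Pow {1..q}"]) (auto simp: QD_def)

lemma lookup_extremal_gen:
  "Poly_Mapping.lookup (extremal_gen q s i) C = (if C \<in> QD q s \<and> i \<in> C then 1 else 0)"
  using finite_QD[of q s]
  by (simp add: extremal_gen_def lookup_sum lookup_single when_def sum.delta)

lemma keys_extremal_gen: "Poly_Mapping.keys (extremal_gen q s i) \<subseteq> extremal_vars q"
  by (auto simp: in_keys_iff lookup_extremal_gen extremal_vars_def QD_def subset_iff split: if_splits)

lemma extremal_labelling: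
  assumes "3 \<le> s" "s \<le> q" "admissible_order q s ord" "linear_order_on (vertices q) V"
  shows "labelling q s ord V (extremal_gen q s)"
  using assms by unfold_locales (auto simp: lookup_extremal_gen QD_def split: if_splits)

lemma extremal_label_touches:
  assumes "x \<in> L2 q" "C \<in> QD q s"
  shows "0 < Poly_Mapping.lookup (face_label (extremal_gen q s) x) C \<longleftrightarrow> touches x C"
    and "1 < Poly_Mapping.lookup (face_label (extremal_gen q s) x) C \<longleftrightarrow> covers x C"
proof -
  have fin: "finite (vertex_label (extremal_gen q s) ` x)" using L2_finite_face assms by blast
  have ee: "\<exists>i j. v = ee i j" if "v \<in> x" for v
    using that L2_vertices[OF assms(1)] by (blast elim: vertices_E)
  have val: "Poly_Mapping.lookup (vertex_label (extremal_gen q s) (ee i j)) C = of_bool (i \<in> C) + of_bool (j \<in> C)" for i j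
    using assms by (simp add: vertex_label_ee lookup_add lookup_extremal_gen)
  have ex: "(\<exists>v\<in>x. P v) \<longleftrightarrow> (\<exists>i j. ee i j \<in> x \<and> P (ee i j))" for P using ee by metis
  have "0 < Poly_Mapping.lookup (face_label (extremal_gen q s) x) C \<longleftrightarrow>
      (\<exists>i j. ee i j \<in> x \<and> (i \<in> C \<or> j \<in> C))"
    unfolding face_label_def less_lookup_lcm_exp[OF fin] by (auto simp: ex val)
  also have "\<dots> \<longleftrightarrow> touches x C" unfolding touches_def using ee_commute by metis
  finally show "0 < Poly_Mapping.lookup (face_label (extremal_gen q s) x) C \<longleftrightarrow> touches x C" .
  show "1 < Poly_Mapping.lookup (face_label (extremal_gen q s) x) C \<longleftrightarrow> covers x C"
    unfolding face_label_def less_lookup_lcm_exp[OF fin] covers_def by (auto simp: ex val)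
qed

lemma extremal_label_inj:
  assumes s: "3 \<le> s" "s \<le> q" and adm: "admissible_order q s ord"
    and x: "x \<in> critical_faces (L2 q) (matching q s ord)" "y \<in> critical_faces (L2 q) (matching q s ord)"
    and eq: "face_label (extremal_gen q s) x = face_label (extremal_gen q s) y"
  shows "x = y"
proof -
  have L2: "x \<in> L2 q" "y \<in> L2 q" using x by (auto simp: critical_faces_def)
  have faces: "plain_face q s z \<or> full_face q s z" if "z \<in> critical_faces (L2 q) (matching q s ord)" for z
    using s(1) adm that by (rule critical_cases) (auto simp: plain_face_def full_face_def)
  have "touches x C \<longleftrightarrow> touches y C" "covers x C \<longleftrightarrow> covers y C" if "C \<in> QD q s" for C
    using extremal_label_touches[OF L2(1) that] extremal_label_touches[OF L2(2) that] eq by auto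
  then show ?thesis
    using critical_face_subset[OF s L2] critical_face_subset[OF s L2(2,1)] faces x by blast
qed

section \<open>Homogeneity and minimality of the extremal resolution\<close>

lemma total_deg_superset:
  assumes "finite S" "Poly_Mapping.keys t \<subseteq> S"
  shows "total_deg t = (\<Sum>x\<in>S. Poly_Mapping.lookup t x)"
  unfolding total_deg_def using assms by (intro sum.mono_neutral_left) (auto simp: in_keys_iff)

lemma total_deg_add: "total_deg (t + u) = total_deg t + total_deg u"
proof -
  let ?S = "Poly_Mapping.keys t \<union> Poly_Mapping.keys u"
  have "Poly_Mapping.keys (t + u) \<subseteq> ?S" by (rule Poly_Mapping.keys_add)
  then show ?thesis
    by (simp add: total_deg_superset[of ?S] lookup_add sum.distrib)
qed

lemma extremal_minimal:
  fixes q s ord V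
  defines "X \<equiv> extremal_vars q" and "E2 \<equiv> ideal_square (extremal_vars q) (extremal_ideal q s :: (nat set, 'k::field) mpol set)"
    and "D \<equiv> \<lambda>i \<tau> \<sigma>. Poly_Mapping.single (face_label (extremal_gen q s) \<tau> - face_label (extremal_gen q s) \<sigma>)
                   (of_int (LD_incidence q s ord V \<tau> \<sigma>)) :: (nat set, 'k) mpol"
  assumes qs: "3 \<le> s" "s \<le> q" and adm: "admissible_order q s ord"
    and V: "linear_order_on (vertices q) V"
  shows "LD_supports_free_resolution X q s ord V (extremal_gen q s) E2"
    and "minimal_graded_free_resolution X (LD_cells q s ord) D (\<lambda>\<sigma>. mon (face_label (extremal_gen q s) \<sigma>)) E2"
proof -
  interpret labelling q s ord V "extremal_gen q s"
    by (rule extremal_labelling[OF qs adm V])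
  show sup: "LD_supports_free_resolution X q s ord V (extremal_gen q s) E2"
    unfolding X_def E2_def extremal_ideal_def by (rule LD_supports[OF keys_extremal_gen])
  have crit: "\<sigma> \<in> critical_faces (L2 q) (matching q s ord)" "\<sigma> \<in> L2 q" "card \<sigma> = Suc i"
    if "\<sigma> \<in> LD_cells q s ord i" for \<sigma> i
    using that by (auto simp: LD_cells_def morse_cells_def critical_faces_def)
  show "minimal_graded_free_resolution X (LD_cells q s ord) D (\<lambda>\<sigma>. mon (label \<sigma>)) E2"
    unfolding minimal_graded_free_resolution_def
  proof (intro conjI exI[of _ "\<lambda>_ \<sigma>. total_deg (label \<sigma>)"] allI ballI)
    show "free_resolution X (LD_cells q s ord) D (\<lambda>\<sigma>. mon (label \<sigma>)) E2"
      using sup by (simp add: LD_supports_free_resolution_def D_def)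
    show "total_deg t = total_deg (label b)" if "t \<in> Poly_Mapping.keys (mon (label b) :: (nat set, 'k) mpol)" for b t
      using that by (simp add: mon_def)
    fix i b c assume b: "b \<in> LD_cells q s ord (Suc i)" and c: "c \<in> LD_cells q s ord i"
    have le: "exp_le (label c) (label b)" if "(inc b c :: 'k) \<noteq> 0"
      using that crit[OF b] crit[OF c] by (intro inc_label) auto
    show "total_deg t + total_deg (label c) = total_deg (label b)" if t: "t \<in> Poly_Mapping.keys (D i b c)" for t
    proof -
      have "(inc b c :: 'k) \<noteq> 0" "t = label b - label c" using t by (auto simp: D_def split: if_splits)
      then have "label c + t = label b" using le exp_le_add_diff by blast
      then show ?thesis using total_deg_add[of "label c" t] by simp
    qed
    show "Poly_Mapping.lookup (D i b c) 0 = 0"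
    proof (rule ccontr)
      assume "Poly_Mapping.lookup (D i b c) 0 \<noteq> 0"
      then have "(inc b c :: 'k) \<noteq> 0" "label b - label c = 0"
        by (auto simp: D_def lookup_single when_def split: if_splits)
      then have "label b = label c" using le exp_le_add_diff[of "label c" "label b"] by simp
      then have "b = c" using extremal_label_inj[OF qs adm] crit[OF b] crit[OF c] by blast
      then show False using crit[OF b] crit[OF c] by simp
    qed
  qed
qed

section \<open>Uniqueness of Betti numbers\<close>

text \<open>Row \<open>b\<close> of a matrix is the image of the basis element \<open>b\<close>, so
  products are written in the order of application.\<close>

definition mat_mult :: "'b set \<Rightarrow> ('a \<Rightarrow> 'b \<Rightarrow> 'r::comm_ring_1) \<Rightarrow> ('b \<Rightarrow> 'c \<Rightarrow> 'r) \<Rightarrow> 'a \<Rightarrow> 'c \<Rightarrow> 'r" where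
  "mat_mult C P Q = (\<lambda>b e. \<Sum>c\<in>C. P b c * Q c e)"

lemma mat_mult_assoc: "mat_mult E (mat_mult C P Q) S = mat_mult C P (mat_mult E Q S)"
proof (intro ext)
  fix b e
  have "mat_mult E (mat_mult C P Q) S b e = (\<Sum>x\<in>E. \<Sum>c\<in>C. P b c * (Q c x * S x e))"
    by (simp add: mat_mult_def sum_distrib_right mult.assoc)
  also have "\<dots> = (\<Sum>c\<in>C. \<Sum>x\<in>E. P b c * (Q c x * S x e))" by (rule sum.swap)
  finally show "mat_mult E (mat_mult C P Q) S b e = mat_mult C P (mat_mult E Q S) b e"
    by (simp add: mat_mult_def sum_distrib_left)
qed

lemma mat_mult_cong:
  "(\<And>c. c \<in> C \<Longrightarrow> P b c = P' b c) \<Longrightarrow> (\<And>c. c \<in> C \<Longrightarrow> Q c e = Q' c e) \<Longrightarrow>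
    mat_mult C P Q b e = mat_mult C P' Q' b e"
  by (simp add: mat_mult_def)

lemma mat_mult_zero_left: "(\<And>c. c \<in> C \<Longrightarrow> P b c = 0) \<Longrightarrow> mat_mult C P Q b e = 0"
  by (simp add: mat_mult_def)

lemma mat_mult_zero_right: "(\<And>c. c \<in> C \<Longrightarrow> Q c e = 0) \<Longrightarrow> mat_mult C P Q b e = 0"
  by (simp add: mat_mult_def)

lemma mat_mult_diff_left:
  "mat_mult C (\<lambda>b c. P b c - P' b c) Q b e = mat_mult C P Q b e - mat_mult C P' Q b e"
  by (simp add: mat_mult_def left_diff_distrib sum_subtractf)

lemma mat_mult_diff_right:
  "mat_mult C P (\<lambda>c e. Q c e - Q' c e) b e = mat_mult C P Q b e - mat_mult C P Q' b e"
  by (simp add: mat_mult_def right_diff_distrib sum_subtractf)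

definition id_mat :: "'a \<Rightarrow> 'a \<Rightarrow> 'r::comm_ring_1" where
  "id_mat b c = (if b = c then 1 else 0)"

lemma mat_mult_id_right: "finite C \<Longrightarrow> e \<in> C \<Longrightarrow> mat_mult C P id_mat b e = P b e"
  by (simp add: mat_mult_def id_mat_def if_distrib[where f = "\<lambda>x. _ * x"] cong: if_cong)

lemma mat_mult_id_left: "finite C \<Longrightarrow> b \<in> C \<Longrightarrow> mat_mult C id_mat Q b e = Q b e"
  by (simp add: mat_mult_def id_mat_def if_distrib[where f = "\<lambda>x. x * _"] cong: if_cong)

lemma sum_fun_apply: "(\<Sum>a\<in>A. f a) x = (\<Sum>a\<in>A. f a x)"
  by (induction A rule: infinite_finite_induct) simp_all

text \<open>The rows of \<open>P\<close> are linearly independent, since multiplication by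
  \<open>Q\<close> sends them to unit vectors, and they lie in the span of at most
  \<open>card C\<close> unit vectors.\<close>

lemma card_le_if_left_inverse:
  fixes P :: "'a \<Rightarrow> 'b \<Rightarrow> 'k::field"
  assumes fin: "finite B" "finite C"
    and inv: "\<And>b b'. b \<in> B \<Longrightarrow> b' \<in> B \<Longrightarrow> mat_mult C P Q b b' = id_mat b b'"
  shows "card B \<le> card C"
proof -
  interpret vs: vector_space "\<lambda>(c :: 'k) (f :: 'b \<Rightarrow> 'k) x. c * f x"
    by unfold_locales (auto simp: algebra_simps)
  define v where "v b = (\<lambda>c. if c \<in> C then P b c else 0)" for b
  define e where "e c = (\<lambda>x. if x = c then 1 else 0 :: 'k)" for c :: 'b
  define \<phi> where "\<phi> f b' = (\<Sum>c\<in>C. f c * Q c b')" for f :: "'b \<Rightarrow> 'k" and b'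
  have \<phi>_v: "\<phi> (v b) b' = id_mat b b'" if "b \<in> B" "b' \<in> B" for b b'
    using inv[OF that] by (simp add: \<phi>_def v_def mat_mult_def)
  have inj: "inj_on v B"
  proof (rule inj_onI)
    fix b b' assume b: "b \<in> B" "b' \<in> B" "v b = v b'"
    then have "id_mat b b' = (id_mat b' b' :: 'k)" using \<phi>_v[of b b'] \<phi>_v[of b' b'] by simp
    then show "b = b'" by (simp add: id_mat_def split: if_splits)
  qed
  have "vs.independent (v ` B)"
  proof (rule vs.independent_if_scalars_zero)
    show "finite (v ` B)" using fin by simp
    fix u x assume sum0: "(\<Sum>x\<in>v ` B. (\<lambda>y. u x * x y)) = 0" and x: "x \<in> v ` B"
    then obtain b' where b': "b' \<in> B" "x = v b'" by blast
    have "(\<Sum>b\<in>B. u (v b) * v b c) = 0" for c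
    proof -
      have "(\<Sum>b\<in>B. (\<lambda>y. u (v b) * v b y)) = 0" using sum0 by (simp add: sum.reindex[OF inj])
      then have "(\<Sum>b\<in>B. (\<lambda>y. u (v b) * v b y)) c = 0" by simp
      then show ?thesis by (simp only: sum_fun_apply)
    qed
    then have "0 = (\<Sum>c\<in>C. (\<Sum>b\<in>B. u (v b) * v b c) * Q c b')" by simp
    also have "\<dots> = (\<Sum>c\<in>C. \<Sum>b\<in>B. u (v b) * (v b c * Q c b'))"
      by (simp add: sum_distrib_right mult.assoc)
    also have "\<dots> = (\<Sum>b\<in>B. \<Sum>c\<in>C. u (v b) * (v b c * Q c b'))" by (rule sum.swap)
    also have "\<dots> = (\<Sum>b\<in>B. u (v b) * \<phi> (v b) b')" by (simp add: \<phi>_def sum_distrib_left)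
    also have "\<dots> = (\<Sum>b\<in>B. if b = b' then u (v b) else 0)"
      using b' by (intro sum.cong) (auto simp: \<phi>_v id_mat_def)
    also have "\<dots> = u x" using fin b' by simp
    finally show "u x = 0" by simp
  qed
  moreover have "v ` B \<subseteq> vs.span (e ` C)"
  proof clarify
    fix b
    have "v b = (\<Sum>c\<in>C. (\<lambda>x. P b c * e c x))"
    proof
      fix x
      have "(\<Sum>c\<in>C. (\<lambda>x. P b c * e c x)) x = (\<Sum>c\<in>C. P b c * e c x)" by (simp only: sum_fun_apply)
      also have "\<dots> = v b x" using fin by (simp add: e_def v_def if_distrib[where f = "\<lambda>x. _ * x"] cong: if_cong)
      finally show "v b x = (\<Sum>c\<in>C. (\<lambda>x. P b c * e c x)) x" by simp
    qed
    also have "\<dots> \<in> vs.span (e ` C)"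
      by (intro vs.span_sum vs.span_scale vs.span_base) auto
    finally show "v b \<in> vs.span (e ` C)" .
  qed
  ultimately have "card (v ` B) \<le> card (e ` C)"
    using vs.independent_span_bound[of "e ` C" "v ` B"] fin by simp
  also have "\<dots> \<le> card C" using fin by (intro card_image_le)
  finally show ?thesis using card_image[OF inj] by simp
qed

text \<open>Exponents are natural numbers, so exponent 0 arises only from two constant terms. Taking
  constant terms is thus reduction modulo the variables.\<close>

lemma lookup_mult_0:
  "Poly_Mapping.lookup (p * r) 0 = Poly_Mapping.lookup p 0 * Poly_Mapping.lookup (r :: ('x, 'k::field) mpol) 0"
proof -
  have zero: "0 = l + u \<longleftrightarrow> l = 0 \<and> u = 0" for l u :: "'x \<Rightarrow>\<^sub>0 nat"
    by (auto simp: poly_mapping_eq_iff fun_eq_iff lookup_add)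
  have inner: "(\<Sum>u. Poly_Mapping.lookup r u when 0 = l + u) = (Poly_Mapping.lookup r 0 when l = 0)" for l
  proof -
    have "(\<lambda>u. Poly_Mapping.lookup r u when 0 = l + u) =
        (\<lambda>u. (Poly_Mapping.lookup r u when l = 0) when u = 0)"
      by (rule ext) (auto simp: zero when_def)
    then show ?thesis by (simp only: Sum_any_when_equal)
  qed
  have "(\<lambda>l. Poly_Mapping.lookup p l * (Poly_Mapping.lookup r 0 when l = 0)) =
      (\<lambda>l. (Poly_Mapping.lookup p l * Poly_Mapping.lookup r 0) when l = 0)"
    by (rule ext) (auto simp: when_def)
  then show ?thesis unfolding lookup_mult inner by (simp only: Sum_any_when_equal)
qed

lemma lookup_mat_mult_0:
  fixes P :: "'a \<Rightarrow> 'b \<Rightarrow> ('x, 'k::field) mpol"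
  shows "Poly_Mapping.lookup (mat_mult C P Q b e) 0 =
    mat_mult C (\<lambda>b c. Poly_Mapping.lookup (P b c) 0) (\<lambda>c e. Poly_Mapping.lookup (Q c e) 0) b e"
  by (simp add: mat_mult_def lookup_sum lookup_mult_0)

section \<open>Comparison maps and homotopies\<close>

definition poly_mat :: "'x set \<Rightarrow> 'b set \<Rightarrow> 'c set \<Rightarrow> ('b \<Rightarrow> 'c \<Rightarrow> ('x, 'k::field) mpol) \<Rightarrow> bool" where
  "poly_mat X B C P \<longleftrightarrow> (\<forall>b\<in>B. \<forall>c\<in>C. P b c \<in> polys X)"

lemma poly_mat_mult: "poly_mat X B C P \<Longrightarrow> poly_mat X C E Q \<Longrightarrow> poly_mat X B E (mat_mult C P Q)"
  by (auto simp: poly_mat_def mat_mult_def intro!: polys_sum)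

lemma poly_mat_diff: "poly_mat X B C P \<Longrightarrow> poly_mat X B C Q \<Longrightarrow> poly_mat X B C (\<lambda>b c. P b c - Q b c)"
  by (auto simp: poly_mat_def intro!: polys_diff)

lemma poly_mat_id: "poly_mat X B C id_mat"
  by (auto simp: poly_mat_def id_mat_def)

text \<open>\<open>lift\<close> is exactness for a whole family of rows indexed by \<open>S\<close>:
  a matrix killed by the differential factors through the next one. It begins at degree 1;
  surjectivity onto degree 0 is not part of it.\<close>

locale exact_complex =
  fixes X :: "'x set" and G :: "nat \<Rightarrow> 'b set" and d :: "nat \<Rightarrow> 'b \<Rightarrow> 'b \<Rightarrow> ('x, 'k::field) mpol"
  assumes finite_G: "finite (G i)"
    and d_mat: "poly_mat X (G (Suc i)) (G i) (d i)"
    and dd: "\<lbrakk>b \<in> G (Suc (Suc i)); c \<in> G i\<rbrakk> \<Longrightarrow> mat_mult (G (Suc i)) (d (Suc i)) (d i) b c = 0"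
    and lift: "\<lbrakk>poly_mat X (S :: 'b set) (G (Suc i)) Q;
        \<And>b c. b \<in> S \<Longrightarrow> c \<in> G i \<Longrightarrow> mat_mult (G (Suc i)) Q (d i) b c = 0\<rbrakk> \<Longrightarrow>
      \<exists>P. poly_mat X S (G (Suc (Suc i))) P \<and>
          (\<forall>b\<in>S. \<forall>c\<in>G (Suc i). mat_mult (G (Suc (Suc i))) P (d (Suc i)) b c = Q b c)"

text \<open>Degree 0 will be the ring itself, with the augmentation as differential into it, so the
  condition on \<open>f 0\<close> makes these maps lifts of the identity.\<close>

definition chain_map ::
    "'x set \<Rightarrow> (nat \<Rightarrow> 'b set) \<Rightarrow> (nat \<Rightarrow> 'b \<Rightarrow> 'b \<Rightarrow> ('x, 'k::field) mpol) \<Rightarrow>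
     (nat \<Rightarrow> 'b set) \<Rightarrow> (nat \<Rightarrow> 'b \<Rightarrow> 'b \<Rightarrow> ('x, 'k) mpol) \<Rightarrow> (nat \<Rightarrow> 'b \<Rightarrow> 'b \<Rightarrow> ('x, 'k) mpol) \<Rightarrow> bool" where
  "chain_map X G d G' d' f \<longleftrightarrow> f 0 = id_mat \<and> (\<forall>i. poly_mat X (G i) (G' i) (f i)) \<and>
     (\<forall>i. \<forall>b\<in>G (Suc i). \<forall>c\<in>G' i.
        mat_mult (G' (Suc i)) (f (Suc i)) (d' i) b c = mat_mult (G i) (d i) (f i) b c)"

lemma chain_map_exists:
  fixes d :: "nat \<Rightarrow> 'b \<Rightarrow> 'b \<Rightarrow> ('x, 'k::field) mpol"
  assumes "exact_complex X G d" "exact_complex X G' d'" and G0: "G 0 = G' 0"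
    and start: "\<exists>P. poly_mat X (G 1) (G' 1) P \<and>
       (\<forall>b\<in>G 1. \<forall>c\<in>G' 0. mat_mult (G' 1) P (d' 0) b c = d 0 b c)"
  shows "\<exists>f. chain_map X G d G' d' f"
proof -
  interpret G: exact_complex X G d by fact
  interpret G': exact_complex X G' d' by fact
  define R where "R i f g \<longleftrightarrow> poly_mat X (G (Suc i)) (G' (Suc i)) g \<and>
     (\<forall>b\<in>G (Suc i). \<forall>c\<in>G' i. mat_mult (G' (Suc i)) g (d' i) b c = mat_mult (G i) (d i) f b c)"
    for i and f g :: "'b \<Rightarrow> 'b \<Rightarrow> ('x, 'k) mpol"
  \<comment> \<open>The existence of a next map is carried along: at 0 it is supplied by
    \<open>start\<close>, later by \<open>lift\<close>, which needs to know that the current map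
    already commutes with the differentials.\<close>
  define P where "P i f \<longleftrightarrow> poly_mat X (G i) (G' i) f \<and> (i = 0 \<longrightarrow> f = id_mat) \<and> (\<exists>g. R i f g)"
    for i and f :: "'b \<Rightarrow> 'b \<Rightarrow> ('x, 'k) mpol"
  have "\<exists>f. \<forall>n. P n (f n) \<and> R n (f n) (f (Suc n))"
  proof (rule dependent_nat_choice)
    have "mat_mult (G 0) (d 0) id_mat b c = d 0 b c" if "c \<in> G' 0" for b c
      using that G0 G.finite_G[of 0] by (intro mat_mult_id_right) auto
    then show "\<exists>f. P 0 f"
      using start by (auto simp: P_def R_def poly_mat_id)
    fix f n assume "P n f"
    then obtain g where g: "R n f g" by (auto simp: P_def)
    have "\<exists>h. R (Suc n) g h"
      unfolding R_def
    proof (rule G'.lift)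
      show "poly_mat X (G (Suc (Suc n))) (G' (Suc n)) (mat_mult (G (Suc n)) (d (Suc n)) g)"
        using G.d_mat g by (auto simp: R_def intro!: poly_mat_mult)
      fix b c assume bc: "b \<in> G (Suc (Suc n))" "c \<in> G' n"
      have "mat_mult (G' (Suc n)) (mat_mult (G (Suc n)) (d (Suc n)) g) (d' n) b c =
          mat_mult (G (Suc n)) (d (Suc n)) (mat_mult (G' (Suc n)) g (d' n)) b c"
        by (simp only: mat_mult_assoc)
      also have "\<dots> = mat_mult (G (Suc n)) (d (Suc n)) (mat_mult (G n) (d n) f) b c"
        using g bc by (intro mat_mult_cong) (auto simp: R_def)
      also have "\<dots> = mat_mult (G n) (mat_mult (G (Suc n)) (d (Suc n)) (d n)) f b c"
        by (simp only: mat_mult_assoc)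
      also have "\<dots> = 0" by (rule mat_mult_zero_left) (rule G.dd[OF bc(1)])
      finally show "mat_mult (G' (Suc n)) (mat_mult (G (Suc n)) (d (Suc n)) g) (d' n) b c = 0" .
    qed
    then show "\<exists>g. P (Suc n) g \<and> R n f g" using g by (auto simp: P_def R_def)
  qed
  then obtain f where f: "\<And>n. P n (f n)" "\<And>n. R n (f n) (f (Suc n))" by blast
  have "chain_map X G d G' d' f"
    unfolding chain_map_def using f(1)[unfolded P_def] f(2)[unfolded R_def] by simp
  then show ?thesis by (intro exI[of _ f])
qed

text \<open>A chain endomorphism over the identity is homotopic to the identity. The homotopy starts
  with \<open>0\<close>, so no assumption on the constant terms of \<open>d 0\<close> is needed.\<close>

lemma chain_endo_constant_term:
  fixes d :: "nat \<Rightarrow> 'b \<Rightarrow> 'b \<Rightarrow> ('x, 'k::field) mpol"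
  assumes "exact_complex X G d" and \<phi>: "chain_map X G d G d \<phi>"
    and minimal: "\<And>i b c. b \<in> G (Suc (Suc i)) \<Longrightarrow> c \<in> G (Suc i) \<Longrightarrow> Poly_Mapping.lookup (d (Suc i) b c) 0 = 0"
    and b: "b \<in> G (Suc i)" "c \<in> G (Suc i)"
  shows "Poly_Mapping.lookup (\<phi> (Suc i) b c) 0 = id_mat b c"
proof -
  interpret exact_complex X G d by fact
  define \<psi> where "\<psi> i = (\<lambda>b c. \<phi> i b c - id_mat b c)" for i
  have \<psi>_mat: "poly_mat X (G i) (G i) (\<psi> i)" for i
    using \<phi> unfolding \<psi>_def by (intro poly_mat_diff poly_mat_id) (simp add: chain_map_def)
  have \<psi>: "mat_mult (G (Suc i)) (\<psi> (Suc i)) (d i) b c = mat_mult (G i) (d i) (\<psi> i) b c"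
    if "b \<in> G (Suc i)" "c \<in> G i" for i b c
    using that \<phi> finite_G
    by (simp add: \<psi>_def mat_mult_diff_left mat_mult_diff_right mat_mult_id_left mat_mult_id_right chain_map_def)
  have \<psi>0: "\<psi> 0 = (\<lambda>_ _. 0)" using \<phi> by (auto simp: \<psi>_def chain_map_def)
  \<comment> \<open>The last conjunct says that \<open>\<psi> (Suc i)\<close> minus the product of
    \<open>d i\<close> and \<open>h\<close> is killed by \<open>d i\<close>, the condition under
    which \<open>lift\<close> gives the next component of the homotopy.\<close>
  define P where "P i h \<longleftrightarrow> poly_mat X (G i) (G (Suc i)) h \<and> (i = 0 \<longrightarrow> h = (\<lambda>_ _. 0)) \<and>
      (\<forall>b\<in>G (Suc i). \<forall>c\<in>G i. mat_mult (G i) (d i) (\<lambda>x y. \<psi> i x y - mat_mult (G (Suc i)) h (d i) x y) b c = 0)"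
    for i and h :: "'b \<Rightarrow> 'b \<Rightarrow> ('x, 'k) mpol"
  define R where "R i h h' \<longleftrightarrow> (\<forall>b\<in>G (Suc i). \<forall>c\<in>G (Suc i).
      mat_mult (G (Suc (Suc i))) h' (d (Suc i)) b c = \<psi> (Suc i) b c - mat_mult (G i) (d i) h b c)"
    for i and h h' :: "'b \<Rightarrow> 'b \<Rightarrow> ('x, 'k) mpol"
  have "\<exists>h. \<forall>n. P n (h n) \<and> R n (h n) (h (Suc n))"
  proof (rule dependent_nat_choice)
    show "\<exists>h. P 0 h"
      by (intro exI[of _ "\<lambda>_ _. 0"]) (auto simp: P_def poly_mat_def \<psi>0 mat_mult_def)
    fix h n assume h: "P n h"
    have "\<exists>h'. poly_mat X (G (Suc n)) (G (Suc (Suc n))) h' \<and> R n h h'"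
      unfolding R_def
    proof (rule lift)
      show "poly_mat X (G (Suc n)) (G (Suc n)) (\<lambda>b c. \<psi> (Suc n) b c - mat_mult (G n) (d n) h b c)"
        using h d_mat \<psi>_mat by (intro poly_mat_diff poly_mat_mult) (auto simp: P_def)
      fix b c assume bc: "b \<in> G (Suc n)" "c \<in> G n"
      have "mat_mult (G (Suc n)) (\<lambda>b c. \<psi> (Suc n) b c - mat_mult (G n) (d n) h b c) (d n) b c =
          mat_mult (G n) (d n) (\<psi> n) b c - mat_mult (G n) (d n) (mat_mult (G (Suc n)) h (d n)) b c"
        using \<psi>[OF bc] by (simp add: mat_mult_diff_left mat_mult_assoc)
      also have "\<dots> = 0" using h bc by (simp add: P_def mat_mult_diff_right)
      finally show "mat_mult (G (Suc n)) (\<lambda>b c. \<psi> (Suc n) b c - mat_mult (G n) (d n) h b c) (d n) b c = 0" .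
    qed
    then obtain h' where h': "poly_mat X (G (Suc n)) (G (Suc (Suc n))) h'" "R n h h'" by blast
    have "mat_mult (G (Suc n)) (d (Suc n)) (\<lambda>x y. \<psi> (Suc n) x y - mat_mult (G (Suc (Suc n))) h' (d (Suc n)) x y) b c = 0"
      if bc: "b \<in> G (Suc (Suc n))" "c \<in> G (Suc n)" for b c
    proof -
      have "mat_mult (G (Suc n)) (d (Suc n)) (\<lambda>x y. \<psi> (Suc n) x y - mat_mult (G (Suc (Suc n))) h' (d (Suc n)) x y) b c =
          mat_mult (G (Suc n)) (d (Suc n)) (mat_mult (G n) (d n) h) b c"
        using h'(2) bc by (intro mat_mult_cong) (auto simp: R_def)
      also have "\<dots> = mat_mult (G n) (mat_mult (G (Suc n)) (d (Suc n)) (d n)) h b c"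
        by (simp only: mat_mult_assoc)
      also have "\<dots> = 0" by (rule mat_mult_zero_left) (rule dd[OF bc(1)])
      finally show ?thesis .
    qed
    then show "\<exists>h'. P (Suc n) h' \<and> R n h h'" using h' by (auto simp: P_def)
  qed
  then obtain h where h: "\<And>n. P n (h n)" "\<And>n. R n (h n) (h (Suc n))" by blast
  \<comment> \<open>Each of the two homotopy terms contains a differential with constant term 0; for
    \<open>i = 0\<close> the second vanishes through \<open>h 0\<close> instead.\<close>
  have "Poly_Mapping.lookup (\<psi> (Suc i) b c) 0 =
      Poly_Mapping.lookup (mat_mult (G (Suc (Suc i))) (h (Suc i)) (d (Suc i)) b c + mat_mult (G i) (d i) (h i) b c) 0"
    using h(2)[of i] b by (simp add: R_def)
  also have "\<dots> = 0"
  proof -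
    have "Poly_Mapping.lookup (mat_mult (G (Suc (Suc i))) (h (Suc i)) (d (Suc i)) b c) 0 = 0"
      unfolding lookup_mat_mult_0 using minimal b by (intro mat_mult_zero_right)
    moreover have "Poly_Mapping.lookup (mat_mult (G i) (d i) (h i) b c) 0 = 0"
    proof (cases i)
      case 0
      then show ?thesis using h(1)[of 0] by (simp add: P_def mat_mult_def)
    next
      case (Suc j)
      then show ?thesis unfolding lookup_mat_mult_0 using minimal b by (intro mat_mult_zero_left) auto
    qed
    ultimately show ?thesis by (simp add: lookup_add)
  qed
  finally show ?thesis by (simp add: \<psi>_def lookup_minus id_mat_def lookup_one split: if_splits)
qed

text \<open>Degree 0 is set separately because a product of identity matrices over
  \<open>G' 0\<close> agrees with \<open>id_mat\<close> only on \<open>G' 0\<close>, while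
  \<open>chain_map\<close> asks for \<open>id_mat\<close> itself.\<close>

lemma chain_map_comp:
  assumes "chain_map X G d G' d' f" "chain_map X G' d' G d g" "finite (G' 0)" "G 0 = G' 0"
  shows "chain_map X G d G d (\<lambda>i. if i = 0 then id_mat else mat_mult (G' i) (f i) (g i))"
proof -
  let ?\<phi> = "\<lambda>i. if i = 0 then id_mat else mat_mult (G' i) (f i) (g i)"
  have mats: "poly_mat X (G i) (G' i) (f i)" "poly_mat X (G' i) (G i) (g i)" for i
    using assms by (auto simp: chain_map_def)
  have f: "mat_mult (G' (Suc i)) (f (Suc i)) (d' i) b c = mat_mult (G i) (d i) (f i) b c"
    if "b \<in> G (Suc i)" "c \<in> G' i" for i b c using assms(1) that by (simp add: chain_map_def)
  have g: "mat_mult (G (Suc i)) (g (Suc i)) (d i) b c = mat_mult (G' i) (d' i) (g i) b c"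
    if "b \<in> G' (Suc i)" "c \<in> G i" for i b c using assms(2) that by (simp add: chain_map_def)
  have f0: "f 0 = id_mat" "g 0 = id_mat" using assms by (auto simp: chain_map_def)
  have main: "mat_mult (G (Suc i)) (mat_mult (G' (Suc i)) (f (Suc i)) (g (Suc i))) (d i) b c =
      mat_mult (G i) (d i) (mat_mult (G' i) (f i) (g i)) b c" if bc: "b \<in> G (Suc i)" "c \<in> G i" for i b c
  proof -
    have "mat_mult (G (Suc i)) (mat_mult (G' (Suc i)) (f (Suc i)) (g (Suc i))) (d i) b c =
        mat_mult (G' (Suc i)) (f (Suc i)) (mat_mult (G (Suc i)) (g (Suc i)) (d i)) b c"
      by (simp only: mat_mult_assoc)
    also have "\<dots> = mat_mult (G' (Suc i)) (f (Suc i)) (mat_mult (G' i) (d' i) (g i)) b c"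
      using g bc by (intro mat_mult_cong) auto
    also have "\<dots> = mat_mult (G' i) (mat_mult (G' (Suc i)) (f (Suc i)) (d' i)) (g i) b c"
      by (simp only: mat_mult_assoc)
    also have "\<dots> = mat_mult (G' i) (mat_mult (G i) (d i) (f i)) (g i) b c"
      using f bc by (intro mat_mult_cong) auto
    finally show ?thesis by (simp only: mat_mult_assoc)
  qed
  have "mat_mult (G 0) (d 0) (mat_mult (G' 0) (f 0) (g 0)) b c = mat_mult (G 0) (d 0) id_mat b c"
    if "c \<in> G 0" for b c
    using that assms(3,4) by (intro mat_mult_cong) (auto simp: f0 mat_mult_id_left)
  then have "mat_mult (G (Suc i)) (?\<phi> (Suc i)) (d i) b c = mat_mult (G i) (d i) (?\<phi> i) b c"
    if "b \<in> G (Suc i)" "c \<in> G i" for i b c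
    using main[OF that] that by (cases i) auto
  then show ?thesis
    unfolding chain_map_def using mats by (auto simp: poly_mat_id intro!: poly_mat_mult)
qed

text \<open>The augmentation is treated as the differential into a free module of rank 1 in degree 0, so
  degrees are shifted by 1.\<close>

definition aug_basis :: "(nat \<Rightarrow> nat set) \<Rightarrow> nat \<Rightarrow> nat set" where
  "aug_basis B i = (case i of 0 \<Rightarrow> {0} | Suc j \<Rightarrow> B j)"

definition aug_diff ::
    "(nat \<Rightarrow> nat \<Rightarrow> nat \<Rightarrow> ('x, 'k::field) mpol) \<Rightarrow> (nat \<Rightarrow> ('x, 'k) mpol) \<Rightarrow> nat \<Rightarrow> nat \<Rightarrow> nat \<Rightarrow> ('x, 'k) mpol" where
  "aug_diff D \<epsilon> i = (case i of 0 \<Rightarrow> (\<lambda>b c. \<epsilon> b) | Suc j \<Rightarrow> D j)"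

lemma aug_simps [simp]:
  "aug_basis B 0 = {0}" "aug_basis B (Suc i) = B i"
  "aug_diff D \<epsilon> 0 = (\<lambda>b c. \<epsilon> b)" "aug_diff D \<epsilon> (Suc i) = D i"
  by (simp_all add: aug_basis_def aug_diff_def)

text \<open>Cut off outside \<open>C\<close>, where members of \<open>free_mod\<close> have to
  vanish.\<close>

definition row :: "'c set \<Rightarrow> ('b \<Rightarrow> 'c \<Rightarrow> ('x, 'k::field) mpol) \<Rightarrow> 'b \<Rightarrow> 'c \<Rightarrow> ('x, 'k) mpol" where
  "row C Q b = (\<lambda>c. if c \<in> C then Q b c else 0)"

lemma row_mem: "poly_mat X S C Q \<Longrightarrow> b \<in> S \<Longrightarrow> row C Q b \<in> free_mod X C"
  by (auto simp: row_def free_mod_def poly_mat_def)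

lemma free_map_row: "free_map C E D (row C Q b) = (\<lambda>e. if e \<in> E then mat_mult C Q D b e else 0)"
  by (auto simp: free_map_def row_def mat_mult_def fun_eq_iff intro!: sum.cong)

lemma aug_map_row: "aug_map C \<epsilon> (row C Q b) = mat_mult C Q (\<lambda>c _. \<epsilon> c) b e"
  by (auto simp: aug_map_def row_def mat_mult_def intro!: sum.cong)

lemma image_lift:
  assumes "\<And>b. b \<in> S \<Longrightarrow> row E Q b \<in> free_map C E D ` free_mod X C"
  shows "\<exists>P. poly_mat X S C P \<and> (\<forall>b\<in>S. \<forall>e\<in>E. mat_mult C P D b e = Q b e)"
proof -
  have "\<forall>b\<in>S. \<exists>p. p \<in> free_mod X C \<and> row E Q b = free_map C E D p"
    using assms by (simp add: image_iff Bex_def)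
  from bchoice[OF this] obtain P
    where P: "\<forall>b\<in>S. P b \<in> free_mod X C \<and> row E Q b = free_map C E D (P b)" ..
  show ?thesis
  proof (intro exI[of _ P] conjI ballI)
    show "poly_mat X S C P" using P by (auto simp: poly_mat_def free_mod_def)
    fix b e assume "b \<in> S" "e \<in> E"
    then have "row E Q b e = free_map C E D (P b) e" using P by simp
    then show "mat_mult C P D b e = Q b e"
      using \<open>e \<in> E\<close> by (simp add: row_def free_map_def mat_mult_def)
  qed
qed

text \<open>Exactness for vectors passes to matrices row by row. That consecutive differentials
  compose to 0 follows since the image of a unit vector lies in the next kernel.\<close>

lemma free_resolution_exact_complex:
  assumes res: "free_resolution X B D \<epsilon> M"
  shows "exact_complex X (aug_basis B) (aug_diff D \<epsilon>)"
proof
  have fin: "\<And>i. finite (B i)" and D: "\<And>i b c. b \<in> B (Suc i) \<Longrightarrow> c \<in> B i \<Longrightarrow> D i b c \<in> polys X"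
    and \<epsilon>: "\<And>b. b \<in> B 0 \<Longrightarrow> \<epsilon> b \<in> polys X"
    and ker0: "{f \<in> free_mod X (B 0). aug_map (B 0) \<epsilon> f = 0}
       = free_map (B (Suc 0)) (B 0) (D 0) ` free_mod X (B (Suc 0))"
    and ker: "\<And>i. {f \<in> free_mod X (B (Suc i)). free_map (B (Suc i)) (B i) (D i) f = (\<lambda>_. 0)}
       = free_map (B (Suc (Suc i))) (B (Suc i)) (D (Suc i)) ` free_mod X (B (Suc (Suc i)))"
    using res by (simp_all add: free_resolution_def)
  show "finite (aug_basis B i)" for i using fin by (cases i) auto
  show d: "poly_mat X (aug_basis B (Suc i)) (aug_basis B i) (aug_diff D \<epsilon> i)" for i
    using D \<epsilon> by (cases i) (auto simp: poly_mat_def)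
  have unit: "row (B i) id_mat b \<in> free_mod X (B i)" if "b \<in> B i" for i b
    using row_mem[OF poly_mat_id that] .
  have unit_image: "row (B i) (D i) b \<in> free_map (B (Suc i)) (B i) (D i) ` free_mod X (B (Suc i))"
    if "b \<in> B (Suc i)" for i b
  proof (rule image_eqI[OF _ unit[OF that]])
    show "row (B i) (D i) b = free_map (B (Suc i)) (B i) (D i) (row (B (Suc i)) id_mat b)"
      unfolding free_map_row using that fin by (simp add: mat_mult_id_left row_def cong: if_cong)
  qed
  show "mat_mult (aug_basis B (Suc i)) (aug_diff D \<epsilon> (Suc i)) (aug_diff D \<epsilon> i) b c = 0"
    if bc: "b \<in> aug_basis B (Suc (Suc i))" "c \<in> aug_basis B i" for i b c
  proof (cases i)
    case 0
    then have "row (B 0) (D 0) b \<in> {f \<in> free_mod X (B 0). aug_map (B 0) \<epsilon> f = 0}"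
      unfolding ker0 using unit_image[of b 0] bc by simp
    then have "aug_map (B 0) \<epsilon> (row (B 0) (D 0) b) = 0" by simp
    then show ?thesis using 0 aug_map_row[of "B 0" \<epsilon> "D 0" b c] by simp
  next
    case (Suc j)
    then have "row (B (Suc j)) (D (Suc j)) b \<in>
        {f \<in> free_mod X (B (Suc j)). free_map (B (Suc j)) (B j) (D j) f = (\<lambda>_. 0)}"
      unfolding ker using unit_image[of b "Suc j"] bc by simp
    then have "free_map (B (Suc j)) (B j) (D j) (row (B (Suc j)) (D (Suc j)) b) c = 0" by simp
    then show ?thesis using Suc bc by (simp add: free_map_row)
  qed
  show "\<exists>P. poly_mat X S (aug_basis B (Suc (Suc i))) P \<and>
      (\<forall>b\<in>S. \<forall>c\<in>aug_basis B (Suc i). mat_mult (aug_basis B (Suc (Suc i))) P (aug_diff D \<epsilon> (Suc i)) b c = Q b c)"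
    if Q: "poly_mat X S (aug_basis B (Suc i)) Q"
      and z: "\<And>b c. b \<in> S \<Longrightarrow> c \<in> aug_basis B i \<Longrightarrow> mat_mult (aug_basis B (Suc i)) Q (aug_diff D \<epsilon> i) b c = 0"
    for S :: "nat set" and i Q
  proof -
    have "row (B i) Q b \<in> free_map (B (Suc i)) (B i) (D i) ` free_mod X (B (Suc i))" if b: "b \<in> S" for b
    proof (cases i)
      case 0
      have "aug_map (B 0) \<epsilon> (row (B 0) Q b) = 0" using aug_map_row[of "B 0" \<epsilon> Q b "0 :: nat"] z[OF b, of 0] 0 by simp
      then show ?thesis unfolding 0 ker0[symmetric] using row_mem[of X S "B 0" Q b] Q b 0 by simp
    next
      case (Suc j)
      have "free_map (B (Suc j)) (B j) (D j) (row (B (Suc j)) Q b) = (\<lambda>_. 0)"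
        using z[OF b] Suc by (simp add: free_map_row fun_eq_iff)
      then show ?thesis unfolding Suc ker[symmetric] using row_mem[of X S "B (Suc j)" Q b] Q b Suc by simp
    qed
    then show ?thesis unfolding aug_simps by (rule image_lift)
  qed
qed

text \<open>Both augmentations have image \<open>M\<close>, so the generators of one are
  combinations of those of the other.\<close>

lemma free_resolution_start:
  assumes res: "free_resolution X B D \<epsilon> M" and res': "free_resolution X B' D' \<epsilon>' M"
  shows "\<exists>P. poly_mat X (aug_basis B 1) (aug_basis B' 1) P \<and>
       (\<forall>b\<in>aug_basis B 1. \<forall>c\<in>aug_basis B' 0. mat_mult (aug_basis B' 1) P (aug_diff D' \<epsilon>' 0) b c = aug_diff D \<epsilon> 0 b c)"
proof -
  have fin: "finite (B 0)" using res by (simp add: free_resolution_def)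
  have "\<exists>p\<in>free_mod X (B' 0). aug_map (B' 0) \<epsilon>' p = \<epsilon> b" if b: "b \<in> B 0" for b
  proof -
    have "aug_map (B 0) \<epsilon> (row (B 0) id_mat b) = \<epsilon> b"
      using mat_mult_id_left[OF fin b, of "\<lambda>c _. \<epsilon> c"] aug_map_row by metis
    moreover have "row (B 0) id_mat b \<in> free_mod X (B 0)" using row_mem[OF poly_mat_id b] .
    ultimately have "\<epsilon> b \<in> aug_map (B 0) \<epsilon> ` free_mod X (B 0)" by (metis image_eqI)
    also have "\<dots> = aug_map (B' 0) \<epsilon>' ` free_mod X (B' 0)"
      using res res' by (simp add: free_resolution_def)
    finally show ?thesis by auto
  qed
  then have "\<forall>b\<in>B 0. \<exists>p. p \<in> free_mod X (B' 0) \<and> aug_map (B' 0) \<epsilon>' p = \<epsilon> b" by blast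
  from bchoice[OF this] obtain P
    where "\<forall>b\<in>B 0. P b \<in> free_mod X (B' 0) \<and> aug_map (B' 0) \<epsilon>' (P b) = \<epsilon> b" ..
  then show ?thesis
    by (intro exI[of _ P]) (auto simp: poly_mat_def free_mod_def aug_map_def mat_mult_def)
qed

text \<open>The two comparison maps compose to a lift of the identity, which modulo the variables is
  the identity; so their constant terms are matrices with product 1. By symmetry of the hypotheses
  the reverse inequality follows as well.\<close>

lemma minimal_resolution_card_le:
  fixes D D' :: "nat \<Rightarrow> nat \<Rightarrow> nat \<Rightarrow> ('x, 'k::field) mpol"
  assumes res: "minimal_graded_free_resolution X B D \<epsilon> M" and res': "minimal_graded_free_resolution X B' D' \<epsilon>' M"
  shows "card (B i) \<le> card (B' i)"
proof -
  have fr: "free_resolution X B D \<epsilon> M" "free_resolution X B' D' \<epsilon>' M"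
    using res res' by (auto simp: minimal_graded_free_resolution_def)
  note ex = free_resolution_exact_complex[OF fr(1)] free_resolution_exact_complex[OF fr(2)]
  obtain f where f: "chain_map X (aug_basis B) (aug_diff D \<epsilon>) (aug_basis B') (aug_diff D' \<epsilon>') f"
    using chain_map_exists[OF ex _ free_resolution_start[OF fr]] by auto
  obtain g where g: "chain_map X (aug_basis B') (aug_diff D' \<epsilon>') (aug_basis B) (aug_diff D \<epsilon>) g"
    using chain_map_exists[OF ex(2,1) _ free_resolution_start[OF fr(2,1)]] by auto
  have \<phi>: "chain_map X (aug_basis B) (aug_diff D \<epsilon>) (aug_basis B) (aug_diff D \<epsilon>)
      (\<lambda>i. if i = 0 then id_mat else mat_mult (aug_basis B' i) (f i) (g i))"
    using chain_map_comp[OF f g] by simp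
  show ?thesis
  proof (rule card_le_if_left_inverse)
    show "finite (B i)" "finite (B' i)" using fr by (auto simp: free_resolution_def)
    fix b b' assume "b \<in> B i" "b' \<in> B i"
    then have "Poly_Mapping.lookup (mat_mult (B' i) (f (Suc i)) (g (Suc i)) b b') 0 = id_mat b b'"
      using chain_endo_constant_term[OF ex(1) \<phi>, of b i b'] res
      by (auto simp: minimal_graded_free_resolution_def)
    then show "mat_mult (B' i) (\<lambda>b c. Poly_Mapping.lookup (f (Suc i) b c) 0)
        (\<lambda>c e. Poly_Mapping.lookup (g (Suc i) c e) 0) b b' = id_mat b b'"
      unfolding lookup_mat_mult_0 .
  qed
qed

lemma betti_eq:
  fixes D :: "nat \<Rightarrow> nat \<Rightarrow> nat \<Rightarrow> ('x, 'k::field) mpol"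
  assumes "minimal_graded_free_resolution X B D \<epsilon> M"
  shows "betti X M i = card (B i)"
  unfolding betti_def
proof (rule the_equality)
  show "\<exists>(B' :: nat \<Rightarrow> nat set) D \<epsilon>. minimal_graded_free_resolution X B' D \<epsilon> M \<and> card (B' i) = card (B i)"
    using assms by blast
  fix n assume "\<exists>(B' :: nat \<Rightarrow> nat set) D \<epsilon>. minimal_graded_free_resolution X B' D \<epsilon> M \<and> card (B' i) = n"
  then show "n = card (B i)"
    using minimal_resolution_card_le assms le_antisym by metis
qed

text \<open>\<open>betti\<close> speaks of bases in \<open>nat\<close>, whereas the cells are sets
  of vertices; the resolution is transported along an injection. \<open>T\<close> rewrites a vector
  in the new basis, with value 0 outside.\<close>

lemma minimal_resolution_reindex:
  fixes D :: "nat \<Rightarrow> 'b \<Rightarrow> 'b \<Rightarrow> ('x, 'k::field) mpol" and h :: "'b \<Rightarrow> 'c"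
  assumes res: "minimal_graded_free_resolution X B D \<epsilon> M"
    and h: "inj_on h S" and BS: "\<And>i. B i \<subseteq> S"
  defines "g \<equiv> inv_into S h"
  shows "minimal_graded_free_resolution X (\<lambda>i. h ` B i) (\<lambda>i x y. D i (g x) (g y)) (\<lambda>x. \<epsilon> (g x)) M"
proof -
  let ?B = "\<lambda>i. h ` B i" and ?D = "\<lambda>i x y. D i (g x) (g y)" and ?\<epsilon> = "\<lambda>x. \<epsilon> (g x)"
  define T where "T i f = (\<lambda>x. if x \<in> ?B i then f (g x) else 0)" for i and f :: "'b \<Rightarrow> ('x, 'k) mpol"
  have gh: "g (h b) = b" if "b \<in> B i" for b i
    using that BS h unfolding g_def by (intro inv_into_f_f) auto
  have inj: "inj_on h (B i)" for i using h BS inj_on_subset by blast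
  have T_h: "T i f (h b) = f b" if "b \<in> B i" for i f b using that gh by (simp add: T_def)
  have T_sum: "(\<Sum>x\<in>?B i. T i f x * Q (g x)) = (\<Sum>b\<in>B i. f b * Q b)" for i f and Q :: "'b \<Rightarrow> ('x, 'k) mpol"
    unfolding sum.reindex[OF inj] by (intro sum.cong) (auto simp: T_h gh)
  have FM: "free_mod X (?B i) = T i ` free_mod X (B i)" for i
  proof (rule equalityI; rule subsetI)
    fix f' :: "'c \<Rightarrow> ('x, 'k) mpol" assume f': "f' \<in> free_mod X (?B i)"
    show "f' \<in> T i ` free_mod X (B i)"
    proof (rule image_eqI)
      show "f' = T i (\<lambda>b. if b \<in> B i then f' (h b) else 0)"
        using f' by (auto simp: T_def free_mod_def gh fun_eq_iff)
      show "(\<lambda>b. if b \<in> B i then f' (h b) else 0) \<in> free_mod X (B i)"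
        using f' by (auto simp: free_mod_def)
    qed
  next
    fix f' assume "f' \<in> T i ` free_mod X (B i)"
    then show "f' \<in> free_mod X (?B i)" by (auto simp: free_mod_def T_def gh)
  qed
  have aug: "aug_map (?B 0) ?\<epsilon> (T 0 f) = aug_map (B 0) \<epsilon> f" for f
    unfolding aug_map_def by (rule T_sum)
  have fm: "free_map (?B (Suc i)) (?B i) (?D i) (T (Suc i) f) = T i (free_map (B (Suc i)) (B i) (D i) f)" for i f
  proof
    fix y
    show "free_map (?B (Suc i)) (?B i) (?D i) (T (Suc i) f) y = T i (free_map (B (Suc i)) (B i) (D i) f) y"
    proof (cases "y \<in> ?B i")
      case True
      then obtain c where c: "c \<in> B i" "y = h c" by blast
      have "(\<Sum>x\<in>?B (Suc i). T (Suc i) f x * D i (g x) (g y)) = (\<Sum>b\<in>B (Suc i). f b * D i b (g y))"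
        by (rule T_sum)
      then show ?thesis using c T_h gh by (simp add: free_map_def)
    qed (simp add: free_map_def T_def)
  qed
  have fm_mem: "free_map (B (Suc i)) (B i) (D i) f b = 0" if "b \<notin> B i" for i f b
    using that by (simp add: free_map_def)
  have T0: "T i f = (\<lambda>_. 0) \<longleftrightarrow> f = (\<lambda>_. 0)" if "\<And>b. b \<notin> B i \<Longrightarrow> f b = 0" for i f
  proof
    assume "T i f = (\<lambda>_. 0)"
    then have "f b = 0" for b using T_h[of b i f] that[of b] by (cases "b \<in> B i") auto
    then show "f = (\<lambda>_. 0)" by blast
  qed (auto simp: T_def)
  have fr: "free_resolution X B D \<epsilon> M" using res by (simp add: minimal_graded_free_resolution_def)
  have "free_resolution X ?B ?D ?\<epsilon> M"
    unfolding free_resolution_def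
  proof (intro conjI allI)
    show "finite (?B i)" for i using fr by (simp add: free_resolution_def)
    show "\<forall>b\<in>?B (Suc i). \<forall>c\<in>?B i. ?D i b c \<in> carrier (poly_ring X)" for i
      using fr gh by (auto simp: free_resolution_def)
    show "\<forall>b\<in>?B 0. ?\<epsilon> b \<in> carrier (poly_ring X)"
      using fr gh by (auto simp: free_resolution_def)
    have "aug_map (?B 0) ?\<epsilon> ` free_mod X (?B 0) = aug_map (B 0) \<epsilon> ` free_mod X (B 0)"
      unfolding FM image_image aug ..
    then show "aug_map (?B 0) ?\<epsilon> ` free_mod X (?B 0) = M"
      using fr by (simp add: free_resolution_def)
    have "{f \<in> free_mod X (?B 0). aug_map (?B 0) ?\<epsilon> f = 0} =
        T 0 ` {f \<in> free_mod X (B 0). aug_map (B 0) \<epsilon> f = 0}"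
      unfolding FM using aug by auto
    also have "\<dots> = T 0 ` free_map (B (Suc 0)) (B 0) (D 0) ` free_mod X (B (Suc 0))"
      using fr by (simp add: free_resolution_def)
    finally show "{f \<in> free_mod X (?B 0). aug_map (?B 0) ?\<epsilon> f = 0} =
        free_map (?B (Suc 0)) (?B 0) (?D 0) ` free_mod X (?B (Suc 0))"
      unfolding FM image_image fm .
    fix i
    have "{f \<in> free_mod X (?B (Suc i)). free_map (?B (Suc i)) (?B i) (?D i) f = (\<lambda>_. 0)} =
        T (Suc i) ` {f \<in> free_mod X (B (Suc i)). free_map (B (Suc i)) (B i) (D i) f = (\<lambda>_. 0)}"
      unfolding FM using fm T0 fm_mem by auto
    also have "\<dots> = T (Suc i) ` free_map (B (Suc (Suc i))) (B (Suc i)) (D (Suc i)) ` free_mod X (B (Suc (Suc i)))"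
      using fr by (simp add: free_resolution_def)
    finally show "{f \<in> free_mod X (?B (Suc i)). free_map (?B (Suc i)) (?B i) (?D i) f = (\<lambda>_. 0)} =
        free_map (?B (Suc (Suc i))) (?B (Suc i)) (?D (Suc i)) ` free_mod X (?B (Suc (Suc i)))"
      unfolding FM image_image fm .
  qed
  moreover obtain deg where
    "\<forall>b\<in>B 0. \<forall>t\<in>Poly_Mapping.keys (\<epsilon> b). total_deg t = deg 0 b"
    "\<forall>i. \<forall>b\<in>B (Suc i). \<forall>c\<in>B i. \<forall>t\<in>Poly_Mapping.keys (D i b c). total_deg t + deg i c = deg (Suc i) b"
    using res unfolding minimal_graded_free_resolution_def by blast
  moreover have "\<forall>i. \<forall>b\<in>B (Suc i). \<forall>c\<in>B i. Poly_Mapping.lookup (D i b c) 0 = 0"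
    using res unfolding minimal_graded_free_resolution_def by blast
  ultimately show ?thesis
    unfolding minimal_graded_free_resolution_def
    by (intro conjI exI[of _ "\<lambda>i x. deg i (g x)"]) (simp_all add: gh)
qed

theorem theoremA:
  fixes q s :: nat
    and ord :: "(vertex set \<times> vertex set) set"
    and V :: "(vertex \<times> vertex) set"
  assumes "3 \<le> s" and "s \<le> q"
    and "admissible_order q s ord"
    and "linear_order_on (vertices q) V"
  shows "acyclic_matching (L2 q) (matching q s ord) \<and>
    card (LD_cells q s ord 0) = (q + 1) choose 2 \<and>
    (\<forall>(X :: 'x set) (m :: nat \<Rightarrow> ('x \<Rightarrow>\<^sub>0 nat)) (I :: ('x, 'k::field) mpol set).
       finite X \<and>
       (\<forall>i \<in> {1..q}. Poly_Mapping.keys (m i) \<subseteq> X \<and> square_free_exp (m i)) \<and>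
       minimally_generated X q m I \<and>
       (mon (m 1) :: ('x, 'k) mpol) dvd mon (lcm_exp (m ` {2..s}))
       \<longrightarrow> LD_supports_free_resolution X q s ord V m (ideal_square X I)) \<and>
    (let X = extremal_vars q;
         E2 = ideal_square X (extremal_ideal q s :: (nat set, 'k) mpol set)
     in LD_supports_free_resolution X q s ord V (extremal_gen q s) E2 \<and>
        (\<forall>i. card (LD_cells q s ord i) = betti X E2 i))"
proof (intro conjI allI impI)
  have lin: "linear_order_on (NN q s) ord"
    using assms(3) by (simp add: admissible_order_def)
  show "acyclic_matching (L2 q) (matching q s ord)"
    using toggle.acyclic_matching[OF toggle_L2[OF lin]] by (simp add: matching_eq_toggle[OF lin])
  show "card (LD_cells q s ord 0) = (q + 1) choose 2"
    by (rule card_LD_cells_0[OF assms(1)])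
next
  fix X :: "'x set" and m :: "nat \<Rightarrow> ('x \<Rightarrow>\<^sub>0 nat)" and I :: "('x, 'k) mpol set"
  assume H: "finite X \<and>
       (\<forall>i \<in> {1..q}. Poly_Mapping.keys (m i) \<subseteq> X \<and> square_free_exp (m i)) \<and>
       minimally_generated X q m I \<and>
       (mon (m 1) :: ('x, 'k) mpol) dvd mon (lcm_exp (m ` {2..s}))"
  then have "exp_le (m 1) (lcm_exp (m ` {2..s}))" by (simp add: mon_dvd_iff)
  then have cover: "\<exists>k\<in>{2..s}. Poly_Mapping.lookup (m k) x \<noteq> 0" if "Poly_Mapping.lookup (m 1) x \<noteq> 0" for x
    using that less_lookup_lcm_exp[of "m ` {2..s}" 0 x] unfolding exp_le_def by (fastforce dest: spec[of _ x])
  interpret labelling q s ord V m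
    using assms H cover by unfold_locales (auto simp: square_free_exp_def)
  have "I = genideal (poly_ring X) (mon ` m ` {1..q})" using H by (simp add: minimally_generated_def)
  then show "LD_supports_free_resolution X q s ord V m (ideal_square X I)"
    using LD_supports[of X] H by blast
next
  let ?E = "ideal_square (extremal_vars q) (extremal_ideal q s :: (nat set, 'k) mpol set)"
  note min = extremal_minimal[OF assms, where 'k = 'k]
  obtain h :: "vertex set \<Rightarrow> nat" where h: "inj_on h (L2 q)"
    using finite_imp_inj_to_nat_seg[OF finite_L2[of q]] by blast
  have cells: "LD_cells q s ord i \<subseteq> L2 q" for i
    by (auto simp: LD_cells_def morse_cells_def critical_faces_def)
  have "card (LD_cells q s ord i) = betti (extremal_vars q) ?E i" for i
    using betti_eq[OF minimal_resolution_reindex[OF min(2) h cells], of i]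
      card_image[OF inj_on_subset[OF h cells[of i]]] by simp
  then show "let X = extremal_vars q;
         E2 = ideal_square X (extremal_ideal q s :: (nat set, 'k) mpol set)
     in LD_supports_free_resolution X q s ord V (extremal_gen q s) E2 \<and>
        (\<forall>i. card (LD_cells q s ord i) = betti X E2 i)"
    using min(1) by (simp add: Let_def)
qed

end
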